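(* Let $(M_1,\tilde g_1)$ and $(M_2,\tilde g_2)$ be pseudo-Riemannian manifolds with cometrics $g_1,g_2$, let $\Pi_i$ be a bivector field on $M_i$ ($i=1,2$), let $f$ be a positive smooth function on $M_1$ and $\mu$ a smooth function on $M_1$. Let $\mathcal K,\mathcal K_1,\mathcal K_2$ be the sectional contravariant curvatures of $(M_1\times M_2,g^f,\Pi^\mu)$, $(M_1,g_1,\Pi_1)$, $(M_2,g_2,\Pi_2)$ respectively, and let $\mathcal D^1$ be the Levi-Civita contravariant connection of $(g_1,\Pi_1)$. For any $\alpha_i,\beta_i\in\Gamma(T^*M_i)$, $i=1,2$, one has (at all points where the sectional curvatures involved are defined, i.e. where the denominators are nonzero): 1. $\mathcal K(\alpha_1^h,\beta_1^h)=\mathcal K_1(\alpha_1,\beta_1)^h$; 2. $\displaystyle \mathcal K(\alpha_1^h,\beta_2^v)=\left(\frac{g_1(d\mu,\alpha_1)^2}{4f^2\|\alpha_1\|_1^2}\right)^h\left(\frac{\|J_2\beta_2\|_2^2}{\|\beta_2\|_2^2}\right)^v+\left(\frac{g_1(J_1df,\alpha_1)^2}{4f^2\|\alpha_1\|_1^2}+\frac{g_1(\mathcal D^1_{\alpha_1}(J_1df),\alpha_1)}{2f\|\alpha_1\|_1^2}\right)^h$; 3. $\displaystyle \mathcal K(\alpha_2^v,\beta_2^v)=\left(\frac{\mu^2}{f}\right)^h\mathcal K_2(\alpha_2,\beta_2)^v-\left(\frac{\|d\mu\|_1^2}{4f^2}\right)^h\left(\frac{3\,\Pi_2(\alpha_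2,\beta_2)^2}{\|\alpha_2\|_2^2\|\beta_2\|_2^2-g_2(\alpha_2,\beta_2)^2}\right)^v-\left(\frac{\|J_1df\|_1^2}{4f^2}\right)^h+\left(\frac{g_1(d\mu,J_1df)}{2f^2}\right)^h\left(\frac{\Pi_2(\alpha_2,\beta_2)\,g_2(\alpha_2,\beta_2)}{\|\alpha_2\|_2^2\|\beta_2\|_2^2-g_2(\alpha_2,\beta_2)^2}\right)^v.$
   Context: For a bivector field $\Pi$ on $M$, the anchor map $\sharp_\Pi:T^*M\to TM$ is given by $\beta(\sharp_\Pi(\alpha))=\Pi(\alpha,\beta)$, and the Koszul bracket of 1-forms is $[\alpha,\beta]_\Pi=\mathcal L_{\sharp_\Pi(\alpha)}\beta-\mathcal L_{\sharp_\Pi(\beta)}\alpha-d(\Pi(\alpha,\beta))$. A contravariant connection with respect to $\Pi$ is an $\mathbb R$-bilinear map $\mathcal D:\Gamma(T^*M)\times\Gamma(T^*M)\to\Gamma(T^*M)$ with $\mathcal D_{\varphi\alpha}\beta=\varphi\mathcal D_\alpha\beta$ and $\mathcal D_\alpha(\varphi\beta)=\varphi\mathcal D_\alpha\beta+\sharp_\Pi(\alpha)(\varphi)\beta$. The cometric of a pseudo-Riemannian metric $\tilde g$ is the induced metric $g$ on $T^*M$. The Levi-Civita contravariant connection of $(g,\Pi)$ is the unique contravariant connection with respect to $\Pi$ satisfying $\sharp_\Pi(\alpha).g(\beta,\gamma)=g(\mathcal D_\alpha\beta,\gamma)+g(\beta,\mathcal D_\alpha\gamma)$ and $\mathcal D_\alpha\beta-\mathcal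 D_\beta\alpha=[\alpha,\beta]_\Pi$. Its curvature is $\mathcal R(\alpha,\beta)=\mathcal D_\alpha\mathcal D_\beta-\mathcal D_\beta\mathcal D_\alpha-\mathcal D_{[\alpha,\beta]_\Pi}$. The sectional contravariant curvature of $(M,g,\Pi)$ for 1-forms $\theta,\eta$ is $$\mathcal K(\theta,\eta)=\frac{g(\mathcal R(\theta,\eta)\eta,\theta)}{g(\theta,\theta)g(\eta,\eta)-g(\theta,\eta)^2}.$$ The endomorphism field $J_i$ of $T^*M_i$ is defined by $g_i(J_i\alpha,\beta)=\Pi_i(\alpha,\beta)$, and $\|\alpha\|_i^2=g_i(\alpha,\alpha)$. With $\sigma_i:M_1\times M_2\to M_i$ the projections, lifts of functions and forms are $\omega_1^h=\sigma_1^*\omega_1$, $\omega_2^v=\sigma_2^*\omega_2$. The warped bivector field $\Pi^\mu$ is determined by $\Pi^\mu(\alpha_1^h,\beta_1^h)=\Pi_1(\alpha_1,\beta_1)^h$, $\Pi^\mu(\alpha_2^v,\beta_2^v)=\mu^h\Pi_2(\alpha_2,\beta_2)^v$, $\Pi^\mu(\alpha_1^h,\beta_2^v)=0$, and the contravariant warped metric $g^f$ by $g^f(\alpha_1^h,\beta_1^h)=g_1(\alpha_1,\beta_1)^h$, $g^f(\alpha_2^v,\beta_2^v)=f^hg_2(\alpha_2,\beta_2)^v$, $g^f(\alpha_1^h,\alpha_2^v)=0$. *)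

theory Defs
  imports "HOL-Analysis.Analysis"
begin

section \<open>Smooth manifolds\<close>

fun Ck_on :: "nat \<Rightarrow> 'e::real_normed_vector set \<Rightarrow> ('e \<Rightarrow> 'f::real_normed_vector) \<Rightarrow> bool" where
  "Ck_on 0 S F \<longleftrightarrow> continuous_on S F"
| "Ck_on (Suc k) S F \<longleftrightarrow>
     (\<forall>x\<in>S. F differentiable (at x)) \<and> (\<forall>u. Ck_on k S (\<lambda>x. frechet_derivative F (at x) u))"

text \<open>Only used for open \<open>S\<close>.\<close>

definition smooth_on :: "'e::real_normed_vector set \<Rightarrow> ('e \<Rightarrow> 'f::real_normed_vector) \<Rightarrow> bool" where
  "smooth_on S F \<longleftrightarrow> (\<forall>k. Ck_on k S F)"

text \<open>A manifold is a Hausdorff, second countable type \<open>'a\<close> together with a smooth atlas. A chart is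
  a pair of its domain and its coordinate map, whose values outside the domain are irrelevant. The
  atlas need not be maximal.\<close>

type_synonym ('a, 'e) atlas = "('a set \<times> ('a \<Rightarrow> 'e)) set"

definition smooth_atlas ::
  "('a::{t2_space,second_countable_topology}, 'e::euclidean_space) atlas \<Rightarrow> bool" where
  "smooth_atlas A \<longleftrightarrow>
     (\<Union>(U, c)\<in>A. U) = UNIV \<and>
     (\<forall>(U, c)\<in>A. open U \<and> open (c ` U) \<and> homeomorphism U (c ` U) c (inv_into U c)) \<and>
     (\<forall>(U, c)\<in>A. \<forall>(V, d)\<in>A. smooth_on (c ` (U \<inter> V)) (d \<circ> inv_into U c))"

definition prod_atlas :: "('a, 'e) atlas \<Rightarrow> ('b, 'f) atlas \<Rightarrow> ('a \<times> 'b, 'e \<times> 'f) atlas" where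
  "prod_atlas A B = (\<Union>(U, c)\<in>A. \<Union>(V, d)\<in>B. {(U \<times> V, map_prod c d)})"

definition smooth_functions :: "('a, 'e::euclidean_space) atlas \<Rightarrow> ('a \<Rightarrow> real) set" where
  "smooth_functions A = {\<phi>. \<forall>(U, c)\<in>A. smooth_on (c ` U) (\<phi> \<circ> inv_into U c)}"

section \<open>Tangent and cotangent spaces, vector fields and 1-forms\<close>

text \<open>Tangent vectors at \<open>p\<close> are the derivations at \<open>p\<close> of the algebra of smooth functions,
  and covectors are linear functionals on the tangent space. Both are extended by zero outside their
  proper domain, so that equality of vectors and covectors is equality in HOL.\<close>

type_synonym 'a vec = "('a \<Rightarrow> real) \<Rightarrow> real"
type_synonym 'a covec = "'a vec \<Rightarrow> real"

definition tangent_space :: "('a, 'e::euclidean_space) atlas \<Rightarrow> 'a \<Rightarrow> 'a vec set" where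
  "tangent_space A p = {v.
     (\<forall>\<phi>\<in>smooth_functions A. \<forall>\<psi>\<in>smooth_functions A. \<forall>a b.
        v (\<lambda>x. a * \<phi> x + b * \<psi> x) = a * v \<phi> + b * v \<psi>) \<and>
     (\<forall>\<phi>\<in>smooth_functions A. \<forall>\<psi>\<in>smooth_functions A.
        v (\<lambda>x. \<phi> x * \<psi> x) = \<phi> p * v \<psi> + \<psi> p * v \<phi>) \<and>
     (\<forall>\<phi>. \<phi> \<notin> smooth_functions A \<longrightarrow> v \<phi> = 0)}"

definition linear_form_on :: "('x \<Rightarrow> real) set \<Rightarrow> (('x \<Rightarrow> real) \<Rightarrow> real) \<Rightarrow> bool" where
  "linear_form_on V L \<longleftrightarrow>
     (\<forall>u\<in>V. \<forall>v\<in>V. \<forall>a b. L (\<lambda>x. a * u x + b * v x) = a * L u + b * L v)"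

definition bilinear_form_on ::
  "('x \<Rightarrow> real) set \<Rightarrow> (('x \<Rightarrow> real) \<Rightarrow> ('x \<Rightarrow> real) \<Rightarrow> real) \<Rightarrow> bool" where
  "bilinear_form_on V B \<longleftrightarrow>
     (\<forall>u\<in>V. linear_form_on V (B u)) \<and> (\<forall>u\<in>V. linear_form_on V (\<lambda>v. B v u))"

definition nondegenerate_on ::
  "('x \<Rightarrow> real) set \<Rightarrow> (('x \<Rightarrow> real) \<Rightarrow> ('x \<Rightarrow> real) \<Rightarrow> real) \<Rightarrow> bool" where
  "nondegenerate_on V B \<longleftrightarrow> (\<forall>u\<in>V. (\<forall>v\<in>V. B u v = 0) \<longrightarrow> u = (\<lambda>x. 0))"

definition cotangent_space :: "('a, 'e::euclidean_space) atlas \<Rightarrow> 'a \<Rightarrow> 'a covec set" where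
  "cotangent_space A p = {\<xi>. linear_form_on (tangent_space A p) \<xi> \<and>
     (\<forall>v. v \<notin> tangent_space A p \<longrightarrow> \<xi> v = 0)}"

definition vector_fields :: "('a, 'e::euclidean_space) atlas \<Rightarrow> ('a \<Rightarrow> 'a vec) set" where
  "vector_fields A = {X. (\<forall>p. X p \<in> tangent_space A p) \<and>
     (\<forall>\<phi>\<in>smooth_functions A. (\<lambda>p. X p \<phi>) \<in> smooth_functions A)}"

definition one_forms :: "('a, 'e::euclidean_space) atlas \<Rightarrow> ('a \<Rightarrow> 'a covec) set" where
  "one_forms A = {\<omega>. (\<forall>p. \<omega> p \<in> cotangent_space A p) \<and>
     (\<forall>X\<in>vector_fields A. (\<lambda>p. \<omega> p (X p)) \<in> smooth_functions A)}"

definition exterior_d :: "('a, 'e::euclidean_space) atlas \<Rightarrow> ('a \<Rightarrow> real) \<Rightarrow> 'a \<Rightarrow> 'a covec" where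
  "exterior_d A \<phi> = (\<lambda>p v. if v \<in> tangent_space A p then v \<phi> else 0)"

definition lie_bracket :: "('a \<Rightarrow> 'a vec) \<Rightarrow> ('a \<Rightarrow> 'a vec) \<Rightarrow> 'a \<Rightarrow> 'a vec" where
  "lie_bracket X Y = (\<lambda>p \<phi>. X p (\<lambda>q. Y q \<phi>) - Y p (\<lambda>q. X q \<phi>))"

text \<open>The Lie derivative of a 1-form is determined by
  \<open>(L\<^sub>X \<beta>)(Y) = X (\<beta>(Y)) - \<beta>([X, Y])\<close>.\<close>

definition lie_derivative ::
  "('a, 'e::euclidean_space) atlas \<Rightarrow> ('a \<Rightarrow> 'a vec) \<Rightarrow> ('a \<Rightarrow> 'a covec) \<Rightarrow> 'a \<Rightarrow> 'a covec" where
  "lie_derivative A X \<beta> = (THE \<omega>. \<omega> \<in> one_forms A \<and>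
     (\<forall>Y\<in>vector_fields A. \<forall>p.
        \<omega> p (Y p) = X p (\<lambda>q. \<beta> q (Y q)) - \<beta> p (lie_bracket X Y p)))"

text \<open>Pullback of 1-forms along a smooth map \<open>h\<close> from the manifold \<open>(UNIV, B)\<close> to the manifold
  \<open>(UNIV, A)\<close>.\<close>

definition pushforward :: "('a, 'e::euclidean_space) atlas \<Rightarrow> ('b \<Rightarrow> 'a) \<Rightarrow> 'b vec \<Rightarrow> 'a vec" where
  "pushforward A h v = (\<lambda>\<phi>. if \<phi> \<in> smooth_functions A then v (\<phi> \<circ> h) else 0)"

definition pullback :: "('a, 'e::euclidean_space) atlas \<Rightarrow> ('b, 'f::euclidean_space) atlas \<Rightarrow>
    ('b \<Rightarrow> 'a) \<Rightarrow> ('a \<Rightarrow> 'a covec) \<Rightarrow> 'b \<Rightarrow> 'b covec" where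
  "pullback A B h \<omega> =
     (\<lambda>p v. if v \<in> tangent_space B p then \<omega> (h p) (pushforward A h v) else 0)"

definition hlift :: "('a, 'e::euclidean_space) atlas \<Rightarrow> ('b, 'f::euclidean_space) atlas \<Rightarrow>
    ('a \<Rightarrow> 'a covec) \<Rightarrow> 'a \<times> 'b \<Rightarrow> ('a \<times> 'b) covec" where
  "hlift A B \<omega> = pullback A (prod_atlas A B) fst \<omega>"

definition vlift :: "('a, 'e::euclidean_space) atlas \<Rightarrow> ('b, 'f::euclidean_space) atlas \<Rightarrow>
    ('b \<Rightarrow> 'b covec) \<Rightarrow> 'a \<times> 'b \<Rightarrow> ('a \<times> 'b) covec" where
  "vlift A B \<omega> = pullback B (prod_atlas A B) snd \<omega>"

section \<open>Metrics, cometrics and bivector fields\<close>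

type_synonym 'a metric = "'a \<Rightarrow> 'a vec \<Rightarrow> 'a vec \<Rightarrow> real"
type_synonym 'a cotensor = "'a \<Rightarrow> 'a covec \<Rightarrow> 'a covec \<Rightarrow> real"

definition pseudo_riemannian :: "('a, 'e::euclidean_space) atlas \<Rightarrow> 'a metric \<Rightarrow> bool" where
  "pseudo_riemannian A gt \<longleftrightarrow>
     (\<forall>p. bilinear_form_on (tangent_space A p) (gt p) \<and>
          (\<forall>v\<in>tangent_space A p. \<forall>w\<in>tangent_space A p. gt p v w = gt p w v) \<and>
          nondegenerate_on (tangent_space A p) (gt p)) \<and>
     (\<forall>X\<in>vector_fields A. \<forall>Y\<in>vector_fields A. (\<lambda>p. gt p (X p) (Y p)) \<in> smooth_functions A)"

definition metric_sharp ::
  "('a, 'e::euclidean_space) atlas \<Rightarrow> 'a metric \<Rightarrow> 'a \<Rightarrow> 'a covec \<Rightarrow> 'a vec" where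
  "metric_sharp A gt p \<xi> =
     (THE v. v \<in> tangent_space A p \<and> (\<forall>w\<in>tangent_space A p. gt p v w = \<xi> w))"

definition cometric :: "('a, 'e::euclidean_space) atlas \<Rightarrow> 'a metric \<Rightarrow> 'a cotensor" where
  "cometric A gt = (\<lambda>p \<xi> \<zeta>. gt p (metric_sharp A gt p \<xi>) (metric_sharp A gt p \<zeta>))"

definition tensor_pair ::
  "'a cotensor \<Rightarrow> ('a \<Rightarrow> 'a covec) \<Rightarrow> ('a \<Rightarrow> 'a covec) \<Rightarrow> 'a \<Rightarrow> real" where
  "tensor_pair T \<alpha> \<beta> = (\<lambda>p. T p (\<alpha> p) (\<beta> p))"

definition smooth_cotensor :: "('a, 'e::euclidean_space) atlas \<Rightarrow> 'a cotensor \<Rightarrow> bool" where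
  "smooth_cotensor A T \<longleftrightarrow>
     (\<forall>p. bilinear_form_on (cotangent_space A p) (T p)) \<and>
     (\<forall>\<alpha>\<in>one_forms A. \<forall>\<beta>\<in>one_forms A. tensor_pair T \<alpha> \<beta> \<in> smooth_functions A)"

definition contravariant_metric :: "('a, 'e::euclidean_space) atlas \<Rightarrow> 'a cotensor \<Rightarrow> bool" where
  "contravariant_metric A g \<longleftrightarrow> smooth_cotensor A g \<and>
     (\<forall>p. (\<forall>\<xi>\<in>cotangent_space A p. \<forall>\<zeta>\<in>cotangent_space A p. g p \<xi> \<zeta> = g p \<zeta> \<xi>) \<and>
          nondegenerate_on (cotangent_space A p) (g p))"

definition bivector_field :: "('a, 'e::euclidean_space) atlas \<Rightarrow> 'a cotensor \<Rightarrow> bool" where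
  "bivector_field A P \<longleftrightarrow> smooth_cotensor A P \<and>
     (\<forall>p. \<forall>\<xi>\<in>cotangent_space A p. \<forall>\<zeta>\<in>cotangent_space A p. P p \<xi> \<zeta> = - P p \<zeta> \<xi>)"

definition anchor ::
  "('a, 'e::euclidean_space) atlas \<Rightarrow> 'a cotensor \<Rightarrow> ('a \<Rightarrow> 'a covec) \<Rightarrow> 'a \<Rightarrow> 'a vec" where
  "anchor A P \<alpha> = (\<lambda>p. THE v. v \<in> tangent_space A p \<and>
     (\<forall>\<xi>\<in>cotangent_space A p. \<xi> v = P p (\<alpha> p) \<xi>))"

definition endo_J :: "('a, 'e::euclidean_space) atlas \<Rightarrow> 'a cotensor \<Rightarrow> 'a cotensor \<Rightarrow>
    ('a \<Rightarrow> 'a covec) \<Rightarrow> 'a \<Rightarrow> 'a covec" where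
  "endo_J A g P \<alpha> = (\<lambda>p. THE \<xi>. \<xi> \<in> cotangent_space A p \<and>
     (\<forall>\<zeta>\<in>cotangent_space A p. g p \<xi> \<zeta> = P p (\<alpha> p) \<zeta>))"

definition koszul_bracket :: "('a, 'e::euclidean_space) atlas \<Rightarrow> 'a cotensor \<Rightarrow>
    ('a \<Rightarrow> 'a covec) \<Rightarrow> ('a \<Rightarrow> 'a covec) \<Rightarrow> 'a \<Rightarrow> 'a covec" where
  "koszul_bracket A P \<alpha> \<beta> = (\<lambda>p v.
     lie_derivative A (anchor A P \<alpha>) \<beta> p v - lie_derivative A (anchor A P \<beta>) \<alpha> p v
     - exterior_d A (tensor_pair P \<alpha> \<beta>) p v)"

section \<open>Contravariant connections and curvature\<close>

type_synonym 'a connection = "('a \<Rightarrow> 'a covec) \<Rightarrow> ('a \<Rightarrow> 'a covec) \<Rightarrow> 'a \<Rightarrow> 'a covec"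

definition contravariant_connection ::
  "('a, 'e::euclidean_space) atlas \<Rightarrow> 'a cotensor \<Rightarrow> 'a connection \<Rightarrow> bool" where
  "contravariant_connection A P D \<longleftrightarrow>
     (\<forall>\<alpha>\<in>one_forms A. \<forall>\<beta>\<in>one_forms A. D \<alpha> \<beta> \<in> one_forms A) \<and>
     (\<forall>\<alpha>\<in>one_forms A. \<forall>\<alpha>'\<in>one_forms A. \<forall>\<beta>\<in>one_forms A. \<forall>a b.
        D (\<lambda>p v. a * \<alpha> p v + b * \<alpha>' p v) \<beta> = (\<lambda>p v. a * D \<alpha> \<beta> p v + b * D \<alpha>' \<beta> p v)) \<and>
     (\<forall>\<alpha>\<in>one_forms A. \<forall>\<beta>\<in>one_forms A. \<forall>\<beta>'\<in>one_forms A. \<forall>a b.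
        D \<alpha> (\<lambda>p v. a * \<beta> p v + b * \<beta>' p v) = (\<lambda>p v. a * D \<alpha> \<beta> p v + b * D \<alpha> \<beta>' p v)) \<and>
     (\<forall>\<phi>\<in>smooth_functions A. \<forall>\<alpha>\<in>one_forms A. \<forall>\<beta>\<in>one_forms A.
        D (\<lambda>p v. \<phi> p * \<alpha> p v) \<beta> = (\<lambda>p v. \<phi> p * D \<alpha> \<beta> p v) \<and>
        D \<alpha> (\<lambda>p v. \<phi> p * \<beta> p v) = (\<lambda>p v. \<phi> p * D \<alpha> \<beta> p v + anchor A P \<alpha> p \<phi> * \<beta> p v))"

text \<open>As the connection is unique on 1-forms, ``the'' Levi-Civita contravariant connection is any
  \<open>D\<close> with the following property; the values of \<open>D\<close> on arguments that are not 1-forms are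
  irrelevant.\<close>

definition levi_civita_connection ::
  "('a, 'e::euclidean_space) atlas \<Rightarrow> 'a cotensor \<Rightarrow> 'a cotensor \<Rightarrow> 'a connection \<Rightarrow> bool" where
  "levi_civita_connection A g P D \<longleftrightarrow> contravariant_connection A P D \<and>
     (\<forall>\<alpha>\<in>one_forms A. \<forall>\<beta>\<in>one_forms A. \<forall>\<gamma>\<in>one_forms A. \<forall>p.
        anchor A P \<alpha> p (tensor_pair g \<beta> \<gamma>)
          = tensor_pair g (D \<alpha> \<beta>) \<gamma> p + tensor_pair g \<beta> (D \<alpha> \<gamma>) p) \<and>
     (\<forall>\<alpha>\<in>one_forms A. \<forall>\<beta>\<in>one_forms A.
        (\<lambda>p v. D \<alpha> \<beta> p v - D \<beta> \<alpha> p v) = koszul_bracket A P \<alpha> \<beta>)"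

definition contra_curvature :: "('a, 'e::euclidean_space) atlas \<Rightarrow> 'a cotensor \<Rightarrow> 'a connection \<Rightarrow>
    ('a \<Rightarrow> 'a covec) \<Rightarrow> ('a \<Rightarrow> 'a covec) \<Rightarrow> ('a \<Rightarrow> 'a covec) \<Rightarrow> 'a \<Rightarrow> 'a covec" where
  "contra_curvature A P D \<alpha> \<beta> \<gamma> = (\<lambda>p v.
     D \<alpha> (D \<beta> \<gamma>) p v - D \<beta> (D \<alpha> \<gamma>) p v - D (koszul_bracket A P \<alpha> \<beta>) \<gamma> p v)"

definition gram ::
  "'a cotensor \<Rightarrow> ('a \<Rightarrow> 'a covec) \<Rightarrow> ('a \<Rightarrow> 'a covec) \<Rightarrow> 'a \<Rightarrow> real" where
  "gram g \<theta> \<eta> p = tensor_pair g \<theta> \<theta> p * tensor_pair g \<eta> \<eta> p - (tensor_pair g \<theta> \<eta> p)\<^sup>2"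

text \<open>For a general bivector field the curvature is not tensorial in its third argument, so the
  sectional curvature at a point depends on the 1-forms and not only on their values at that point.\<close>

definition sectional_curvature :: "('a, 'e::euclidean_space) atlas \<Rightarrow> 'a cotensor \<Rightarrow> 'a cotensor \<Rightarrow>
    'a connection \<Rightarrow> ('a \<Rightarrow> 'a covec) \<Rightarrow> ('a \<Rightarrow> 'a covec) \<Rightarrow> 'a \<Rightarrow> real" where
  "sectional_curvature A g P D \<theta> \<eta> p =
     tensor_pair g (contra_curvature A P D \<theta> \<eta> \<eta>) \<theta> p / gram g \<theta> \<eta> p"

section \<open>Warped structures on a product\<close>

text \<open>The covectors \<open>\<sigma>\<^sub>1\<^sup>*\<omega>\<^sub>1\<close> and \<open>\<sigma>\<^sub>2\<^sup>*\<omega>\<^sub>2\<close> span each cotangent space of the product, so the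
  equations below determine the tensor fields.\<close>

definition warped_bivector :: "('a, 'e::euclidean_space) atlas \<Rightarrow> ('b, 'f::euclidean_space) atlas \<Rightarrow>
    ('a \<Rightarrow> real) \<Rightarrow> 'a cotensor \<Rightarrow> 'b cotensor \<Rightarrow> ('a \<times> 'b) cotensor \<Rightarrow> bool" where
  "warped_bivector A B \<mu> P1 P2 P \<longleftrightarrow> bivector_field (prod_atlas A B) P \<and>
     (\<forall>\<alpha>1\<in>one_forms A. \<forall>\<beta>1\<in>one_forms A. \<forall>p q.
        tensor_pair P (hlift A B \<alpha>1) (hlift A B \<beta>1) (p, q) = tensor_pair P1 \<alpha>1 \<beta>1 p) \<and>
     (\<forall>\<alpha>2\<in>one_forms B. \<forall>\<beta>2\<in>one_forms B. \<forall>p q.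
        tensor_pair P (vlift A B \<alpha>2) (vlift A B \<beta>2) (p, q) = \<mu> p * tensor_pair P2 \<alpha>2 \<beta>2 q) \<and>
     (\<forall>\<alpha>1\<in>one_forms A. \<forall>\<beta>2\<in>one_forms B. \<forall>p q.
        tensor_pair P (hlift A B \<alpha>1) (vlift A B \<beta>2) (p, q) = 0)"

definition warped_metric :: "('a, 'e::euclidean_space) atlas \<Rightarrow> ('b, 'f::euclidean_space) atlas \<Rightarrow>
    ('a \<Rightarrow> real) \<Rightarrow> 'a cotensor \<Rightarrow> 'b cotensor \<Rightarrow> ('a \<times> 'b) cotensor \<Rightarrow> bool" where
  "warped_metric A B f g1 g2 g \<longleftrightarrow> contravariant_metric (prod_atlas A B) g \<and>
     (\<forall>\<alpha>1\<in>one_forms A. \<forall>\<beta>1\<in>one_forms A. \<forall>p q.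
        tensor_pair g (hlift A B \<alpha>1) (hlift A B \<beta>1) (p, q) = tensor_pair g1 \<alpha>1 \<beta>1 p) \<and>
     (\<forall>\<alpha>2\<in>one_forms B. \<forall>\<beta>2\<in>one_forms B. \<forall>p q.
        tensor_pair g (vlift A B \<alpha>2) (vlift A B \<beta>2) (p, q) = f p * tensor_pair g2 \<alpha>2 \<beta>2 q) \<and>
     (\<forall>\<alpha>1\<in>one_forms A. \<forall>\<alpha>2\<in>one_forms B. \<forall>p q.
        tensor_pair g (hlift A B \<alpha>1) (vlift A B \<alpha>2) (p, q) = 0)"

end

(* On a manifold given by derivations of the global smooth functions, Hadamard's lemma and cut-off
   functions provide local frames. Hence a function-linear operation on vector fields is a 1-form, a
   1-form is locally a combination of exact forms, and the Lie derivative and the Koszul bracket exist.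

   On the product the Koszul brackets of lifts are
     [a^h, b^h] = [a, b]^h,   [a^h, b^v] = 0,   [a^v, b^v] = mu^h [a, b]^v + P2(a, b)^v (d mu)^h,
   and the Koszul formula gives the connection on lifts:
     D_(a^h) b^h = (D1_a b)^h,
     D_(a^v) b^v = 1/2 g2(a, b)^v (J1 df)^h + 1/2 P2(a, b)^v (d mu)^h + mu^h (D2_a b)^v,
     D_(a^h) b^v = D_(b^v) a^h = -1/(2f)^h (g1(J1 df, a)^h b^v + g1(d mu, a)^h (J2 b)^v).
   Metric compatibility rewrites g(D_x D_y z, w) as #x.g(D_y z, w) - g(D_y z, D_x w), so the curvature
   only requires pairings of these values. *)

theory Submission
  imports Defs "HOL-Real_Asymp.Real_Asymp"
begin

text \<open>All functions, fields and forms live on the whole manifold; cut-offs take the place of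
  restriction to a chart. The descriptions by \<open>THE\<close> in the definitions become usable
  once a candidate is exhibited, either by expansion in a frame or by tensoriality. The two warping
  functions reach the connection by different routes. The function f enters through the metric: the
  anchor of a^h differentiates f g2(b, c), and P1(a, df) = - g1(J1 df, a), so that df is seen only
  through J1 df. The function mu enters through the bracket: for exact vertical forms the bracket is
  d(mu P2(a, b)), and the product rule leaves P2(a, b) dmu, a horizontal part in a bracket of
  vertical forms. The endomorphism J2 appears only when P2(b, c) = g2(J2 b, c) is used to write a
  pairing as one with a vertical lift. In the mixed curvature the identities P2(b, b) = 0 = g2(J2 b,
  b) remove every cross term. In the vertical one the cross term g1(dmu, J1 df) comes from the
  bracket alone.\<close>

section \<open>Calculus of C^k and smooth maps on open sets\<close>

lemma Ck_on_cong:
  assumes "open S" "\<And>x. x \<in> S \<Longrightarrow> F x = G x" "Ck_on k S F"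
  shows "Ck_on k S G"
  using assms(2,3)
proof (induction k arbitrary: F G)
  case 0
  then show ?case using continuous_on_cong[of S S F G] by simp
next
  case (Suc k)
  \<comment> \<open>The filter \<open>at x\<close> is not restricted to S; agreement on S transfers
    the derivative because S is open.\<close>
  have d: "(G has_derivative frechet_derivative F (at x)) (at x)" if "x \<in> S" for x
  proof (rule has_derivative_transform_within_open[OF _ assms(1) that])
    show "(F has_derivative frechet_derivative F (at x)) (at x)"
      using Suc.prems that by (simp add: frechet_derivative_works)
  qed (use Suc.prems in auto)
  then have eq: "frechet_derivative F (at x) = frechet_derivative G (at x)" if "x \<in> S" for x
    using that frechet_derivative_at by blast
  have "Ck_on k S (\<lambda>x. frechet_derivative G (at x) u)" for u
    by (rule Suc.IH[of "\<lambda>x. frechet_derivative F (at x) u"]) (use Suc.prems eq in simp_all)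
  then show ?case using d by (auto simp: differentiable_def)
qed

text \<open>Replaces the choice-defined \<open>frechet_derivative\<close> by any explicitly known
  derivative, by uniqueness of derivatives. The closure rules that follow combine it with a
  differentiation rule and an induction on k.\<close>

lemma Ck_on_SucI:
  assumes "open S" "\<And>x. x \<in> S \<Longrightarrow> (F has_derivative F' x) (at x)"
    "\<And>u. Ck_on k S (\<lambda>x. F' x u)"
  shows "Ck_on (Suc k) S F"
proof -
  have "frechet_derivative F (at x) = F' x" if "x \<in> S" for x
    using frechet_derivative_at[OF assms(2)[OF that]] by simp
  then have "Ck_on k S (\<lambda>x. frechet_derivative F (at x) u)" for u
    by (intro Ck_on_cong[OF assms(1) _ assms(3)]) auto
  then show ?thesis using assms(2) by (auto simp: differentiable_def)
qed

lemma Ck_on_SucD: "Ck_on (Suc k) S F \<Longrightarrow> Ck_on k S F"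
  by (induction k arbitrary: F)
    (auto intro!: continuous_at_imp_continuous_on differentiable_imp_continuous_within)

lemma Ck_on_continuous_on: "Ck_on k S F \<Longrightarrow> continuous_on S F"
  by (induction k) (auto dest: Ck_on_SucD simp del: Ck_on.simps(2))

lemma Ck_on_derivative:
  "Ck_on (Suc k) S F \<Longrightarrow> x \<in> S \<Longrightarrow> (F has_derivative frechet_derivative F (at x)) (at x)"
  by (simp add: frechet_derivative_works)

lemma Ck_on_locally:
  assumes "\<And>x. x \<in> S \<Longrightarrow> \<exists>T. open T \<and> x \<in> T \<and> Ck_on k T F"
  shows "Ck_on k S F"
  using assms
proof (induction k arbitrary: F)
  case 0
  then show ?case
    by (metis Ck_on.simps(1) continuous_at_imp_continuous_on continuous_on_eq_continuous_at)
next
  case (Suc k)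
  have "Ck_on k S (\<lambda>x. frechet_derivative F (at x) u)" for u
    by (rule Suc.IH) (use Suc.prems in force)
  moreover have "\<forall>x\<in>S. F differentiable (at x)" using Suc.prems by force
  ultimately show ?case by simp
qed

lemma Ck_on_subset: "Ck_on k S F \<Longrightarrow> T \<subseteq> S \<Longrightarrow> Ck_on k T F"
  by (induction k arbitrary: F) (auto intro: continuous_on_subset)

lemma Ck_on_const: "open S \<Longrightarrow> Ck_on k S (\<lambda>x. c)"
proof (induction k arbitrary: c)
  case (Suc k)
  show ?case by (rule Ck_on_SucI[OF Suc.prems has_derivative_const]) (use Suc in auto)
qed simp

lemma Ck_on_linear:
  assumes "bounded_linear L" "open S"
  shows "Ck_on k S L"
proof (cases k)
  case 0
  then show ?thesis using assms by (simp add: linear_continuous_on)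
next
  case (Suc n)
  then show ?thesis
    using Ck_on_SucI[OF assms(2), of L "\<lambda>x. L"] assms
    by (auto intro: bounded_linear_imp_has_derivative Ck_on_const)
qed

lemma Ck_on_add:
  assumes "open S" "Ck_on k S F" "Ck_on k S G"
  shows "Ck_on k S (\<lambda>x. F x + G x)"
  using assms(2,3)
proof (induction k arbitrary: F G)
  case (Suc k)
  show ?case
    by (rule Ck_on_SucI[OF assms(1)
          has_derivative_add[OF Suc.prems[THEN Ck_on_derivative]]])
      (use Suc.prems Suc.IH in simp_all)
qed (auto intro!: continuous_intros)

lemma Ck_on_scaleR:
  fixes F :: "'x::real_normed_vector \<Rightarrow> real"
  assumes "open S" "Ck_on k S F" "Ck_on k S G"
  shows "Ck_on k S (\<lambda>x. F x *\<^sub>R G x)"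
  using assms(2,3)
proof (induction k arbitrary: F G)
  case (Suc k)
  have "Ck_on k S (\<lambda>x. F x *\<^sub>R frechet_derivative G (at x) u + frechet_derivative F (at x) u *\<^sub>R G x)" for u
    using Suc.prems Suc.prems[THEN Ck_on_SucD] by (intro Ck_on_add[OF assms(1)] Suc.IH) simp_all
  then show ?case
    by (intro Ck_on_SucI[OF assms(1) has_derivative_scaleR[OF Suc.prems[THEN Ck_on_derivative]]])
qed (auto intro!: continuous_intros)

lemma Ck_on_mult:
  fixes F G :: "'x::real_normed_vector \<Rightarrow> real"
  assumes "open S" "Ck_on k S F" "Ck_on k S G"
  shows "Ck_on k S (\<lambda>x. F x * G x)"
  using Ck_on_scaleR[OF assms] by simp

lemma Ck_on_sum:
  assumes "open S" "\<And>i. i \<in> I \<Longrightarrow> Ck_on k S (F i)"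
  shows "Ck_on k S (\<lambda>x. \<Sum>i\<in>I. F i x)"
  using assms(2)
  by (induction I rule: infinite_finite_induct)
    (auto intro: Ck_on_const Ck_on_add assms(1))

lemma Ck_on_bounded_linear:
  assumes "open S" "bounded_linear L" "Ck_on k S F"
  shows "Ck_on k S (\<lambda>x. L (F x))"
  using assms(3)
proof (induction k arbitrary: F)
  case 0
  then show ?case using bounded_linear.continuous_on[OF assms(2)] by auto
next
  case (Suc k)
  show ?case
    by (rule Ck_on_SucI[OF assms(1)
          bounded_linear.has_derivative[OF assms(2) Ck_on_derivative[OF Suc.prems]]])
      (use Suc.prems Suc.IH in simp_all)
qed

text \<open>The chain rule gives a derivative of G in the direction DF(x) u, which moves with x,
  whereas \<open>Ck_on\<close> controls only fixed directions. Expanding the direction in a basis of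
  the Euclidean middle space turns it into a finite sum of products, each C^k by induction.\<close>

lemma Ck_on_compose:
  fixes F :: "'x::real_normed_vector \<Rightarrow> 'y::euclidean_space" and G :: "'y \<Rightarrow> 'z::real_normed_vector"
  assumes "open S" "open T" "F ` S \<subseteq> T" "Ck_on k S F" "Ck_on k T G"
  shows "Ck_on k S (\<lambda>x. G (F x))"
  using assms(4,5)
proof (induction k arbitrary: G)
  case 0
  then show ?case using assms(3) by (auto intro: continuous_on_compose2)
next
  case (Suc k)
  have FT: "F x \<in> T" if "x \<in> S" for x using assms(3) that by auto
  have d: "((\<lambda>x. G (F x)) has_derivative
      (\<lambda>u. frechet_derivative G (at (F x)) (frechet_derivative F (at x) u))) (at x)" if "x \<in> S" for x
    using diff_chain_at[OF Ck_on_derivative[OF Suc.prems(1) that]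
        Ck_on_derivative[OF Suc.prems(2) FT[OF that]]] by (simp add: o_def)
  have eq: "(\<Sum>i\<in>Basis. (frechet_derivative F (at x) u \<bullet> i) *\<^sub>R frechet_derivative G (at (F x)) i)
      = frechet_derivative G (at (F x)) (frechet_derivative F (at x) u)" if "x \<in> S" for x u
  proof -
    have "linear (frechet_derivative G (at (F x)))"
      using Ck_on_derivative[OF Suc.prems(2) FT[OF that]] has_derivative_linear by blast
    then have "frechet_derivative G (at (F x)) (\<Sum>i\<in>Basis. (frechet_derivative F (at x) u \<bullet> i) *\<^sub>R i)
        = (\<Sum>i\<in>Basis. (frechet_derivative F (at x) u \<bullet> i) *\<^sub>R frechet_derivative G (at (F x)) i)"
      by (simp add: linear_sum linear_scale)
    then show ?thesis by (simp add: euclidean_representation)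
  qed
  have C: "Ck_on k S (\<lambda>x. frechet_derivative G (at (F x)) (frechet_derivative F (at x) u))" for u
  proof (rule Ck_on_cong[OF assms(1) eq])
    show "Ck_on k S (\<lambda>x. \<Sum>i\<in>Basis. (frechet_derivative F (at x) u \<bullet> i) *\<^sub>R frechet_derivative G (at
        (F x)) i)"
      using Suc.prems
      by (intro Ck_on_sum Ck_on_scaleR Ck_on_bounded_linear[OF _ bounded_linear_inner_left]
          Suc.IH[OF Ck_on_SucD[OF Suc.prems(1)]] assms(1)) simp_all
  qed
  show ?case by (rule Ck_on_SucI[OF assms(1) d C])
qed

lemma smooth_on_cong: "open S \<Longrightarrow> (\<And>x. x \<in> S \<Longrightarrow> F x = G x) \<Longrightarrow> smooth_on S F \<Longrightarrow> smooth_on S G"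
  unfolding smooth_on_def using Ck_on_cong by blast

lemma smooth_on_subset: "smooth_on S F \<Longrightarrow> T \<subseteq> S \<Longrightarrow> smooth_on T F"
  unfolding smooth_on_def using Ck_on_subset by blast

lemma smooth_on_locally:
  "(\<And>x. x \<in> S \<Longrightarrow> \<exists>T. open T \<and> x \<in> T \<and> smooth_on T F) \<Longrightarrow> smooth_on S F"
  unfolding smooth_on_def by (metis Ck_on_locally)

lemma smooth_on_const: "open S \<Longrightarrow> smooth_on S (\<lambda>x. c)"
  by (simp add: smooth_on_def Ck_on_const)

lemma smooth_on_linear: "bounded_linear L \<Longrightarrow> open S \<Longrightarrow> smooth_on S L"
  by (simp add: smooth_on_def Ck_on_linear)

lemma smooth_on_bounded_linear:
  "open S \<Longrightarrow> bounded_linear L \<Longrightarrow> smooth_on S F \<Longrightarrow> smooth_on S (\<lambda>x. L (F x))"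
  by (simp add: smooth_on_def Ck_on_bounded_linear)

lemma smooth_on_add:
  "open S \<Longrightarrow> smooth_on S F \<Longrightarrow> smooth_on S G \<Longrightarrow> smooth_on S (\<lambda>x. F x + G x)"
  by (simp add: smooth_on_def Ck_on_add)

lemma smooth_on_mult:
  fixes F G :: "'x::real_normed_vector \<Rightarrow> real"
  shows "open S \<Longrightarrow> smooth_on S F \<Longrightarrow> smooth_on S G \<Longrightarrow> smooth_on S (\<lambda>x. F x * G x)"
  by (simp add: smooth_on_def Ck_on_mult)

lemma smooth_on_sum:
  "open S \<Longrightarrow> (\<And>i. i \<in> I \<Longrightarrow> smooth_on S (F i)) \<Longrightarrow> smooth_on S (\<lambda>x. \<Sum>i\<in>I. F i x)"
  by (simp add: smooth_on_def Ck_on_sum)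

lemma smooth_on_compose:
  fixes F :: "'x::real_normed_vector \<Rightarrow> 'y::euclidean_space" and G :: "'y \<Rightarrow> 'z::real_normed_vector"
  shows "open S \<Longrightarrow> open T \<Longrightarrow> F ` S \<subseteq> T \<Longrightarrow> smooth_on S F \<Longrightarrow> smooth_on T G
    \<Longrightarrow> smooth_on S (\<lambda>x. G (F x))"
  unfolding smooth_on_def using Ck_on_compose by blast

lemma smooth_on_derivative:
  "smooth_on S F \<Longrightarrow> x \<in> S \<Longrightarrow> (F has_derivative frechet_derivative F (at x)) (at x)"
  unfolding smooth_on_def using Ck_on_derivative by blast

lemma smooth_on_frechet_derivative:
  "smooth_on S F \<Longrightarrow> smooth_on S (\<lambda>x. frechet_derivative F (at x) u)"
  unfolding smooth_on_def using Ck_on.simps(2) by blast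

section \<open>Bump functions\<close>

text \<open>The powers of \<open>1/t\<close> make the family closed under differentiation.\<close>

definition flat_exp :: "nat \<Rightarrow> real \<Rightarrow> real" where
  "flat_exp n t = (if t > 0 then inverse t ^ n * exp (- inverse t) else 0)"

lemma flat_exp_tendsto_0: "(flat_exp n \<longlongrightarrow> 0) (at 0)"
proof (rule filterlim_split_at_real)
  have "((\<lambda>t::real. inverse t ^ n * exp (- inverse t)) \<longlongrightarrow> 0) (at_right 0)"
    by real_asymp
  then show "(flat_exp n \<longlongrightarrow> 0) (at_right 0)"
    by (rule Lim_transform_eventually) (auto simp: eventually_at_filter flat_exp_def)
  show "(flat_exp n \<longlongrightarrow> 0) (at_left 0)"
    by (rule Lim_transform_eventually[OF tendsto_const])
      (auto simp: eventually_at_filter flat_exp_def)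
qed

lemma DERIV_flat_exp:
  "(flat_exp n has_field_derivative flat_exp (n + 2) x - of_nat n * flat_exp (n + 1) x) (at x)"
proof -
  consider "x > 0" | "x < 0" | "x = 0" by linarith
  then show ?thesis
  proof cases
    case 1
    have "((\<lambda>t. inverse t ^ n * exp (- inverse t)) has_field_derivative
        (of_nat n * inverse x ^ (n - 1) * (- (inverse x ^ 2)) * exp (- inverse x)
        + inverse x ^ n * (exp (- inverse x) * inverse x ^ 2))) (at x)"
      using 1 by (auto intro!: derivative_eq_intros simp: power2_eq_square)
    also have "of_nat n * inverse x ^ (n - 1) * (- (inverse x ^ 2)) * exp (- inverse x)
        + inverse x ^ n * (exp (- inverse x) * inverse x ^ 2)
        = flat_exp (n + 2) x - of_nat n * flat_exp (n + 1) x"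
      using 1 by (cases n) (simp_all add: flat_exp_def power2_eq_square algebra_simps)
    finally have "((\<lambda>t. inverse t ^ n * exp (- inverse t)) has_field_derivative
        flat_exp (n + 2) x - of_nat n * flat_exp (n + 1) x) (at x)" .
    then show ?thesis
      by (rule has_field_derivative_transform_within_open[of _ _ _ "{0<..}"])
        (use 1 in \<open>auto simp: flat_exp_def\<close>)
  next
    case 2
    then have "((\<lambda>t. 0) has_field_derivative
        flat_exp (n + 2) x - of_nat n * flat_exp (n + 1) x) (at x)"
      by (simp add: flat_exp_def)
    then show ?thesis
      by (rule has_field_derivative_transform_within_open[of _ _ _ "{..<0}"])
        (use 2 in \<open>auto simp: flat_exp_def\<close>)
  next
    case 3
    \<comment> \<open>The difference quotient at 0 is \<open>flat_exp (n + 1)\<close>, so the limit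
      is known from the same family.\<close>
    have "((\<lambda>t. (flat_exp n t - flat_exp n 0) / (t - 0)) \<longlongrightarrow> 0) (at 0)"
      by (rule Lim_transform_eventually[OF flat_exp_tendsto_0[of "n + 1"]])
        (auto simp: eventually_at_filter flat_exp_def field_simps)
    then show ?thesis using 3 by (simp add: has_field_derivative_iff flat_exp_def)
  qed
qed

lemma Ck_on_flat_exp: "Ck_on k UNIV (flat_exp n)"
proof (induction k arbitrary: n)
  case 0
  show ?case
    using DERIV_isCont[OF DERIV_flat_exp] by (simp add: continuous_at_imp_continuous_on)
next
  case (Suc k)
  show ?case
  proof (rule Ck_on_SucI[OF open_UNIV has_field_derivative_imp_has_derivative[OF DERIV_flat_exp]])
    fix u
    have "Ck_on k UNIV (\<lambda>x. u * (flat_exp (n + 2) x + (- of_nat n) * flat_exp (n + 1) x))"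
      by (intro Ck_on_mult Ck_on_add Ck_on_const Suc open_UNIV)
    then show "Ck_on k UNIV (\<lambda>x. (flat_exp (n + 2) x - of_nat n * flat_exp (n + 1) x) * u)"
      by (simp add: mult.commute)
  qed
qed

lemma smooth_on_flat_exp: "smooth_on UNIV (flat_exp n)"
  by (simp add: smooth_on_def Ck_on_flat_exp)

lemma flat_exp_mono: "s \<le> t \<Longrightarrow> flat_exp 0 s \<le> flat_exp 0 t"
  by (auto simp: flat_exp_def le_imp_inverse_le)

text \<open>The bump is \<open>flat_exp 0 (c - flat_exp 0 (\<bar>y - y0\<bar>\<^sup>2 - r\<^sup>2/4))\<close> divided by its value at \<open>y0\<close>: it
  is constant where the inner function vanishes, and no quotient of functions is needed.\<close>

lemma ex_euclidean_bump:
  fixes y0 :: "'e::euclidean_space"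
  assumes "r > 0"
  shows "\<exists>\<beta>. smooth_on UNIV \<beta> \<and> (\<forall>y\<in>ball y0 (r/2). \<beta> y = (1::real)) \<and> (\<forall>y. y \<notin> ball y0 r \<longrightarrow> \<beta> y = 0)"
proof -
  \<comment> \<open>The squared distance, spelled with sums, products and added constants so that
    the closure rules for \<open>smooth_on\<close> apply verbatim.\<close>
  let ?n = "\<lambda>y. (\<Sum>i\<in>Basis. (y \<bullet> i + (- (y0 \<bullet> i))) * (y \<bullet> i + (- (y0 \<bullet> i))))"
  let ?e = "flat_exp 0"
  \<comment> \<open>On the sphere of radius r the inner argument is r^2 - r^2/4 = 3/4 r^2.
    Subtracting the inner function from its value there makes the outer argument nonpositive outside
    the ball, where \<open>flat_exp\<close> vanishes.\<close>
  let ?m = "?e (?e (3/4 * r\<^sup>2))"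
  let ?\<beta> = "\<lambda>y. (1 / ?m) * ?e (?e (3/4 * r\<^sup>2) + (-1) * ?e (?n y + (- (r\<^sup>2/4))))"
  have n: "?n y = (dist y0 y)\<^sup>2" for y
    unfolding dist_norm norm_minus_commute[of y0] power2_norm_eq_inner
      euclidean_inner[of "y - y0" "y - y0"]
    by (simp add: inner_diff_left)
  have m: "?m > 0" using assms by (simp add: flat_exp_def)
  have c: "smooth_on UNIV (\<lambda>y. ?e (F y))" if "smooth_on UNIV F" for F :: "'e \<Rightarrow> real"
    using smooth_on_compose[OF open_UNIV open_UNIV _ that smooth_on_flat_exp] by simp
  have "smooth_on UNIV ?\<beta>"
    by (intro smooth_on_mult smooth_on_add smooth_on_sum c smooth_on_const open_UNIV
        smooth_on_linear[OF bounded_linear_inner_left])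
  moreover have "?\<beta> y = 1" if "y \<in> ball y0 (r/2)" for y
  proof -
    have "(dist y0 y)\<^sup>2 \<le> (r/2)\<^sup>2" using that by (intro power_mono) auto
    then have "?e (?n y + (- (r\<^sup>2/4))) = 0" unfolding n by (simp add: flat_exp_def power_divide)
    then show ?thesis using m by simp
  qed
  moreover have "?\<beta> y = 0" if "y \<notin> ball y0 r" for y
  proof -
    have "r\<^sup>2 \<le> (dist y0 y)\<^sup>2" using that assms by (intro power_mono) auto
    then have "?e (3/4 * r\<^sup>2) \<le> ?e (?n y + (- (r\<^sup>2/4)))" unfolding n by (intro flat_exp_mono) simp
    then show ?thesis by (simp add: flat_exp_def[of 0 "_ - _"])
  qed
  ultimately show ?thesis by blast
qed

section \<open>The Hadamard lemma\<close>

lemma segment_in_convex: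
  assumes "convex S" "y0 \<in> S" "y \<in> S" "0 \<le> t" "t \<le> 1"
  shows "y0 + t *\<^sub>R (y - y0) \<in> S"
proof -
  have "y0 + t *\<^sub>R (y - y0) = (1 - t) *\<^sub>R y0 + t *\<^sub>R y" by (simp add: algebra_simps)
  then show ?thesis using convexD[OF assms(1-3), of "1 - t" t] assms(4,5) by simp
qed

lemma continuous_on_segment:
  fixes g :: "'e::euclidean_space \<Rightarrow> real"
  assumes "convex S" "y0 \<in> S" "smooth_on S g"
  shows "continuous_on (S \<times> cbox 0 1) (\<lambda>(y, t). t ^ n * g (y0 + t *\<^sub>R (y - y0)))"
proof -
  have "continuous_on S g" using assms(3) Ck_on_continuous_on smooth_on_def by blast
  moreover have "continuous_on (S \<times> cbox 0 1) (\<lambda>z. y0 + snd z *\<^sub>R (fst z - y0))"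
    by (intro continuous_intros)
  ultimately have "continuous_on (S \<times> cbox 0 1) (\<lambda>z. g (y0 + snd z *\<^sub>R (fst z - y0)))"
    by (rule continuous_on_compose2) (use segment_in_convex[OF assms(1,2)] in auto)
  then show ?thesis unfolding case_prod_beta' by (intro continuous_intros)
qed

lemma integrable_on_segment:
  fixes g :: "'e::euclidean_space \<Rightarrow> real"
  assumes "convex S" "y0 \<in> S" "smooth_on S g" "y \<in> S"
  shows "(\<lambda>t. t ^ n * g (y0 + t *\<^sub>R (y - y0))) integrable_on cbox 0 1"
proof (rule integrable_continuous)
  have "continuous_on (cbox 0 1) (\<lambda>t. (y, t))" by (intro continuous_intros)
  from continuous_on_compose2[OF continuous_on_segment[OF assms(1-3)] this] assms(4)
  show "continuous_on (cbox 0 1) (\<lambda>t. t ^ n * g (y0 + t *\<^sub>R (y - y0)))" by auto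
qed

lemma frechet_derivative_expand:
  fixes G :: "'e::euclidean_space \<Rightarrow> real"
  assumes "smooth_on S G" "y \<in> S"
  shows "frechet_derivative G (at y) u = (\<Sum>i\<in>Basis. (u \<bullet> i) * frechet_derivative G (at y) i)"
proof -
  have "linear (frechet_derivative G (at y))"
    using smooth_on_derivative[OF assms] has_derivative_linear by blast
  then have "frechet_derivative G (at y) (\<Sum>i\<in>Basis. (u \<bullet> i) *\<^sub>R i)
      = (\<Sum>i\<in>Basis. (u \<bullet> i) * frechet_derivative G (at y) i)"
    by (simp add: linear_sum linear_scale)
  then show ?thesis by (simp add: euclidean_representation)
qed

text \<open>Differentiating in y under the integral sign replaces G by a directional derivative and
  produces one more factor t. The weight \<open>t ^ n\<close> with arbitrary n keeps the family
  closed, so the induction on k generalizes over both n and G.\<close>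

lemma Ck_on_segment_integral:
  fixes G :: "'e::euclidean_space \<Rightarrow> real"
  assumes "open S" "convex S" "y0 \<in> S" "smooth_on S G"
  shows "Ck_on k S (\<lambda>y. integral (cbox 0 1) (\<lambda>t::real. t ^ n * G (y0 + t *\<^sub>R (y - y0))))"
  using assms(4)
proof (induction k arbitrary: n G)
  case 0
  show ?case
    unfolding Ck_on.simps
    by (rule integral_continuous_on_param[OF continuous_on_segment[OF assms(2,3) 0]])
next
  case (Suc k)
  let ?\<gamma> = "\<lambda>y t. y0 + t *\<^sub>R (y - y0)"
  let ?D = "\<lambda>i y. frechet_derivative G (at y) i"
  let ?f = "\<lambda>y t. t ^ n * G (?\<gamma> y t)"
  \<comment> \<open>\<open>leibniz_rule\<close> expects the derivative as a jointly continuous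
    family of bounded linear maps; it is assembled from the partial derivatives and the functionals
    \<open>blinfun_inner_left i\<close>.\<close>
  let ?fx = "\<lambda>y t. \<Sum>i\<in>Basis. (t ^ Suc n * ?D i (?\<gamma> y t)) *\<^sub>R blinfun_inner_left i"
  note \<gamma>S = segment_in_convex[OF assms(2,3)]
  note D = smooth_on_derivative[OF Suc.prems]
  note sD = smooth_on_frechet_derivative[OF Suc.prems]
  have fx: "blinfun_apply (?fx y t) u = t ^ Suc n * ?D u (?\<gamma> y t)"
    if "y \<in> S" "t \<in> cbox 0 1" for y t u
    using \<gamma>S[OF that(1), of t] that(2)
    by (subst frechet_derivative_expand[OF Suc.prems])
      (simp_all add: blinfun.sum_left blinfun.scaleR_left sum_distrib_left mult_ac inner_commute)
  have deriv: "((\<lambda>y. integral (cbox 0 1) (?f y)) has_derivative integral (cbox 0 1) (?fx y)) (at y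
      within S)"
    if "y \<in> S" for y
  proof (rule leibniz_rule[OF _ _ _ that assms(2)])
    fix x t assume x: "x \<in> S" and t: "t \<in> cbox (0::real) 1"
    then have xt: "?\<gamma> x t \<in> S" using \<gamma>S[OF x, of t] by simp
    have "((\<lambda>y. G (?\<gamma> y t)) has_derivative (\<lambda>u. frechet_derivative G (at (?\<gamma> x t)) (t *\<^sub>R u))) (at x)"
      by (rule has_derivative_compose[where f = "\<lambda>y. ?\<gamma> y t" and x = x, OF _ D[OF xt]]) (auto
          intro!: derivative_eq_intros)
    then have "((\<lambda>y. t ^ n * G (?\<gamma> y t)) has_derivative
        (\<lambda>u. t ^ n * frechet_derivative G (at (?\<gamma> x t)) (t *\<^sub>R u))) (at x)"
      by (rule has_derivative_mult_right)
    also have "(\<lambda>u. t ^ n * frechet_derivative G (at (?\<gamma> x t)) (t *\<^sub>R u)) = blinfun_apply (?fx x t)"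
      using linear_scale[OF has_derivative_linear[OF D[OF xt]]]
      by (intro ext) (simp only: fx[OF x t], simp)
    finally show "((\<lambda>y. ?f y t) has_derivative blinfun_apply (?fx x t)) (at x within S)"
      by (rule has_derivative_at_withinI)
  next
    show "?f x integrable_on cbox 0 1" if "x \<in> S" for x
      using integrable_on_segment[OF assms(2,3) Suc.prems that] .
    have "continuous_on (S \<times> cbox 0 1) (\<lambda>z. snd z ^ Suc n * ?D i (?\<gamma> (fst z) (snd z)))" for i
      using continuous_on_segment[OF assms(2,3) sD, of "Suc n" i] by (simp only: case_prod_beta')
    then show "continuous_on (S \<times> cbox 0 1) (\<lambda>(x, t). ?fx x t)"
      unfolding case_prod_beta' by (intro continuous_on_sum continuous_on_scaleR continuous_on_const)
  qed
  have eq: "blinfun_apply (integral (cbox 0 1) (?fx y)) u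
      = integral (cbox 0 1) (\<lambda>t. t ^ Suc n * ?D u (?\<gamma> y t))" if "y \<in> S" for y u
  proof -
    have ifx: "?fx y integrable_on cbox 0 1"
      by (intro integrable_sum integrable_on_scaleR_left finite_Basis
          integrable_on_segment[OF assms(2,3) sD that])
    have "blinfun_apply (integral (cbox 0 1) (?fx y)) u
        = integral (cbox 0 1) (\<lambda>t. blinfun_apply (?fx y t) u)"
      using integral_linear[OF ifx blinfun.bounded_linear_left[of u]] by (simp only: o_def)
    also have "\<dots> = integral (cbox 0 1) (\<lambda>t. t ^ Suc n * ?D u (?\<gamma> y t))"
      by (rule integral_cong) (rule fx[OF that])
    finally show ?thesis .
  qed
  show ?case
  proof (rule Ck_on_SucI[OF assms(1)])
    show "((\<lambda>y. integral (cbox 0 1) (?f y)) has_derivative integral (cbox 0 1) (?fx y)) (at y)"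
      if "y \<in> S" for y using deriv[OF that] at_within_open[OF that assms(1)] by simp
    show "Ck_on k S (\<lambda>y. blinfun_apply (integral (cbox 0 1) (?fx y)) u)" for u
      by (rule Ck_on_cong[OF assms(1) eq[symmetric] Suc.IH[OF sD]])
  qed
qed

text \<open>Integrate the derivative of \<phi> along the segment from y0 to y and expand it in the
  basis: the coefficients are the partial derivatives averaged over the segment. At y0 the segment
  is a point, which gives the value of \<open>h i\<close> there.\<close>

lemma hadamard:
  fixes \<phi> :: "'e::euclidean_space \<Rightarrow> real"
  assumes "open S" "convex S" "y0 \<in> S" "smooth_on S \<phi>"
  obtains h where "\<And>i. smooth_on S (h i)" "\<And>i. h i y0 = frechet_derivative \<phi> (at y0) i"
    "\<And>y. y \<in> S \<Longrightarrow> \<phi> y = \<phi> y0 + (\<Sum>i\<in>Basis. ((y - y0) \<bullet> i) * h i y)"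
proof
  let ?D = "\<lambda>i y. frechet_derivative \<phi> (at y) i"
  \<comment> \<open>The factor \<open>t ^ 0\<close> only matches the shape of
    \<open>Ck_on_segment_integral\<close>.\<close>
  let ?h = "\<lambda>i y. integral (cbox 0 1) (\<lambda>t::real. t ^ 0 * ?D i (y0 + t *\<^sub>R (y - y0)))"
  note sD = smooth_on_frechet_derivative[OF assms(4)]
  show "smooth_on S (?h i)" for i
    unfolding smooth_on_def using Ck_on_segment_integral[OF assms(1-3) sD] by blast
  show "?h i y0 = ?D i y0" for i by simp
  fix y assume y: "y \<in> S"
  have "((\<lambda>t. ?D (y - y0) (y0 + t *\<^sub>R (y - y0))) has_integral
      \<phi> (y0 + 1 *\<^sub>R (y - y0)) - \<phi> (y0 + 0 *\<^sub>R (y - y0))) {0..1}"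
  proof (rule fundamental_theorem_of_calculus)
    fix t :: real assume "t \<in> {0..1}"
    then have "y0 + t *\<^sub>R (y - y0) \<in> S" using segment_in_convex[OF assms(2,3) y] by simp
    note D = smooth_on_derivative[OF assms(4) this]
    have "((\<lambda>t. \<phi> (y0 + t *\<^sub>R (y - y0))) has_derivative
        (\<lambda>s. frechet_derivative \<phi> (at (y0 + t *\<^sub>R (y - y0))) (s *\<^sub>R (y - y0)))) (at t)"
      by (rule has_derivative_compose[where f = "\<lambda>t. y0 + t *\<^sub>R (y - y0)" and x = t, OF _ D]) (auto
          intro!: derivative_eq_intros)
    then show "((\<lambda>t. \<phi> (y0 + t *\<^sub>R (y - y0))) has_vector_derivative
        ?D (y - y0) (y0 + t *\<^sub>R (y - y0))) (at t within {0..1})"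
      unfolding has_vector_derivative_def linear_scale[OF has_derivative_linear[OF D]]
      by (rule has_derivative_at_withinI)
  qed simp
  then have "\<phi> y - \<phi> y0 = integral (cbox 0 1) (\<lambda>t. ?D (y - y0) (y0 + t *\<^sub>R (y - y0)))"
    by (simp add: integral_unique)
  also have "\<dots> = integral (cbox 0 1)
      (\<lambda>t. \<Sum>i\<in>Basis. ((y - y0) \<bullet> i) * (t ^ 0 * ?D i (y0 + t *\<^sub>R (y - y0))))"
    using segment_in_convex[OF assms(2,3) y]
    by (intro integral_cong) (subst frechet_derivative_expand[OF assms(4)], auto)
  also have "\<dots> = (\<Sum>i\<in>Basis. integral (cbox 0 1)
      (\<lambda>t. ((y - y0) \<bullet> i) * (t ^ 0 * ?D i (y0 + t *\<^sub>R (y - y0)))))"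
    by (intro integral_sum integrable_on_mult_right integrable_on_segment[OF assms(2,3) sD y]) simp
  also have "\<dots> = (\<Sum>i\<in>Basis. ((y - y0) \<bullet> i) * ?h i y)"
    by (simp only: integral_mult_right)
  finally show "\<phi> y = \<phi> y0 + (\<Sum>i\<in>Basis. ((y - y0) \<bullet> i) * ?h i y)" by simp
qed

section \<open>Smooth functions on manifolds\<close>

text \<open>Polymorphic in the argument of the fibre, so that one operation serves vector fields and
  1-forms alike; the same holds for \<open>plus_field\<close>.\<close>

definition scale :: "('a \<Rightarrow> real) \<Rightarrow> ('a \<Rightarrow> 'x \<Rightarrow> real) \<Rightarrow> 'a \<Rightarrow> 'x \<Rightarrow> real" (infixr "\<odot>" 75) where
  "f \<odot> \<omega> = (\<lambda>p v. f p * \<omega> p v)"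

definition plus_field :: "('a \<Rightarrow> 'x \<Rightarrow> real) \<Rightarrow> ('a \<Rightarrow> 'x \<Rightarrow> real) \<Rightarrow> 'a \<Rightarrow> 'x \<Rightarrow> real" (infixl "\<oplus>" 65) where
  "\<omega> \<oplus> \<eta> = (\<lambda>p v. \<omega> p v + \<eta> p v)"

locale smooth_manifold =
  fixes A :: "('a::{t2_space,second_countable_topology}, 'e::euclidean_space) atlas"
  assumes smooth_atlas: "smooth_atlas A"
begin

abbreviation "smooth \<equiv> smooth_functions A"
abbreviation "tangent \<equiv> tangent_space A"
abbreviation "cotangent \<equiv> cotangent_space A"
abbreviation "differential \<equiv> exterior_d A"
abbreviation "vfields \<equiv> vector_fields A"
abbreviation "forms \<equiv> one_forms A"

lemma chart_open: "(U, c) \<in> A \<Longrightarrow> open U"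
  and chart_image_open: "(U, c) \<in> A \<Longrightarrow> open (c ` U)"
  and chart_homeomorphism: "(U, c) \<in> A \<Longrightarrow> homeomorphism U (c ` U) c (inv_into U c)"
  using smooth_atlas unfolding smooth_atlas_def by (auto dest!: bspec[where x = "(U, c)"])

lemma chart_transition:
  assumes "(U, c) \<in> A" "(V, e) \<in> A"
  shows "smooth_on (c ` (U \<inter> V)) (e \<circ> inv_into U c)"
proof -
  have "\<forall>(U, c)\<in>A. \<forall>(V, d)\<in>A. smooth_on (c ` (U \<inter> V)) (d \<circ> inv_into U c)"
    using smooth_atlas unfolding smooth_atlas_def by (elim conjE)
  from bspec[OF this assms(1)] have "\<forall>(V, d)\<in>A. smooth_on (c ` (U \<inter> V)) (d \<circ> inv_into U c)" by simp
  from bspec[OF this assms(2)] show ?thesis by simp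
qed

lemma ex_chart: "\<exists>U c. (U, c) \<in> A \<and> p \<in> U"
proof -
  have "p \<in> (\<Union>(U, c)\<in>A. U)" using smooth_atlas unfolding smooth_atlas_def by simp
  then show ?thesis by auto
qed

lemma chart_inverse: "(U, c) \<in> A \<Longrightarrow> q \<in> U \<Longrightarrow> inv_into U c (c q) = q"
  using chart_homeomorphism[of U c] by (simp add: homeomorphism_def)

lemma chart_subset_open:
  assumes "(U, c) \<in> A" "open W" "W \<subseteq> U"
  shows "open (c ` W)"
proof -
  have "openin (top_of_set (c ` U)) (c ` W)"
    using homeomorphism_imp_open_map[OF chart_homeomorphism[OF assms(1)]] assms(2,3)
    by (simp add: openin_open_eq chart_open[OF assms(1)])
  then show ?thesis by (simp add: openin_open_eq chart_image_open[OF assms(1)])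
qed

lemma chart_preimage_open:
  assumes "(U, c) \<in> A" "open B"
  shows "open (U \<inter> c -` B)"
  using continuous_open_preimage[OF homeomorphism_cont1[OF chart_homeomorphism[OF assms(1)]]
      chart_open[OF assms(1)] assms(2)] .

lemma smooth_functions_chart:
  "\<phi> \<in> smooth \<Longrightarrow> (U, c) \<in> A \<Longrightarrow> smooth_on (c ` U) (\<lambda>y. \<phi> (inv_into U c y))"
  unfolding smooth_functions_def o_def by (auto dest: bspec[where x = "(U, c)"])

text \<open>One chart around each point suffices: in any other chart the local expression is the
  given one composed with a transition map.\<close>

lemma smooth_functionsI:
  assumes "\<And>p. \<exists>U c W. (U, c) \<in> A \<and> open W \<and> p \<in> W \<and> W \<subseteq> U \<and>
    smooth_on (c ` W) (\<lambda>y. \<phi> (inv_into U c y))"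
  shows "\<phi> \<in> smooth"
  unfolding smooth_functions_def o_def
proof (clarify, rule smooth_on_locally)
  fix V e y
  assume V: "(V, e) \<in> A" and y: "y \<in> e ` V"
  then obtain p where p: "p \<in> V" "y = e p" by blast
  obtain U c W where W: "(U, c) \<in> A" "open W" "p \<in> W" "W \<subseteq> U"
    "smooth_on (c ` W) (\<lambda>y. \<phi> (inv_into U c y))"
    using assms by blast
  let ?T = "e ` (V \<inter> W)"
  have T: "open ?T" using chart_subset_open[OF V] W(2) chart_open[OF V] by blast
  have "smooth_on ?T (\<lambda>y. c (inv_into V e y))"
    by (rule smooth_on_subset[OF chart_transition[OF V W(1), unfolded o_def]]) (use W(4) in auto)
  then have "smooth_on ?T (\<lambda>y. \<phi> (inv_into U c (c (inv_into V e y))))"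
    by (intro smooth_on_compose[OF T chart_subset_open[OF W(1,2,4)] _ _ W(5)])
      (auto simp: chart_inverse[OF V])
  then have "smooth_on ?T (\<lambda>y. \<phi> (inv_into V e y))"
    by (rule smooth_on_cong[OF T, rotated])
      (use W(4) in \<open>auto simp: chart_inverse[OF V] chart_inverse[OF W(1)]\<close>)
  then show "\<exists>T. open T \<and> y \<in> T \<and> smooth_on T (\<lambda>x. \<phi> (inv_into V e x))"
    using T p W(3) by blast
qed

lemma smooth_functions_const: "(\<lambda>x. a) \<in> smooth"
  unfolding smooth_functions_def o_def using chart_image_open by (auto intro: smooth_on_const)

lemma smooth_functions_add: "\<phi> \<in> smooth \<Longrightarrow> \<psi> \<in> smooth \<Longrightarrow> (\<lambda>x. \<phi> x + \<psi> x) \<in> smooth"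
  unfolding smooth_functions_def o_def using chart_image_open by (auto intro!: smooth_on_add)

lemma smooth_functions_mult: "\<phi> \<in> smooth \<Longrightarrow> \<psi> \<in> smooth \<Longrightarrow> (\<lambda>x. \<phi> x * \<psi> x) \<in> smooth"
  unfolding smooth_functions_def o_def using chart_image_open by (auto intro!: smooth_on_mult)

lemma smooth_functions_lincomb:
  "\<phi> \<in> smooth \<Longrightarrow> \<psi> \<in> smooth \<Longrightarrow> (\<lambda>x. a * \<phi> x + b * \<psi> x) \<in> smooth"
  by (intro smooth_functions_add smooth_functions_mult smooth_functions_const)

lemma smooth_functions_diff: "\<phi> \<in> smooth \<Longrightarrow> \<psi> \<in> smooth \<Longrightarrow> (\<lambda>x. \<phi> x - \<psi> x) \<in> smooth"
  using smooth_functions_lincomb[of \<phi> \<psi> 1 "-1"] by simp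

lemma smooth_functions_sum:
  "(\<And>i. i \<in> I \<Longrightarrow> \<phi> i \<in> smooth) \<Longrightarrow> (\<lambda>x. \<Sum>i\<in>I. \<phi> i x) \<in> smooth"
  by (induction I rule: infinite_finite_induct)
    (auto intro: smooth_functions_const smooth_functions_add)

lemma smooth_functions_locally:
  assumes "\<And>p. \<exists>W \<psi>. open W \<and> p \<in> W \<and> \<psi> \<in> smooth \<and> (\<forall>x\<in>W. \<phi> x = \<psi> x)"
  shows "\<phi> \<in> smooth"
proof (rule smooth_functionsI)
  fix p
  obtain W \<psi> where W: "open W" "p \<in> W" "\<psi> \<in> smooth" "\<forall>x\<in>W. \<phi> x = \<psi> x" using assms by blast
  obtain U c where U: "(U, c) \<in> A" "p \<in> U" using ex_chart by blast
  have o: "open (U \<inter> W)" using chart_open[OF U(1)] W(1) by blast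
  have "smooth_on (c ` (U \<inter> W)) (\<lambda>y. \<psi> (inv_into U c y))"
    by (rule smooth_on_subset[OF smooth_functions_chart[OF W(3) U(1)]]) auto
  then have "smooth_on (c ` (U \<inter> W)) (\<lambda>y. \<phi> (inv_into U c y))"
    by (rule smooth_on_cong[OF chart_subset_open[OF U(1) o Int_lower1], rotated])
      (use W(4) in \<open>auto simp: chart_inverse[OF U(1)]\<close>)
  then show "\<exists>U c W. (U, c) \<in> A \<and> open W \<and> p \<in> W \<and> W \<subseteq> U \<and>
      smooth_on (c ` W) (\<lambda>y. \<phi> (inv_into U c y))"
    using U W o by (intro exI[of _ U] exI[of _ c] exI[of _ "U \<inter> W"]) auto
qed

text \<open>The sets W and the complement of K are open and cover the manifold. The function is G in
  the chart on the first and zero on the second. K must be closed in the whole manifold, not merely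
  in the chart domain.\<close>

lemma smooth_functions_extend:
  assumes "(U, c) \<in> A" "open W" "W \<subseteq> U" "smooth_on (c ` W) G" "closed K" "K \<subseteq> W"
    "\<And>q. q \<in> W \<Longrightarrow> q \<notin> K \<Longrightarrow> G (c q) = 0"
  shows "(\<lambda>q. if q \<in> W then G (c q) else 0) \<in> smooth"
proof (rule smooth_functionsI)
  fix p
  let ?\<phi> = "\<lambda>q. if q \<in> W then G (c q) else 0"
  show "\<exists>U c W. (U, c) \<in> A \<and> open W \<and> p \<in> W \<and> W \<subseteq> U \<and>
      smooth_on (c ` W) (\<lambda>y. ?\<phi> (inv_into U c y))"
  proof (cases "p \<in> W")
    case True
    have "smooth_on (c ` W) (\<lambda>y. ?\<phi> (inv_into U c y))"
      by (rule smooth_on_cong[OF chart_subset_open[OF assms(1-3)] _ assms(4)])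
        (use assms(3) in \<open>auto simp: chart_inverse[OF assms(1)] subset_iff\<close>)
    then show ?thesis using assms True by blast
  next
    case False
    obtain V e where V: "(V, e) \<in> A" "p \<in> V" using ex_chart by blast
    have o: "open (V - K)" using chart_open[OF V(1)] assms(5) by blast
    have "smooth_on (e ` (V - K)) (\<lambda>y. ?\<phi> (inv_into V e y))"
      by (rule smooth_on_cong[OF chart_subset_open[OF V(1) o Diff_subset] _
            smooth_on_const[OF chart_subset_open[OF V(1) o Diff_subset], of 0]])
        (use assms(7) in \<open>auto simp: chart_inverse[OF V(1)]\<close>)
    then show ?thesis
      using V o False assms(6) by (intro exI[of _ V] exI[of _ e] exI[of _ "V - K"]) auto
  qed
qed

lemma ex_bump:
  assumes "(U, c) \<in> A" "open W" "W \<subseteq> U" "p \<in> W"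
  obtains \<beta> N K where "\<beta> \<in> smooth" "open N" "p \<in> N" "N \<subseteq> W" "\<And>q. q \<in> N \<Longrightarrow> \<beta> q = 1"
    "closed K" "K \<subseteq> W" "\<And>q. q \<notin> K \<Longrightarrow> \<beta> q = 0"
proof -
  obtain r where r: "r > 0" "cball (c p) r \<subseteq> c ` W"
    using chart_subset_open[OF assms(1-3)] assms(4) open_contains_cball by blast
  obtain \<beta> :: "'e \<Rightarrow> real" where \<beta>: "smooth_on UNIV \<beta>" "\<And>y. y \<in> ball (c p) (r/2) \<Longrightarrow> \<beta> y = 1"
    "\<And>y. y \<notin> ball (c p) r \<Longrightarrow> \<beta> y = 0"
    using ex_euclidean_bump[OF r(1), of "c p"] by blast
  let ?K = "inv_into U c ` cball (c p) r"
  let ?\<beta> = "\<lambda>q. if q \<in> W then \<beta> (c q) else 0"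
  let ?N = "W \<inter> (U \<inter> c -` ball (c p) (r/2))"
  have KU: "cball (c p) r \<subseteq> c ` U" using r(2) assms(3) by blast
  \<comment> \<open>The preimage of a closed ball is compact, hence closed because the manifold is
    Hausdorff.\<close>
  have K: "closed ?K"
    by (intro compact_imp_closed compact_continuous_image compact_cball
        continuous_on_subset[OF homeomorphism_cont2[OF chart_homeomorphism[OF assms(1)]] KU])
  have KW: "?K \<subseteq> W" using r(2) assms(3) by (force simp: subset_iff chart_inverse[OF assms(1)])
  have z: "\<beta> (c q) = 0" if "q \<in> W" "q \<notin> ?K" for q
  proof (rule \<beta>(3))
    have "inv_into U c (c q) = q" using chart_inverse[OF assms(1)] that(1) assms(3) by blast
    then have "c q \<notin> cball (c p) r" using that(2) by (metis imageI)
    then show "c q \<notin> ball (c p) r" using ball_subset_cball by blast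
  qed
  have "?\<beta> \<in> smooth"
    by (rule smooth_functions_extend[OF assms(1-3) smooth_on_subset[OF \<beta>(1)] K KW z]) auto
  moreover have "open ?N" by (intro open_Int assms(2) chart_preimage_open[OF assms(1)] open_ball)
  moreover have "p \<in> ?N" using assms r(1) by auto
  ultimately show thesis
    using that[of ?\<beta> ?N ?K] K KW z \<beta>(2) by auto
qed

text \<open>Derivations act on global functions only, so the coordinates of a chart are multiplied
  by a bump function; they keep their values near p.\<close>

lemma ex_coordinates:
  assumes "(U, c) \<in> A" "p \<in> U"
  obtains x W where "open W" "p \<in> W" "W \<subseteq> U" "\<And>i. x i \<in> smooth" "\<And>i q. q \<in> W \<Longrightarrow> x i q = c q \<bullet> i"
proof -
  obtain \<beta> N K where \<beta>: "\<beta> \<in> smooth" "open N" "p \<in> N" "N \<subseteq> U" "\<And>q. q \<in> N \<Longrightarrow> \<beta> q = 1"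
    "closed K" "K \<subseteq> U" "\<And>q. q \<notin> K \<Longrightarrow> \<beta> q = 0"
    using ex_bump[OF assms(1) chart_open[OF assms(1)] order_refl assms(2)] by blast
  \<comment> \<open>The detour \<open>inv_into U c (c q)\<close> for q puts the product into the
    form \<open>G (c q)\<close> required by \<open>smooth_functions_extend\<close>.\<close>
  let ?x = "\<lambda>i q. if q \<in> U then \<beta> (inv_into U c (c q)) * (c q \<bullet> i) else 0"
  have "?x i \<in> smooth" for i
    by (rule smooth_functions_extend[OF assms(1) chart_open[OF assms(1)] order_refl _ \<beta>(6,7)])
      (intro smooth_on_mult smooth_functions_chart[OF \<beta>(1) assms(1)] chart_image_open[OF assms(1)]
        smooth_on_linear[OF bounded_linear_inner_left], simp add: \<beta>(8) chart_inverse[OF assms(1)])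
  moreover have "?x i q = c q \<bullet> i" if "q \<in> N" for i q
    using that \<beta>(4,5) by (auto simp: chart_inverse[OF assms(1)])
  ultimately show thesis using that[of N ?x] \<beta>(2-4) by blast
qed

section \<open>Local frames\<close>

lemma tangent_lincomb:
  "v \<in> tangent p \<Longrightarrow> \<phi> \<in> smooth \<Longrightarrow> \<psi> \<in> smooth \<Longrightarrow> v (\<lambda>x. a * \<phi> x + b * \<psi> x) = a * v \<phi> + b * v \<psi>"
  unfolding tangent_space_def by blast

lemma tangent_mult:
  "v \<in> tangent p \<Longrightarrow> \<phi> \<in> smooth \<Longrightarrow> \<psi> \<in> smooth \<Longrightarrow> v (\<lambda>x. \<phi> x * \<psi> x) = \<phi> p * v \<psi> + \<psi> p * v \<phi>"
  unfolding tangent_space_def by blast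

lemma tangent_non_smooth: "v \<in> tangent p \<Longrightarrow> \<phi> \<notin> smooth \<Longrightarrow> v \<phi> = 0"
  unfolding tangent_space_def by blast

lemma tangent_add:
  "v \<in> tangent p \<Longrightarrow> \<phi> \<in> smooth \<Longrightarrow> \<psi> \<in> smooth \<Longrightarrow> v (\<lambda>x. \<phi> x + \<psi> x) = v \<phi> + v \<psi>"
  using tangent_lincomb[of v p \<phi> \<psi> 1 1] by simp

text \<open>Leibniz' rule for 1 = 1 * 1 gives v(1) = 2 v(1); linearity does the rest.\<close>

lemma tangent_const: 
  assumes "v \<in> tangent p" shows "v (\<lambda>x. a) = 0"
proof -
  have "v (\<lambda>x. 1) = 0"
    using tangent_mult[OF assms smooth_functions_const[of 1] smooth_functions_const[of 1]] by simp
  then show ?thesis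
    using tangent_lincomb[OF assms smooth_functions_const[of 1] smooth_functions_const[of 1], of a 0]
    by simp
qed

lemma tangent_sum:
  assumes "v \<in> tangent p" "\<And>i. i \<in> I \<Longrightarrow> \<phi> i \<in> smooth"
  shows "v (\<lambda>x. \<Sum>i\<in>I. \<phi> i x) = (\<Sum>i\<in>I. v (\<phi> i))"
  using assms(2)
  by (induction I rule: infinite_finite_induct)
    (simp_all add: tangent_const[OF assms(1)] tangent_add[OF assms(1)] smooth_functions_sum)

text \<open>The cut-off coordinate derivative along u, continued by zero. The cut-off makes it
  smooth outside W, and the test for smooth functions follows the convention that tangent vectors
  vanish on all other functions.\<close>

lemma chart_partial_vector_field:
  assumes U: "(U, c) \<in> A" and W: "open W" "W \<subseteq> U" and \<rho>: "\<rho> \<in> smooth" "closed K" "K \<subseteq> W"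
    "\<And>q. q \<notin> K \<Longrightarrow> \<rho> q = 0"
  shows "(\<lambda>q \<phi>. if \<phi> \<in> smooth \<and> q \<in> W
      then \<rho> q * frechet_derivative (\<lambda>y. \<phi> (inv_into U c y)) (at (c q)) u else 0) \<in> vector_fields A"
    (is "?E \<in> _")
proof -
  let ?D = "\<lambda>\<phi> y. frechet_derivative (\<lambda>y. \<phi> (inv_into U c y)) (at y) u"
  have D: "((\<lambda>y. \<phi> (inv_into U c y)) has_derivative frechet_derivative (\<lambda>y. \<phi> (inv_into U c y)) (at
      (c q))) (at (c q))"
    if "\<phi> \<in> smooth" "q \<in> W" for \<phi> q
    by (rule smooth_on_derivative[OF smooth_functions_chart[OF that(1) U]]) (use that W in auto)
  have lin: "?D (\<lambda>x. a * \<phi> x + b * \<psi> x) (c q) = a * ?D \<phi> (c q) + b * ?D \<psi> (c q)"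
    if "\<phi> \<in> smooth" "\<psi> \<in> smooth" "q \<in> W" for \<phi> \<psi> q a b
    using fun_cong[OF frechet_derivative_at[OF has_derivative_add[OF
          has_derivative_mult_right[OF D[OF that(1,3)], of a]
          has_derivative_mult_right[OF D[OF that(2,3)], of b]]], of u]
    by simp
  have mul: "?D (\<lambda>x. \<phi> x * \<psi> x) (c q) = \<phi> q * ?D \<psi> (c q) + \<psi> q * ?D \<phi> (c q)"
    if "\<phi> \<in> smooth" "\<psi> \<in> smooth" "q \<in> W" for \<phi> \<psi> q
    using fun_cong[OF frechet_derivative_at[OF has_derivative_mult[OF D[OF that(1,3)] D[OF
        that(2,3)]]], of u]
      chart_inverse[OF U subsetD[OF W(2) that(3)]] by (simp add: mult.commute)
  have "?E q \<in> tangent q" for q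
    unfolding tangent_space_def
    by (auto simp: lin mul smooth_functions_lincomb smooth_functions_mult algebra_simps)
  moreover have "(\<lambda>q. ?E q \<phi>) \<in> smooth" if "\<phi> \<in> smooth" for \<phi>
  proof -
    let ?G = "\<lambda>y. \<rho> (inv_into U c y) * ?D \<phi> y"
    have "smooth_on (c ` U) ?G"
      by (intro smooth_on_mult chart_image_open[OF U] smooth_on_frechet_derivative
          smooth_functions_chart[OF that U] smooth_functions_chart[OF \<rho>(1) U])
    then have "smooth_on (c ` W) ?G" by (rule smooth_on_subset) (use W in auto)
    from smooth_functions_extend[OF U W this \<rho>(2,3)] \<rho>(4) W(2) chart_inverse[OF U]
    have "(\<lambda>q. if q \<in> W then ?G (c q) else 0) \<in> smooth" by (auto simp: subset_iff)
    also have "(\<lambda>q. if q \<in> W then ?G (c q) else 0) = (\<lambda>q. ?E q \<phi>)"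
      using that W(2) chart_inverse[OF U] by (auto simp: fun_eq_iff)
    finally show ?thesis .
  qed
  ultimately show ?thesis unfolding vector_fields_def by blast
qed

text \<open>The cut-off \<open>\<rho>\<close> turns the expansion of tangent vectors in a coordinate frame into an identity that
  holds on the whole manifold, so that fields and forms never have to be restricted to open sets.\<close>

definition is_frame :: "'a \<Rightarrow> ('a \<Rightarrow> real) \<Rightarrow> ('e \<Rightarrow> 'a \<Rightarrow> real) \<Rightarrow> ('e \<Rightarrow> 'a \<Rightarrow> 'a vec) \<Rightarrow> bool" where
  "is_frame p \<rho> x E \<longleftrightarrow> \<rho> \<in> smooth \<and> (\<exists>N. open N \<and> p \<in> N \<and> (\<forall>q\<in>N. \<rho> q = 1)) \<and> (\<forall>i. x i \<in> smooth) \<and>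
      (\<forall>i. E i \<in> vector_fields A) \<and>
    (\<forall>q. \<forall>v\<in>tangent q. \<forall>\<phi>. \<rho> q * v \<phi> = (\<Sum>i\<in>Basis. v (x i) * E i q \<phi>)) \<and>
    (\<forall>i\<in>Basis. \<forall>j\<in>Basis. E i p (x j) = (if i = j then 1 else 0))"

text \<open>A derivation at q is determined by its values on the coordinates: apply it to the
  Hadamard expansion of \<phi> around q. Since the coefficients of that expansion are only local, a
  second bump function, centred at q, makes the identity global before the derivation is
  applied.\<close>

lemma frame_of_coordinates:
  assumes U: "(U, c) \<in> A" and W: "open W" "p \<in> W" "W \<subseteq> U" and x: "\<And>i. x i \<in> smooth"
    and xc: "\<And>i q. i \<in> Basis \<Longrightarrow> q \<in> W \<Longrightarrow> x i q = c q \<bullet> i"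
  obtains \<rho> E where "is_frame p \<rho> x E"
proof -
  \<comment> \<open>W is shrunk until its image is a ball. A ball is convex, so the Hadamard lemma
    can be centred at every q in it and not only at p.\<close>
  obtain r where r: "r > 0" "ball (c p) r \<subseteq> c ` W"
    using chart_subset_open[OF U W(1,3)] W(2) open_contains_ball by blast
  let ?B = "ball (c p) r"
  define W' where "W' = W \<inter> (U \<inter> c -` ?B)"
  have W': "open W'" "W' \<subseteq> U" "W' \<subseteq> W" "p \<in> W'"
    unfolding W'_def using W r(1) chart_preimage_open[OF U open_ball] by auto
  have cW': "c ` W' = ?B"
  proof
    show "?B \<subseteq> c ` W'"
    proof
      fix y assume y: "y \<in> ?B"
      then obtain q where "q \<in> W" "y = c q" using r(2) by blast
      then show "y \<in> c ` W'" using y W(3) by (auto simp: W'_def)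
    qed
  qed (auto simp: W'_def)
  have inv: "inv_into U c (c q) = q" if "q \<in> W'" for q using chart_inverse[OF U] W'(2) that by blast
  obtain \<rho> N K where \<rho>: "\<rho> \<in> smooth" "p \<in> N" "\<And>q. q \<in> N \<Longrightarrow> \<rho> q = 1"
    "closed K" "K \<subseteq> W'" "\<And>q. q \<notin> K \<Longrightarrow> \<rho> q = 0" "open N"
    using ex_bump[OF U W'(1,2,4)] by metis
  define E where "E = (\<lambda>i q \<phi>. if \<phi> \<in> smooth \<and> q \<in> W'
      then \<rho> q * frechet_derivative (\<lambda>y. \<phi> (inv_into U c y)) (at (c q)) i else 0)"
  have E: "E i \<in> vector_fields A" for i
    unfolding E_def by (rule chart_partial_vector_field[OF U W'(1,2) \<rho>(1,4,5,6)])
  have expand: "v \<phi> = (\<Sum>i\<in>Basis. v (x i) * frechet_derivative (\<lambda>y. \<phi> (inv_into U c y)) (at (c q)) i)"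
    if q: "q \<in> W'" and v: "v \<in> tangent q" and \<phi>: "\<phi> \<in> smooth" for q v \<phi>
  proof -
    have cq: "c q \<in> ?B" using cW' q by blast
    have "smooth_on ?B (\<lambda>y. \<phi> (inv_into U c y))"
      by (rule smooth_on_subset[OF smooth_functions_chart[OF \<phi> U]]) (use cW' W'(2) in auto)
    then obtain h where h: "\<And>i. smooth_on ?B (h i)"
      "\<And>i. h i (c q) = frechet_derivative (\<lambda>y. \<phi> (inv_into U c y)) (at (c q)) i"
      "\<And>y. y \<in> ?B \<Longrightarrow> \<phi> (inv_into U c y) = \<phi> (inv_into U c (c q)) + (\<Sum>i\<in>Basis. ((y - c q) \<bullet> i) * h i y)"
      by (rule hadamard[OF open_ball convex_ball cq]) (rule that)
    obtain \<beta> N' K' where \<beta>: "\<beta> \<in> smooth" "q \<in> N'" "\<And>q. q \<in> N' \<Longrightarrow> \<beta> q = 1"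
      "closed K'" "K' \<subseteq> W'" "\<And>q. q \<notin> K' \<Longrightarrow> \<beta> q = 0"
      using ex_bump[OF U W'(1,2) q] by metis
    define H where "H = (\<lambda>i q. if q \<in> W' then \<beta> (inv_into U c (c q)) * h i (c q) else 0)"
    have H: "H i \<in> smooth" for i
      unfolding H_def
    proof (rule smooth_functions_extend[OF U W'(1,2) _ \<beta>(4,5)])
      show "smooth_on (c ` W') (\<lambda>y. \<beta> (inv_into U c y) * h i y)"
        unfolding cW'
        by (intro smooth_on_mult open_ball h(1) smooth_on_subset[OF smooth_functions_chart[OF \<beta>(1) U]])
          (use cW' W'(2) in auto)
    qed (simp add: inv \<beta>(6))
    have Hq: "H i q = frechet_derivative (\<lambda>y. \<phi> (inv_into U c y)) (at (c q)) i" for i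
      using q \<beta>(2,3) h(2) by (simp add: H_def inv)
    \<comment> \<open>The Hadamard expansion times \<beta>: on \<open>W'\<close> this is the
      expansion itself, elsewhere both sides vanish.\<close>
    have eq: "(\<lambda>z. \<beta> z * (\<phi> z + (- \<phi> q))) = (\<lambda>z. \<Sum>i\<in>Basis. (x i z + (- x i q)) * H i z)"
    proof
      fix z
      show "\<beta> z * (\<phi> z + (- \<phi> q)) = (\<Sum>i\<in>Basis. (x i z + (- x i q)) * H i z)"
      proof (cases "z \<in> W'")
        case True
        then have "\<phi> z = \<phi> q + (\<Sum>i\<in>Basis. ((c z - c q) \<bullet> i) * h i (c z))"
          using h(3)[of "c z"] cW' inv q by force
        moreover have "x i z + (- x i q) = (c z - c q) \<bullet> i" if "i \<in> Basis" for i
          using xc[OF that] True q W'(3) by (simp add: inner_diff_left subset_iff)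
        ultimately show ?thesis
          using True by (simp add: H_def inv sum_distrib_left mult_ac)
      next
        case False
        then have "z \<notin> K'" using \<beta>(5) by blast
        then show ?thesis using False by (simp add: H_def \<beta>(6))
      qed
    qed
    \<comment> \<open>By Leibniz' rule, since \<beta> is 1 at q, \<phi> minus its value at q
      vanishes there, and v kills constants.\<close>
    have "v \<phi> = v (\<lambda>z. \<beta> z * (\<phi> z + (- \<phi> q)))"
      using \<beta>(2,3) by (simp add: tangent_mult[OF v] tangent_add[OF v] tangent_const[OF v]
          smooth_functions_add smooth_functions_const \<beta>(1) \<phi> del: add_uminus_conv_diff)
    also have "\<dots> = (\<Sum>i\<in>Basis. v (\<lambda>z. (x i z + (- x i q)) * H i z))"
      unfolding eq by (rule tangent_sum[OF v])
        (intro smooth_functions_add smooth_functions_mult smooth_functions_const x H)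
    \<comment> \<open>The factors \<open>x i z - x i q\<close> vanish at z = q, so only the
      derivative of that factor survives.\<close>
    also have "\<dots> = (\<Sum>i\<in>Basis. v (x i) * H i q)"
      by (simp add: tangent_mult[OF v] tangent_add[OF v] tangent_const[OF v]
          smooth_functions_add smooth_functions_const x H mult.commute del: add_uminus_conv_diff)
    finally show ?thesis unfolding Hq .
  qed
  have "\<rho> q * v \<phi> = (\<Sum>i\<in>Basis. v (x i) * E i q \<phi>)" if v: "v \<in> tangent q" for q v \<phi>
  proof (cases "\<phi> \<in> smooth \<and> q \<in> W'")
    case True
    then show ?thesis using expand[OF _ v, of \<phi>] by (simp add: E_def sum_distrib_left mult_ac)
  next
    case False
    then have "\<rho> q = 0 \<or> v \<phi> = 0" using \<rho>(5,6) tangent_non_smooth[OF v] by blast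
    then show ?thesis using False by (auto simp: E_def)
  qed
  moreover have "E i p (x j) = (if i = j then 1 else 0)" if "i \<in> Basis" "j \<in> Basis" for i j
  proof -
    have "((\<lambda>y. x j (inv_into U c y)) has_derivative (\<lambda>u. u \<bullet> j)) (at (c p))"
    proof (rule has_derivative_transform_within_open[OF _ open_ball])
      show "((\<lambda>y. y \<bullet> j) has_derivative (\<lambda>u. u \<bullet> j)) (at (c p))"
        by (rule bounded_linear_imp_has_derivative[OF bounded_linear_inner_left])
      show "c p \<in> ?B" using r(1) by simp
      fix y assume "y \<in> ?B"
      then obtain q where "q \<in> W'" "y = c q" using cW' by blast
      then show "y \<bullet> j = x j (inv_into U c y)" using xc[OF that(2)] W'(3) by (auto simp: inv)
    qed
    from frechet_derivative_at[OF this]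
    have "frechet_derivative (\<lambda>y. x j (inv_into U c y)) (at (c p)) i = i \<bullet> j" by metis
    then show ?thesis using that x W'(4) \<rho>(2,3) by (simp add: E_def inner_Basis)
  qed
  moreover have "\<exists>N. open N \<and> p \<in> N \<and> (\<forall>q\<in>N. \<rho> q = 1)" using \<rho>(2,3,7) by auto
  ultimately have "is_frame p \<rho> x E" unfolding is_frame_def using \<rho>(1) x E by simp
  then show thesis by (rule that)
qed

lemma is_frameD:
  assumes "is_frame p \<rho> x E"
  shows "\<rho> \<in> smooth" "\<rho> p = 1" "\<And>i. x i \<in> smooth" "\<And>i. E i \<in> vector_fields A"
    "\<And>q v \<phi>. v \<in> tangent q \<Longrightarrow> \<rho> q * v \<phi> = (\<Sum>i\<in>Basis. v (x i) * E i q \<phi>)"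
    "\<And>i j. i \<in> Basis \<Longrightarrow> j \<in> Basis \<Longrightarrow> E i p (x j) = (if i = j then 1 else 0)"
    "\<exists>N. open N \<and> p \<in> N \<and> (\<forall>q\<in>N. \<rho> q = 1)"
  using assms unfolding is_frame_def by auto

lemma ex_frame: obtains \<rho> x E where "is_frame p \<rho> x E"
proof -
  obtain U c where U: "(U, c) \<in> A" "p \<in> U" using ex_chart by blast
  obtain x W where "open W" "p \<in> W" "W \<subseteq> U" "\<And>i. x i \<in> smooth" "\<And>i q. q \<in> W \<Longrightarrow> x i q = c q \<bullet> i"
    using ex_coordinates[OF U] by metis
  then show thesis using frame_of_coordinates[OF U(1)] that by metis
qed

section \<open>Vector fields and 1-forms as modules\<close>

lemma tangent_space_lincomb:
  assumes "u \<in> tangent p" "v \<in> tangent p"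
  shows "(\<lambda>\<phi>. a * u \<phi> + b * v \<phi>) \<in> tangent p"
  unfolding tangent_space_def
  by (auto simp: tangent_lincomb[OF assms(1)] tangent_lincomb[OF assms(2)]
      tangent_mult[OF assms(1)] tangent_mult[OF assms(2)]
      tangent_non_smooth[OF assms(1)] tangent_non_smooth[OF assms(2)] algebra_simps)

lemma tangent_space_zero: "(\<lambda>\<phi>. 0) \<in> tangent p"
  unfolding tangent_space_def by auto

lemma tangent_space_sum:
  assumes "\<And>i. i \<in> I \<Longrightarrow> u i \<in> tangent p"
  shows "(\<lambda>\<phi>. \<Sum>i\<in>I. c i * u i \<phi>) \<in> tangent p"
  using assms
proof (induction I rule: infinite_finite_induct)
  case (insert j I)
  then have "(\<lambda>\<phi>. c j * u j \<phi> + 1 * (\<Sum>i\<in>I. c i * u i \<phi>)) \<in> tangent p"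
    by (intro tangent_space_lincomb) auto
  then show ?case using insert by simp
qed (auto simp: tangent_space_zero)

lemma vector_field_tangent: "X \<in> vfields \<Longrightarrow> X p \<in> tangent p"
  and vector_field_smooth: "X \<in> vfields \<Longrightarrow> \<phi> \<in> smooth \<Longrightarrow> (\<lambda>p. X p \<phi>) \<in> smooth"
  unfolding vector_fields_def by auto

lemma vector_field_scale: "f \<in> smooth \<Longrightarrow> X \<in> vfields \<Longrightarrow> f \<odot> X \<in> vfields"
  using tangent_space_lincomb[of "X p" p "X p" "f p" 0 for p]
  by (auto simp: vector_fields_def scale_def intro: smooth_functions_mult)

lemma vector_field_plus: "X \<in> vfields \<Longrightarrow> Y \<in> vfields \<Longrightarrow> X \<oplus> Y \<in> vfields"
  using tangent_space_lincomb[of "X p" p "Y p" 1 1 for p]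
  by (auto simp: vector_fields_def plus_field_def intro: smooth_functions_add)

lemma vector_field_zero: "(\<lambda>p \<phi>. 0) \<in> vfields"
  by (simp add: vector_fields_def tangent_space_zero smooth_functions_const)

lemma vector_field_sum:
  "(\<And>i. i \<in> I \<Longrightarrow> f i \<in> smooth) \<Longrightarrow> (\<And>i. i \<in> I \<Longrightarrow> X i \<in> vfields)
    \<Longrightarrow> (\<lambda>p \<phi>. \<Sum>i\<in>I. f i p * X i p \<phi>) \<in> vfields"
  by (simp add: vector_fields_def tangent_space_sum smooth_functions_sum smooth_functions_mult)

text \<open>In Leibniz' rule for a product the mixed first-order terms from X Y and from Y X are the
  same and cancel.\<close>

lemma lie_bracket_vector_field:
  assumes X: "X \<in> vfields" and Y: "Y \<in> vfields"
  shows "lie_bracket X Y \<in> vfields"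
proof -
  note Xt = vector_field_tangent[OF X] and Yt = vector_field_tangent[OF Y]
  note sm = vector_field_smooth[OF X] vector_field_smooth[OF Y]
    smooth_functions_lincomb smooth_functions_mult smooth_functions_add
  have "lie_bracket X Y p \<in> tangent p" for p
    unfolding tangent_space_def lie_bracket_def mem_Collect_eq
    by (intro conjI ballI allI impI)
      (simp_all add: sm tangent_lincomb[OF Xt] tangent_lincomb[OF Yt] tangent_mult[OF Xt]
          tangent_mult[OF Yt]
        tangent_add[OF Xt] tangent_add[OF Yt] tangent_non_smooth[OF Xt] tangent_non_smooth[OF Yt]
        tangent_const[OF Xt] tangent_const[OF Yt] algebra_simps)
  then show ?thesis
    by (simp add: vector_fields_def) (simp add: lie_bracket_def smooth_functions_diff sm)
qed

lemma lie_bracket_scale_right: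
  assumes f: "f \<in> smooth" and X: "X \<in> vfields" and Y: "Y \<in> vfields"
  shows "lie_bracket X (f \<odot> Y) p = (\<lambda>\<phi>. f p * lie_bracket X Y p \<phi> + X p f * Y p \<phi>)"
proof
  fix \<phi>
  note Xt = vector_field_tangent[OF X] and Yt = vector_field_tangent[OF Y]
  show "lie_bracket X (f \<odot> Y) p \<phi> = f p * lie_bracket X Y p \<phi> + X p f * Y p \<phi>"
  proof (cases "\<phi> \<in> smooth")
    case True
    then show ?thesis using tangent_mult[OF Xt f vector_field_smooth[OF Y True]]
      by (simp add: lie_bracket_def scale_def algebra_simps)
  next
    case False
    then show ?thesis
      by (simp add: lie_bracket_def scale_def tangent_non_smooth[OF Xt] tangent_non_smooth[OF Yt]
          tangent_const[OF Xt] tangent_const[OF Yt])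
  qed
qed

lemma lie_bracket_antisym: "lie_bracket Y X p = (\<lambda>\<phi>. - lie_bracket X Y p \<phi>)"
  by (simp add: lie_bracket_def)

lemma lie_bracket_plus_right:
  assumes X: "X \<in> vfields" and Y: "Y \<in> vfields" and Z: "Z \<in> vfields"
  shows "lie_bracket X (Y \<oplus> Z) p = (\<lambda>\<phi>. lie_bracket X Y p \<phi> + lie_bracket X Z p \<phi>)"
proof
  fix \<phi>
  note Xt = vector_field_tangent[OF X] and Yt = vector_field_tangent[OF Y]
    and Zt = vector_field_tangent[OF Z]
  show "lie_bracket X (Y \<oplus> Z) p \<phi> = lie_bracket X Y p \<phi> + lie_bracket X Z p \<phi>"
  proof (cases "\<phi> \<in> smooth")
    case True
    then show ?thesis
      using tangent_add[OF Xt vector_field_smooth[OF Y True] vector_field_smooth[OF Z True]]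
      by (simp add: lie_bracket_def plus_field_def algebra_simps)
  next
    case False
    then show ?thesis
      by (simp add: lie_bracket_def plus_field_def tangent_non_smooth[OF Xt] tangent_non_smooth[OF Yt]
          tangent_non_smooth[OF Zt] tangent_const[OF Xt] tangent_const[OF Yt] tangent_const[OF Zt])
  qed
qed

section \<open>Covectors and 1-forms\<close>

lemma cotangent_lincomb:
  "\<xi> \<in> cotangent p \<Longrightarrow> u \<in> tangent p \<Longrightarrow> v \<in> tangent p \<Longrightarrow>
    \<xi> (\<lambda>\<phi>. a * u \<phi> + b * v \<phi>) = a * \<xi> u + b * \<xi> v"
  unfolding cotangent_space_def linear_form_on_def by blast

lemma cotangent_plus:
  "\<xi> \<in> cotangent p \<Longrightarrow> u \<in> tangent p \<Longrightarrow> v \<in> tangent p \<Longrightarrow> \<xi> (\<lambda>\<phi>. u \<phi> + v \<phi>) = \<xi> u + \<xi> v"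
  using cotangent_lincomb[of \<xi> p u v 1 1] by simp

lemma cotangent_zero: "\<xi> \<in> cotangent p \<Longrightarrow> \<xi> (\<lambda>\<phi>. 0) = 0"
  using cotangent_lincomb[OF _ tangent_space_zero tangent_space_zero, of \<xi> p 0 0] by simp

lemma cotangent_scale:
  "\<xi> \<in> cotangent p \<Longrightarrow> u \<in> tangent p \<Longrightarrow> \<xi> (\<lambda>\<phi>. a * u \<phi>) = a * \<xi> u"
  using cotangent_lincomb[of \<xi> p u u a 0] by simp

lemma cotangent_sum:
  assumes "\<xi> \<in> cotangent p" "\<And>i. i \<in> I \<Longrightarrow> u i \<in> tangent p"
  shows "\<xi> (\<lambda>\<phi>. \<Sum>i\<in>I. c i * u i \<phi>) = (\<Sum>i\<in>I. c i * \<xi> (u i))"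
  using assms(2)
proof (induction I rule: infinite_finite_induct)
  case (insert j I)
  then have "\<xi> (\<lambda>\<phi>. c j * u j \<phi> + 1 * (\<Sum>i\<in>I. c i * u i \<phi>)) = c j * \<xi> (u j) + 1 * (\<Sum>i\<in>I. c i * \<xi> (u i))"
    by (subst cotangent_lincomb[OF assms(1)]) (auto intro: tangent_space_sum)
  then show ?case using insert by simp
qed (auto simp: cotangent_zero[OF assms(1)])

lemma cotangent_outside: "\<xi> \<in> cotangent p \<Longrightarrow> v \<notin> tangent p \<Longrightarrow> \<xi> v = 0"
  unfolding cotangent_space_def by blast

lemma cotangent_ext:
  "\<xi> \<in> cotangent p \<Longrightarrow> \<zeta> \<in> cotangent p \<Longrightarrow> (\<And>v. v \<in> tangent p \<Longrightarrow> \<xi> v = \<zeta> v) \<Longrightarrow> \<xi> = \<zeta>"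
  using cotangent_outside by (metis ext)

lemma cotangent_space_lincomb:
  "\<xi> \<in> cotangent p \<Longrightarrow> \<zeta> \<in> cotangent p \<Longrightarrow> (\<lambda>v. a * \<xi> v + b * \<zeta> v) \<in> cotangent p"
  unfolding cotangent_space_def linear_form_on_def by (auto simp: algebra_simps)

lemma cotangent_space_zero: "(\<lambda>v. 0) \<in> cotangent p"
  unfolding cotangent_space_def linear_form_on_def by auto

lemma cotangent_space_sum:
  assumes "\<And>i. i \<in> I \<Longrightarrow> \<xi> i \<in> cotangent p"
  shows "(\<lambda>v. \<Sum>i\<in>I. c i * \<xi> i v) \<in> cotangent p"
  using assms
proof (induction I rule: infinite_finite_induct)
  case (insert j I)
  then have "(\<lambda>v. c j * \<xi> j v + 1 * (\<Sum>i\<in>I. c i * \<xi> i v)) \<in> cotangent p"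
    by (intro cotangent_space_lincomb) auto
  then show ?case using insert by simp
qed (auto simp: cotangent_space_zero)

lemma form_cotangent: "\<omega> \<in> forms \<Longrightarrow> \<omega> p \<in> cotangent p"
  and form_smooth: "\<omega> \<in> forms \<Longrightarrow> X \<in> vfields \<Longrightarrow> (\<lambda>p. \<omega> p (X p)) \<in> smooth"
  unfolding one_forms_def by auto

lemma form_scale: "f \<in> smooth \<Longrightarrow> \<omega> \<in> forms \<Longrightarrow> f \<odot> \<omega> \<in> forms"
  using cotangent_space_lincomb[of "\<omega> p" p "\<omega> p" "f p" 0 for p]
  by (auto simp: one_forms_def scale_def intro: smooth_functions_mult)

lemma form_plus: "\<omega> \<in> forms \<Longrightarrow> \<eta> \<in> forms \<Longrightarrow> \<omega> \<oplus> \<eta> \<in> forms"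
  using cotangent_space_lincomb[of "\<omega> p" p "\<eta> p" 1 1 for p]
  by (auto simp: one_forms_def plus_field_def intro: smooth_functions_add)

lemma form_zero: "(\<lambda>p v. 0) \<in> forms"
  by (simp add: one_forms_def cotangent_space_zero smooth_functions_const)

lemma differential_apply: "v \<in> tangent p \<Longrightarrow> differential \<phi> p v = v \<phi>"
  by (simp add: exterior_d_def)

lemma form_differential: "\<phi> \<in> smooth \<Longrightarrow> differential \<phi> \<in> forms"
  unfolding one_forms_def cotangent_space_def linear_form_on_def
  by (auto simp: differential_apply tangent_space_lincomb vector_field_tangent vector_field_smooth)
    (simp add: exterior_d_def)

section \<open>Extension of vectors, expansion of 1-forms, tensoriality\<close>

lemma frame_vector:
  assumes "is_frame p \<rho> x E" "v \<in> tangent p"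
  shows "v = (\<lambda>\<phi>. \<Sum>i\<in>Basis. v (x i) * E i p \<phi>)"
proof
  fix \<phi>
  show "v \<phi> = (\<Sum>i\<in>Basis. v (x i) * E i p \<phi>)"
    using is_frameD(5)[OF assms, of \<phi>] is_frameD(2)[OF assms(1)] by simp
qed

text \<open>Freezing the components of v in a frame gives a global field. Equality of forms can
  therefore be tested on vector fields.\<close>

lemma ex_vector_field:
  assumes "v \<in> tangent p"
  obtains X where "X \<in> vfields" "X p = v"
proof -
  obtain \<rho> x E where fr: "is_frame p \<rho> x E" using ex_frame by blast
  let ?X = "\<lambda>q \<phi>. \<Sum>i\<in>Basis. v (x i) * E i q \<phi>"
  have "?X \<in> vfields"
    by (intro vector_field_sum smooth_functions_const is_frameD(4)[OF fr])
  moreover have "?X p = v" by (rule frame_vector[OF fr assms, symmetric])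
  ultimately show thesis using that by blast
qed

lemma form_eqI:
  assumes "\<omega> \<in> forms" "\<eta> \<in> forms" "\<And>X p. X \<in> vfields \<Longrightarrow> \<omega> p (X p) = \<eta> p (X p)"
  shows "\<omega> = \<eta>"
proof
  fix p
  show "\<omega> p = \<eta> p"
    by (rule cotangent_ext[OF form_cotangent form_cotangent])
      (use assms ex_vector_field in \<open>blast+\<close>)
qed

lemma frame_covector:
  assumes fr: "is_frame p \<rho> x E" and \<xi>: "\<xi> \<in> cotangent p"
  shows "\<xi> = (\<lambda>v. \<Sum>i\<in>Basis. \<xi> (E i p) * differential (x i) p v)"
proof (rule cotangent_ext[OF \<xi>])
  note x = is_frameD(3)[OF fr] and E = is_frameD(4)[OF fr]
  show "(\<lambda>v. \<Sum>i\<in>Basis. \<xi> (E i p) * differential (x i) p v) \<in> cotangent p"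
    by (intro cotangent_space_sum form_cotangent form_differential x)
  fix v assume v: "v \<in> tangent p"
  have "\<xi> v = \<xi> (\<lambda>\<phi>. \<Sum>i\<in>Basis. v (x i) * E i p \<phi>)" by (rule arg_cong[OF frame_vector[OF fr v]])
  also have "\<dots> = (\<Sum>i\<in>Basis. v (x i) * \<xi> (E i p))"
    by (rule cotangent_sum[OF \<xi> vector_field_tangent[OF E]])
  finally show "\<xi> v = (\<Sum>i\<in>Basis. \<xi> (E i p) * differential (x i) p v)"
    using v by (simp add: differential_apply mult.commute)
qed

text \<open>Evaluate \<omega> on the cut-off expansion of a tangent vector. The result holds at
  every q: up to a factor that is 1 near p, a 1-form is a combination of exact forms with globally
  smooth coefficients.\<close>

lemma frame_form:
  assumes fr: "is_frame p \<rho> x E" and \<omega>: "\<omega> \<in> forms"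
  shows "\<rho> \<odot> \<omega> = (\<lambda>q v. \<Sum>i\<in>Basis. \<omega> q (E i q) * differential (x i) q v)"
proof
  fix q
  note \<rho> = is_frameD(1)[OF fr] and x = is_frameD(3)[OF fr] and E = is_frameD(4)[OF fr]
  show "(\<rho> \<odot> \<omega>) q = (\<lambda>v. \<Sum>i\<in>Basis. \<omega> q (E i q) * differential (x i) q v)"
  proof (rule cotangent_ext)
    show "(\<rho> \<odot> \<omega>) q \<in> cotangent q" by (rule form_cotangent[OF form_scale[OF \<rho> \<omega>]])
    show "(\<lambda>v. \<Sum>i\<in>Basis. \<omega> q (E i q) * differential (x i) q v) \<in> cotangent q"
      by (intro cotangent_space_sum form_cotangent form_differential x)
    fix v assume v: "v \<in> tangent q"
    have "(\<rho> \<odot> \<omega>) q v = \<omega> q (\<lambda>\<phi>. \<rho> q * v \<phi>)"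
      by (simp add: scale_def cotangent_scale[OF form_cotangent[OF \<omega>] v])
    also have "(\<lambda>\<phi>. \<rho> q * v \<phi>) = (\<lambda>\<phi>. \<Sum>i\<in>Basis. v (x i) * E i q \<phi>)"
      using is_frameD(5)[OF fr v] by simp
    also have "\<omega> q \<dots> = (\<Sum>i\<in>Basis. v (x i) * \<omega> q (E i q))"
      by (rule cotangent_sum[OF form_cotangent[OF \<omega>] vector_field_tangent[OF E]])
    finally show "(\<rho> \<odot> \<omega>) q v = (\<Sum>i\<in>Basis. \<omega> q (E i q) * differential (x i) q v)"
      using v by (simp add: differential_apply mult.commute)
  qed
qed

text \<open>The induction principle behind the bracket computations. \<open>frame_form\<close> makes
  \<rho> times \<omega> a sum of multiples of exact forms, and the case \<open>multiple\<close>
  removes the cut-off again, which is possible for properties that look at the forms only at p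
  through rules such as f p * (value).\<close>

lemma form_induct_at [consumes 1, case_names exact scale plus multiple]:
  assumes \<omega>: "\<omega> \<in> forms"
    and exact: "\<And>\<phi>. \<phi> \<in> smooth \<Longrightarrow> Q (differential \<phi>)"
    and scale: "\<And>f \<eta>. f \<in> smooth \<Longrightarrow> \<eta> \<in> forms \<Longrightarrow> Q \<eta> \<Longrightarrow> Q (f \<odot> \<eta>)"
    and plus: "\<And>\<eta> \<theta>. \<eta> \<in> forms \<Longrightarrow> \<theta> \<in> forms \<Longrightarrow> Q \<eta> \<Longrightarrow> Q \<theta> \<Longrightarrow> Q (\<eta> \<oplus> \<theta>)"
    and multiple: "\<And>\<rho> \<eta>. \<rho> \<in> smooth \<Longrightarrow> \<rho> p = 1 \<Longrightarrow> \<eta> \<in> forms \<Longrightarrow> Q (\<rho> \<odot> \<eta>) \<Longrightarrow> Q \<eta>"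
  shows "Q \<omega>"
proof -
  obtain \<rho> x E where fr: "is_frame p \<rho> x E" using ex_frame by blast
  note \<rho> = is_frameD(1,2)[OF fr] and x = is_frameD(3)[OF fr] and E = is_frameD(4)[OF fr]
  \<comment> \<open>The zero form, needed for the empty sum, is the differential of a
    constant.\<close>
  have zero: "Q (\<lambda>q v. 0)"
  proof -
    have "differential (\<lambda>q. 0) = (\<lambda>q v. 0)" by (auto simp: exterior_d_def tangent_const fun_eq_iff)
    then show ?thesis using exact[OF smooth_functions_const[of 0]] by simp
  qed
  have "finite I \<Longrightarrow> (\<lambda>q v. \<Sum>i\<in>I. \<omega> q (E i q) * differential (x i) q v) \<in> forms \<and>
    Q (\<lambda>q v. \<Sum>i\<in>I. \<omega> q (E i q) * differential (x i) q v)" for I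
  proof (induction I rule: finite_induct)
    case (insert i I)
    have s: "(\<lambda>q. \<omega> q (E i q)) \<in> smooth" by (rule form_smooth[OF \<omega> E])
    have "(\<lambda>q v. \<Sum>i\<in>insert i I. \<omega> q (E i q) * differential (x i) q v) =
      ((\<lambda>q. \<omega> q (E i q)) \<odot> differential (x i)) \<oplus> (\<lambda>q v. \<Sum>i\<in>I. \<omega> q (E i q) * differential (x i) q v)"
      using insert by (simp add: plus_field_def scale_def)
    then show ?case
      using insert.IH s form_differential[OF x] form_scale[OF s] scale[OF s] exact[OF x]
      by (auto intro!: form_plus plus)
  qed (auto simp: form_zero zero)
  then have "Q (\<rho> \<odot> \<omega>)" unfolding frame_form[OF fr \<omega>] by simp
  then show ?thesis using multiple[OF \<rho> \<omega>] by blast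
qed

text \<open>Function-linearity makes \<open>L Y p\<close> depend on the vector \<open>Y p\<close>
  alone: multiply Y by a cut-off with value 1 at p, expand in a frame, and only the components of
  \<open>Y p\<close> remain. A covector at p is then obtained by extending tangent vectors to
  fields.\<close>

lemma ex_form_of_tensorial:
  assumes sm: "\<And>Y. Y \<in> vfields \<Longrightarrow> L Y \<in> smooth"
    and plus: "\<And>Y Z p. Y \<in> vfields \<Longrightarrow> Z \<in> vfields \<Longrightarrow> L (Y \<oplus> Z) p = L Y p + L Z p"
    and scale: "\<And>f Y p. f \<in> smooth \<Longrightarrow> Y \<in> vfields \<Longrightarrow> L (f \<odot> Y) p = f p * L Y p"
  obtains \<omega> where "\<omega> \<in> forms" "\<And>Y p. Y \<in> vfields \<Longrightarrow> \<omega> p (Y p) = L Y p"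
proof -
  have L_zero: "L (\<lambda>q \<phi>. 0) p = 0" for p
    using scale[OF smooth_functions_const[of 0] vector_field_zero] by (simp add: scale_def)
  have L_sum: "L (\<lambda>q \<phi>. \<Sum>i\<in>I. f i q * E i q \<phi>) p = (\<Sum>i\<in>I. f i p * L (E i) p)"
    if "\<And>i. f i \<in> smooth" "\<And>i. E i \<in> vfields" for f E p and I :: "'e set"
  proof (induction I rule: infinite_finite_induct)
    case (insert i I)
    have "(\<lambda>q \<phi>. \<Sum>i\<in>insert i I. f i q * E i q \<phi>) = (f i \<odot> E i) \<oplus> (\<lambda>q \<phi>. \<Sum>i\<in>I. f i q * E i q \<phi>)"
      using insert by (simp add: plus_field_def scale_def)
    then show ?case
      using insert by (simp add: plus scale that vector_field_scale vector_field_sum)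
  qed (auto simp: L_zero)
  have pointwise: "L Y p = L Z p" if Y: "Y \<in> vfields" and Z: "Z \<in> vfields" and eq: "Y p = Z p" for Y Z p
  proof -
    obtain \<rho> x E where fr: "is_frame p \<rho> x E" using ex_frame by blast
    note \<rho> = is_frameD(1,2)[OF fr] and x = is_frameD(3)[OF fr] and E = is_frameD(4)[OF fr]
    have "L Y p = (\<Sum>i\<in>Basis. Y p (x i) * L (E i) p)" if Y: "Y \<in> vfields" for Y
    proof -
      have "\<rho> \<odot> Y = (\<lambda>q \<phi>. \<Sum>i\<in>Basis. Y q (x i) * E i q \<phi>)"
        using is_frameD(5)[OF fr vector_field_tangent[OF Y]] by (simp add: scale_def)
      then have "L (\<rho> \<odot> Y) p = (\<Sum>i\<in>Basis. Y p (x i) * L (E i) p)"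
        using L_sum[of "\<lambda>i q. Y q (x i)" E] vector_field_smooth[OF Y x] E by simp
      then show ?thesis using scale[OF \<rho>(1) Y, of p] \<rho>(2) by simp
    qed
    then show ?thesis using Y Z eq by simp
  qed
  \<comment> \<open>Any extension of v to a field may be chosen; \<open>pointwise\<close> shows that
    the value is the same for all of them.\<close>
  define \<omega> where "\<omega> = (\<lambda>p v. if v \<in> tangent p then L (SOME Y. Y \<in> vfields \<and> Y p = v) p else 0)"
  have \<omega>: "\<omega> p (Y p) = L Y p" if Y: "Y \<in> vfields" for Y p
  proof -
    have "\<exists>Z. Z \<in> vfields \<and> Z p = Y p" using Y by blast
    from someI_ex[OF this] have "L (SOME Z. Z \<in> vfields \<and> Z p = Y p) p = L Y p"
      by (intro pointwise Y) auto
    then show ?thesis using vector_field_tangent[OF Y] by (simp add: \<omega>_def)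
  qed
  have "\<omega> p \<in> cotangent p" for p
    unfolding cotangent_space_def linear_form_on_def
  proof (clarify, intro conjI ballI allI impI)
    fix u v a b assume u: "u \<in> tangent p" and v: "v \<in> tangent p"
    obtain X where X: "X \<in> vfields" "X p = u" using ex_vector_field[OF u] by blast
    obtain Y where Y: "Y \<in> vfields" "Y p = v" using ex_vector_field[OF v] by blast
    let ?Z = "((\<lambda>q. a) \<odot> X) \<oplus> ((\<lambda>q. b) \<odot> Y)"
    have "\<omega> p (?Z p) = a * \<omega> p u + b * \<omega> p v"
      using X Y \<omega>[of X p] \<omega>[of Y p]
      by (simp add: \<omega> plus scale vector_field_plus vector_field_scale smooth_functions_const)
    moreover have "?Z p = (\<lambda>x. a * u x + b * v x)" using X Y by (simp add: plus_field_def scale_def)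
    ultimately show "\<omega> p (\<lambda>x. a * u x + b * v x) = a * \<omega> p u + b * \<omega> p v" by simp
  qed (simp add: \<omega>_def)
  then have "\<omega> \<in> forms" unfolding one_forms_def using \<omega> sm by simp
  then show thesis using that \<omega> by blast
qed

section \<open>The Koszul bracket\<close>

lemma tangent_eqI:
  assumes "v \<in> tangent p" "w \<in> tangent p" "\<And>\<xi>. \<xi> \<in> cotangent p \<Longrightarrow> \<xi> v = \<xi> w"
  shows "v = w"
proof
  fix \<phi>
  show "v \<phi> = w \<phi>"
  proof (cases "\<phi> \<in> smooth")
    case True
    then show ?thesis
      using assms(3)[OF form_cotangent[OF form_differential[OF True]]] assms(1,2)
      by (simp add: differential_apply)
  qed (simp add: tangent_non_smooth[OF assms(1)] tangent_non_smooth[OF assms(2)])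
qed

lemma bilinear_lincomb_left:
  "bilinear_form_on (cotangent p) B \<Longrightarrow> \<xi> \<in> cotangent p \<Longrightarrow> \<xi>' \<in> cotangent p \<Longrightarrow> \<zeta> \<in> cotangent p \<Longrightarrow>
    B (\<lambda>v. a * \<xi> v + b * \<xi>' v) \<zeta> = a * B \<xi> \<zeta> + b * B \<xi>' \<zeta>"
  unfolding bilinear_form_on_def linear_form_on_def by blast

lemma bilinear_lincomb_right:
  "bilinear_form_on (cotangent p) B \<Longrightarrow> \<xi> \<in> cotangent p \<Longrightarrow> \<xi>' \<in> cotangent p \<Longrightarrow> \<zeta> \<in> cotangent p \<Longrightarrow>
    B \<zeta> (\<lambda>v. a * \<xi> v + b * \<xi>' v) = a * B \<zeta> \<xi> + b * B \<zeta> \<xi>'"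
  unfolding bilinear_form_on_def linear_form_on_def by blast

lemma bilinear_sum_right:
  assumes B: "bilinear_form_on (cotangent p) B" and \<zeta>: "\<zeta> \<in> cotangent p"
    and \<xi>: "\<And>i. i \<in> I \<Longrightarrow> \<xi> i \<in> cotangent p"
  shows "B \<zeta> (\<lambda>v. \<Sum>i\<in>I. c i * \<xi> i v) = (\<Sum>i\<in>I. c i * B \<zeta> (\<xi> i))"
proof -
  have z: "B \<zeta> (\<lambda>v. 0) = 0"
    using bilinear_lincomb_right[OF B cotangent_space_zero cotangent_space_zero \<zeta>, of 0 0] by simp
  show ?thesis using \<xi>
  proof (induction I rule: infinite_finite_induct)
    case (insert j I)
    have "B \<zeta> (\<lambda>v. c j * \<xi> j v + 1 * (\<Sum>i\<in>I. c i * \<xi> i v))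
        = c j * B \<zeta> (\<xi> j) + 1 * B \<zeta> (\<lambda>v. \<Sum>i\<in>I. c i * \<xi> i v)"
      by (rule bilinear_lincomb_right[OF B _ _ \<zeta>]) (use insert in \<open>auto intro: cotangent_space_sum\<close>)
    then show ?case using insert by simp
  qed (auto simp: z)
qed

text \<open>The right-hand side is function-linear in Y: the terms with X f produced by the two
  summands cancel. Tensoriality thus provides the form, and uniqueness follows by testing on vector
  fields, so the \<open>THE\<close> of the definition is met.\<close>

lemma lie_derivative:
  assumes X: "X \<in> vfields" and \<beta>: "\<beta> \<in> forms"
  shows "lie_derivative A X \<beta> \<in> forms"
    and "Y \<in> vfields \<Longrightarrow>
      lie_derivative A X \<beta> p (Y p) = X p (\<lambda>q. \<beta> q (Y q)) - \<beta> p (lie_bracket X Y p)"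
proof -
  let ?L = "\<lambda>Y p. X p (\<lambda>q. \<beta> q (Y q)) - \<beta> p (lie_bracket X Y p)"
  note Xt = vector_field_tangent[OF X]
  obtain \<omega> where \<omega>: "\<omega> \<in> forms" "\<And>Y p. Y \<in> vfields \<Longrightarrow> \<omega> p (Y p) = ?L Y p"
  proof (rule ex_form_of_tensorial[of ?L])
    show "?L Y \<in> smooth" if "Y \<in> vfields" for Y
      by (intro smooth_functions_diff vector_field_smooth[OF X] form_smooth[OF \<beta>]
          lie_bracket_vector_field X that)
    fix Y p assume Y: "Y \<in> vfields"
    note Yt = vector_field_tangent[OF Y]
    note bt = vector_field_tangent[OF lie_bracket_vector_field[OF X Y]]
    show "?L (Y \<oplus> Z) p = ?L Y p + ?L Z p" if Z: "Z \<in> vfields" for Z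
    proof -
      have "(\<lambda>q. \<beta> q ((Y \<oplus> Z) q)) = (\<lambda>q. \<beta> q (Y q) + \<beta> q (Z q))"
        using cotangent_plus[OF form_cotangent[OF \<beta>] Yt vector_field_tangent[OF Z]]
        by (simp add: plus_field_def)
      then have "X p (\<lambda>q. \<beta> q ((Y \<oplus> Z) q)) = X p (\<lambda>q. \<beta> q (Y q)) + X p (\<lambda>q. \<beta> q (Z q))"
        using tangent_add[OF Xt form_smooth[OF \<beta> Y] form_smooth[OF \<beta> Z]] by simp
      moreover have "\<beta> p (lie_bracket X (Y \<oplus> Z) p) = \<beta> p (lie_bracket X Y p) + \<beta> p (lie_bracket X Z p)"
        unfolding lie_bracket_plus_right[OF X Y Z]
        by (rule cotangent_plus[OF form_cotangent[OF \<beta>] bt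
              vector_field_tangent[OF lie_bracket_vector_field[OF X Z]]])
      ultimately show ?thesis by simp
    qed
    show "?L (f \<odot> Y) p = f p * ?L Y p" if f: "f \<in> smooth" for f
    proof -
      have "(\<lambda>q. \<beta> q ((f \<odot> Y) q)) = (\<lambda>q. f q * \<beta> q (Y q))"
        using cotangent_scale[OF form_cotangent[OF \<beta>] Yt] by (simp add: scale_def)
      then have "X p (\<lambda>q. \<beta> q ((f \<odot> Y) q)) = f p * X p (\<lambda>q. \<beta> q (Y q)) + \<beta> p (Y p) * X p f"
        using tangent_mult[OF Xt f form_smooth[OF \<beta> Y]] by simp
      moreover have "\<beta> p (lie_bracket X (f \<odot> Y) p) = f p * \<beta> p (lie_bracket X Y p) + X p f * \<beta> p (Y p)"
        unfolding lie_bracket_scale_right[OF f X Y]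
        by (rule cotangent_lincomb[OF form_cotangent[OF \<beta>] bt Yt])
      ultimately show ?thesis by (simp add: algebra_simps)
    qed
  qed blast
  have "lie_derivative A X \<beta> = \<omega>"
    unfolding lie_derivative_def
  proof (rule the_equality)
    show "\<omega> \<in> forms \<and> (\<forall>Y\<in>vfields. \<forall>p. \<omega> p (Y p) = ?L Y p)" using \<omega> by blast
    show "\<eta> = \<omega>" if "\<eta> \<in> forms \<and> (\<forall>Y\<in>vfields. \<forall>p. \<eta> p (Y p) = ?L Y p)" for \<eta>
      using that \<omega> by (intro form_eqI) auto
  qed
  then show "lie_derivative A X \<beta> \<in> forms"
    and "Y \<in> vfields \<Longrightarrow>
      lie_derivative A X \<beta> p (Y p) = X p (\<lambda>q. \<beta> q (Y q)) - \<beta> p (lie_bracket X Y p)"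
    using \<omega> by simp_all
qed

lemma lie_bracket_scale_left:
  assumes "f \<in> smooth" "X \<in> vfields" "Y \<in> vfields"
  shows "lie_bracket (f \<odot> X) Y p = (\<lambda>\<phi>. f p * lie_bracket X Y p \<phi> + (- Y p f) * X p \<phi>)"
proof -
  have "lie_bracket (f \<odot> X) Y p = (\<lambda>\<phi>. - lie_bracket Y (f \<odot> X) p \<phi>)" by (rule lie_bracket_antisym)
  then show ?thesis unfolding lie_bracket_scale_right[OF assms(1,3,2)] by (simp add: lie_bracket_def
      algebra_simps)
qed

lemma form_diff: "\<omega> \<in> forms \<Longrightarrow> \<eta> \<in> forms \<Longrightarrow> (\<lambda>p v. \<omega> p v - \<eta> p v) \<in> forms"
  using form_plus[OF _ form_scale[OF smooth_functions_const[of "-1"]], of \<omega> \<eta>]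
  by (simp add: plus_field_def scale_def)

end

section \<open>The anchor and the Leibniz rules of the Koszul bracket\<close>

locale bivector_manifold = smooth_manifold A
  for A :: "('a::{t2_space,second_countable_topology}, 'e::euclidean_space) atlas" +
  fixes P :: "'a cotensor"
  assumes bivector: "bivector_field A P"
begin

abbreviation "sharp \<equiv> anchor A P"
abbreviation "koszul \<equiv> koszul_bracket A P"

lemma bivector_bilinear: "bilinear_form_on (cotangent p) (P p)"
  and bivector_antisym: "\<xi> \<in> cotangent p \<Longrightarrow> \<zeta> \<in> cotangent p \<Longrightarrow> P p \<xi> \<zeta> = - P p \<zeta> \<xi>"
  and bivector_smooth: "\<alpha> \<in> forms \<Longrightarrow> \<beta> \<in> forms \<Longrightarrow> tensor_pair P \<alpha> \<beta> \<in> smooth"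
  using bivector unfolding bivector_field_def smooth_cotensor_def by blast+

text \<open>The vector with components P(\<alpha>, dx_i) in a frame represents the functional
  P(\<alpha>, -) on covectors, because covectors expand in the dx_i. Exact forms separate vectors,
  hence uniqueness.\<close>

lemma anchor:
  assumes "\<alpha> \<in> forms"
  shows anchor_tangent: "sharp \<alpha> p \<in> tangent p"
    and anchor_pairing: "\<xi> \<in> cotangent p \<Longrightarrow> \<xi> (sharp \<alpha> p) = P p (\<alpha> p) \<xi>"
proof -
  obtain \<rho> x E where fr: "is_frame p \<rho> x E" using ex_frame by blast
  let ?v = "\<lambda>\<phi>. \<Sum>i\<in>Basis. P p (\<alpha> p) (differential (x i) p) * E i p \<phi>"
  note x = is_frameD(3)[OF fr] and E = is_frameD(4)[OF fr]
  have v: "?v \<in> tangent p" by (rule tangent_space_sum[OF vector_field_tangent[OF E]])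
  have p: "\<xi> ?v = P p (\<alpha> p) \<xi>" if \<xi>: "\<xi> \<in> cotangent p" for \<xi>
  proof -
    have "P p (\<alpha> p) \<xi> = P p (\<alpha> p) (\<lambda>v. \<Sum>i\<in>Basis. \<xi> (E i p) * differential (x i) p v)"
      by (rule arg_cong[OF frame_covector[OF fr \<xi>]])
    also have "\<dots> = (\<Sum>i\<in>Basis. \<xi> (E i p) * P p (\<alpha> p) (differential (x i) p))"
      by (rule bilinear_sum_right[OF bivector_bilinear form_cotangent[OF assms]
            form_cotangent[OF form_differential[OF x]]])
    also have "\<dots> = \<xi> ?v"
      unfolding cotangent_sum[OF \<xi> vector_field_tangent[OF E]] by (simp add: mult.commute)
    finally show ?thesis by simp
  qed
  have "sharp \<alpha> p = ?v"
    unfolding anchor_def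
  proof (rule the_equality)
    show "?v \<in> tangent p \<and> (\<forall>\<xi>\<in>cotangent p. \<xi> ?v = P p (\<alpha> p) \<xi>)" using v p by blast
    show "w = ?v" if "w \<in> tangent p \<and> (\<forall>\<xi>\<in>cotangent p. \<xi> w = P p (\<alpha> p) \<xi>)" for w
      using that by (intro tangent_eqI[OF _ v]) (simp_all add: p)
  qed
  then show "sharp \<alpha> p \<in> tangent p" "\<xi> \<in> cotangent p \<Longrightarrow> \<xi> (sharp \<alpha> p) = P p (\<alpha> p) \<xi>"
    using v p by auto
qed

lemma anchor_apply:
  assumes "\<alpha> \<in> forms" "\<phi> \<in> smooth"
  shows "sharp \<alpha> p \<phi> = tensor_pair P \<alpha> (differential \<phi>) p"
  using anchor_pairing[OF assms(1) form_cotangent[OF form_differential[OF assms(2)]]]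
  by (simp add: differential_apply[OF anchor_tangent[OF assms(1)]] tensor_pair_def)

lemma anchor_vector_field: "\<alpha> \<in> forms \<Longrightarrow> sharp \<alpha> \<in> vfields"
  by (auto simp: vector_fields_def anchor_tangent anchor_apply bivector_smooth form_differential)

lemma tensor_pair_scale_left:
  "\<alpha> \<in> forms \<Longrightarrow> \<beta> \<in> forms \<Longrightarrow> tensor_pair P (f \<odot> \<alpha>) \<beta> p = f p * tensor_pair P \<alpha> \<beta> p"
  using bilinear_lincomb_left[OF bivector_bilinear form_cotangent form_cotangent form_cotangent,
      of \<alpha> \<alpha> \<beta> p "f p" 0]
  by (simp add: tensor_pair_def scale_def)

lemma tensor_pair_plus_left:
  "\<alpha> \<in> forms \<Longrightarrow> \<alpha>' \<in> forms \<Longrightarrow> \<beta> \<in> forms \<Longrightarrow>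
    tensor_pair P (\<alpha> \<oplus> \<alpha>') \<beta> p = tensor_pair P \<alpha> \<beta> p + tensor_pair P \<alpha>' \<beta> p"
  using bilinear_lincomb_left[OF bivector_bilinear form_cotangent form_cotangent form_cotangent,
      of \<alpha> \<alpha>' \<beta> p 1 1]
  by (simp add: tensor_pair_def plus_field_def)

lemma tensor_pair_antisym:
  "\<alpha> \<in> forms \<Longrightarrow> \<beta> \<in> forms \<Longrightarrow> tensor_pair P \<alpha> \<beta> = (\<lambda>p. - tensor_pair P \<beta> \<alpha> p)"
  using bivector_antisym form_cotangent unfolding tensor_pair_def by blast

lemma anchor_scale:
  assumes "f \<in> smooth" "\<alpha> \<in> forms"
  shows "sharp (f \<odot> \<alpha>) = f \<odot> sharp \<alpha>"
proof (intro ext)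
  fix p \<phi>
  show "sharp (f \<odot> \<alpha>) p \<phi> = (f \<odot> sharp \<alpha>) p \<phi>"
  proof (cases "\<phi> \<in> smooth")
    case True
    then show ?thesis
      by (simp add: scale_def anchor_apply[OF form_scale[OF assms], unfolded scale_def]
          anchor_apply[OF assms(2)] tensor_pair_scale_left[OF assms(2) form_differential, unfolded
              scale_def])
  qed (use assms in \<open>auto simp: scale_def tangent_non_smooth[OF anchor_tangent]
        tangent_non_smooth[OF anchor_tangent[OF form_scale[OF assms, unfolded scale_def]]]\<close>)
qed

lemma anchor_plus:
  assumes "\<alpha> \<in> forms" "\<beta> \<in> forms"
  shows "sharp (\<alpha> \<oplus> \<beta>) = sharp \<alpha> \<oplus> sharp \<beta>"
proof (intro ext)
  fix p \<phi>
  show "sharp (\<alpha> \<oplus> \<beta>) p \<phi> = (sharp \<alpha> \<oplus> sharp \<beta>) p \<phi>"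
  proof (cases "\<phi> \<in> smooth")
    case True
    then show ?thesis
      by (simp add: plus_field_def anchor_apply[OF form_plus[OF assms], unfolded plus_field_def]
          anchor_apply[OF assms(1)] anchor_apply[OF assms(2)]
          tensor_pair_plus_left[OF assms form_differential, unfolded plus_field_def])
  qed (use assms in \<open>auto simp: plus_field_def tangent_non_smooth[OF anchor_tangent]
        tangent_non_smooth[OF anchor_tangent[OF form_plus[OF assms, unfolded plus_field_def]]]\<close>)
qed

lemma koszul_form:
  assumes "\<alpha> \<in> forms" "\<beta> \<in> forms"
  shows "koszul \<alpha> \<beta> \<in> forms"
  unfolding koszul_bracket_def
  by (intro form_diff lie_derivative(1) anchor_vector_field form_differential bivector_smooth assms)

lemma koszul_apply:
  assumes \<alpha>: "\<alpha> \<in> forms" and \<beta>: "\<beta> \<in> forms" and Y: "Y \<in> vfields"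
  shows "koszul \<alpha> \<beta> p (Y p) =
    sharp \<alpha> p (\<lambda>q. \<beta> q (Y q)) - \<beta> p (lie_bracket (sharp \<alpha>) Y p)
    - (sharp \<beta> p (\<lambda>q. \<alpha> q (Y q)) - \<alpha> p (lie_bracket (sharp \<beta>) Y p))
    - Y p (tensor_pair P \<alpha> \<beta>)"
  unfolding koszul_bracket_def
  by (simp add: lie_derivative(2)[OF anchor_vector_field[OF \<alpha>] \<beta> Y]
      lie_derivative(2)[OF anchor_vector_field[OF \<beta>] \<alpha> Y] differential_apply[OF vector_field_tangent[OF Y]])

lemma koszul_antisym: 
  assumes \<alpha>: "\<alpha> \<in> forms" and \<beta>: "\<beta> \<in> forms"
  shows "koszul \<beta> \<alpha> p v = - koszul \<alpha> \<beta> p v"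
proof -
  have "koszul \<beta> \<alpha> = (\<lambda>p. -1) \<odot> koszul \<alpha> \<beta>"
  proof (intro form_eqI koszul_form form_scale smooth_functions_const \<alpha> \<beta>)
    fix Y p assume Y: "Y \<in> vfields"
    have "Y p (tensor_pair P \<beta> \<alpha>) = - Y p (tensor_pair P \<alpha> \<beta>)"
      using tangent_lincomb[OF vector_field_tangent[OF Y] bivector_smooth[OF \<alpha> \<beta>] bivector_smooth[OF
          \<alpha> \<beta>], of p "-1" 0]
      unfolding tensor_pair_antisym[OF \<beta> \<alpha>] by simp
    then show "koszul \<beta> \<alpha> p (Y p) = ((\<lambda>p. -1) \<odot> koszul \<alpha> \<beta>) p (Y p)"
      by (simp add: scale_def koszul_apply[OF \<alpha> \<beta> Y] koszul_apply[OF \<beta> \<alpha> Y])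
  qed
  then show ?thesis by (simp add: scale_def)
qed

lemma koszul_plus_right:
  assumes \<alpha>: "\<alpha> \<in> forms" and \<beta>: "\<beta> \<in> forms" and \<gamma>: "\<gamma> \<in> forms"
  shows "koszul \<alpha> (\<beta> \<oplus> \<gamma>) p v = koszul \<alpha> \<beta> p v + koszul \<alpha> \<gamma> p v"
proof -
  have "koszul \<alpha> (\<beta> \<oplus> \<gamma>) = koszul \<alpha> \<beta> \<oplus> koszul \<alpha> \<gamma>"
  proof (intro form_eqI koszul_form form_plus \<alpha> \<beta> \<gamma>)
    fix Y p assume Y: "Y \<in> vfields"
    have \<alpha>Y: "(\<lambda>q. \<alpha> q (Y q)) \<in> smooth" by (rule form_smooth[OF \<alpha> Y])
    note st = anchor_tangent[OF \<alpha>]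
    have 1: "sharp \<alpha> p (\<lambda>q. (\<beta> \<oplus> \<gamma>) q (Y q)) = sharp \<alpha> p (\<lambda>q. \<beta> q (Y q)) + sharp \<alpha> p (\<lambda>q. \<gamma> q (Y q))"
      using tangent_add[OF st form_smooth[OF \<beta> Y] form_smooth[OF \<gamma> Y]] by (simp add: plus_field_def)
    have 2: "lie_bracket (sharp (\<beta> \<oplus> \<gamma>)) Y p = (\<lambda>\<phi>. lie_bracket (sharp \<beta>) Y p \<phi> + lie_bracket (sharp
        \<gamma>) Y p \<phi>)"
      unfolding anchor_plus[OF \<beta> \<gamma>] lie_bracket_antisym[of _ Y]
        lie_bracket_plus_right[OF Y anchor_vector_field[OF \<beta>] anchor_vector_field[OF \<gamma>]]
      by (simp add: lie_bracket_def)
    have 3: "\<alpha> p (lie_bracket (sharp (\<beta> \<oplus> \<gamma>)) Y p) = \<alpha> p (lie_bracket (sharp \<beta>) Y p) + \<alpha> p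
        (lie_bracket (sharp \<gamma>) Y p)"
      unfolding 2 by (rule cotangent_plus[OF form_cotangent[OF \<alpha>]
          vector_field_tangent[OF lie_bracket_vector_field[OF anchor_vector_field[OF \<beta>] Y]]
          vector_field_tangent[OF lie_bracket_vector_field[OF anchor_vector_field[OF \<gamma>] Y]]])
    have "tensor_pair P \<alpha> (\<beta> \<oplus> \<gamma>) = (\<lambda>p. tensor_pair P \<alpha> \<beta> p + tensor_pair P \<alpha> \<gamma> p)"
      using tensor_pair_plus_left[OF \<beta> \<gamma> \<alpha>]
      unfolding tensor_pair_antisym[OF \<alpha> form_plus[OF \<beta> \<gamma>]] tensor_pair_antisym[OF \<alpha> \<beta>]
        tensor_pair_antisym[OF \<alpha> \<gamma>] by simp
    then have 4: "Y p (tensor_pair P \<alpha> (\<beta> \<oplus> \<gamma>)) = Y p (tensor_pair P \<alpha> \<beta>) + Y p (tensor_pair P \<alpha> \<gamma>)"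
      using tangent_add[OF vector_field_tangent[OF Y] bivector_smooth[OF \<alpha> \<beta>] bivector_smooth[OF \<alpha>
          \<gamma>]] by simp
    show "koszul \<alpha> (\<beta> \<oplus> \<gamma>) p (Y p) = (koszul \<alpha> \<beta> \<oplus> koszul \<alpha> \<gamma>) p (Y p)"
      unfolding koszul_apply[OF \<alpha> form_plus[OF \<beta> \<gamma>] Y] 1 3 4
      unfolding anchor_plus[OF \<beta> \<gamma>]
      unfolding plus_field_def
      unfolding koszul_apply[OF \<alpha> \<beta> Y] koszul_apply[OF \<alpha> \<gamma> Y] by simp
  qed
  then show ?thesis by (simp add: plus_field_def)
qed

lemma koszul_scale_right:
  assumes f: "f \<in> smooth" and \<alpha>: "\<alpha> \<in> forms" and \<beta>: "\<beta> \<in> forms"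
  shows "koszul \<alpha> (f \<odot> \<beta>) p v = f p * koszul \<alpha> \<beta> p v + sharp \<alpha> p f * \<beta> p v"
proof -
  have "koszul \<alpha> (f \<odot> \<beta>) = (f \<odot> koszul \<alpha> \<beta>) \<oplus> ((\<lambda>p. sharp \<alpha> p f) \<odot> \<beta>)"
  proof (intro form_eqI koszul_form form_plus form_scale f \<alpha> \<beta>
      vector_field_smooth[OF anchor_vector_field[OF \<alpha>] f])
    fix Y p assume Y: "Y \<in> vfields"
    note st = anchor_tangent[OF \<alpha>]
    have 1: "sharp \<alpha> p (\<lambda>q. (f \<odot> \<beta>) q (Y q)) = f p * sharp \<alpha> p (\<lambda>q. \<beta> q (Y q)) + \<beta> p (Y p) * sharp \<alpha> p f"
      using tangent_mult[OF st f form_smooth[OF \<beta> Y]] by (simp add: scale_def)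
    have 3: "\<alpha> p (lie_bracket (sharp (f \<odot> \<beta>)) Y p)
        = f p * \<alpha> p (lie_bracket (sharp \<beta>) Y p) + (- Y p f) * \<alpha> p (sharp \<beta> p)"
      unfolding anchor_scale[OF f \<beta>] lie_bracket_scale_left[OF f anchor_vector_field[OF \<beta>] Y]
      by (rule cotangent_lincomb[OF form_cotangent[OF \<alpha>]
          vector_field_tangent[OF lie_bracket_vector_field[OF anchor_vector_field[OF \<beta>] Y]]
              anchor_tangent[OF \<beta>]])
    \<comment> \<open>With this sign the term in \<open>Y p f\<close> from the Lie bracket cancels
      the one from the differential of P(\<alpha>, f \<beta>); only the anchor term on f
      remains.\<close>
    have 5: "\<alpha> p (sharp \<beta> p) = - tensor_pair P \<alpha> \<beta> p"
      using anchor_pairing[OF \<beta> form_cotangent[OF \<alpha>]] tensor_pair_antisym[OF \<alpha> \<beta>]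
      by (simp add: tensor_pair_def)
    have "tensor_pair P \<alpha> (f \<odot> \<beta>) = (\<lambda>p. f p * tensor_pair P \<alpha> \<beta> p)"
      using tensor_pair_scale_left[OF \<beta> \<alpha>]
      unfolding tensor_pair_antisym[OF \<alpha> form_scale[OF f \<beta>]] tensor_pair_antisym[OF \<alpha> \<beta>] by simp
    then have 4: "Y p (tensor_pair P \<alpha> (f \<odot> \<beta>)) = f p * Y p (tensor_pair P \<alpha> \<beta>) + tensor_pair P \<alpha> \<beta>
        p * Y p f"
      using tangent_mult[OF vector_field_tangent[OF Y] f bivector_smooth[OF \<alpha> \<beta>]] by simp
    show "koszul \<alpha> (f \<odot> \<beta>) p (Y p) = ((f \<odot> koszul \<alpha> \<beta>) \<oplus> ((\<lambda>p. sharp \<alpha> p f) \<odot> \<beta>)) p (Y p)"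
      unfolding koszul_apply[OF \<alpha> form_scale[OF f \<beta>] Y] 1 3 4 5
      unfolding anchor_scale[OF f \<beta>]
      unfolding plus_field_def scale_def
      unfolding koszul_apply[OF \<alpha> \<beta> Y] by (simp add: algebra_simps)
  qed
  then show ?thesis by (simp add: plus_field_def scale_def)
qed

lemma koszul_plus_left:
  assumes \<alpha>: "\<alpha> \<in> forms" and \<beta>: "\<beta> \<in> forms" and \<gamma>: "\<gamma> \<in> forms"
  shows "koszul (\<alpha> \<oplus> \<beta>) \<gamma> p v = koszul \<alpha> \<gamma> p v + koszul \<beta> \<gamma> p v"
  unfolding koszul_antisym[OF \<gamma> form_plus[OF \<alpha> \<beta>]] koszul_antisym[OF \<gamma> \<alpha>] koszul_antisym[OF \<gamma> \<beta>]
  by (simp add: koszul_plus_right[OF \<gamma> \<alpha> \<beta>])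

lemma koszul_scale_left:
  assumes f: "f \<in> smooth" and \<alpha>: "\<alpha> \<in> forms" and \<beta>: "\<beta> \<in> forms"
  shows "koszul (f \<odot> \<alpha>) \<beta> p v = f p * koszul \<alpha> \<beta> p v - sharp \<beta> p f * \<alpha> p v"
  unfolding koszul_antisym[OF \<beta> form_scale[OF f \<alpha>]] koszul_antisym[OF \<beta> \<alpha>]
  by (simp add: koszul_scale_right[OF f \<beta> \<alpha>])

text \<open>Lie derivatives commute with d, so each of the two Lie derivatives, with its sign,
  contributes the differential of P(d\<phi>, d\<psi>), and the last term of the bracket takes one of
  these away.\<close>

lemma koszul_exact:
  assumes \<phi>: "\<phi> \<in> smooth" and \<psi>: "\<psi> \<in> smooth"
  shows "koszul (differential \<phi>) (differential \<psi>)
    = differential (tensor_pair P (differential \<phi>) (differential \<psi>))"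
proof -
  let ?\<alpha> = "differential \<phi>" and ?\<beta> = "differential \<psi>"
  note \<alpha> = form_differential[OF \<phi>] and \<beta> = form_differential[OF \<psi>]
  show ?thesis
  proof (intro form_eqI koszul_form form_differential bivector_smooth \<phi> \<psi>)
    fix Y p assume Y: "Y \<in> vfields"
    note Yt = vector_field_tangent[OF Y]
    have 1: "(\<lambda>q. ?\<alpha> q (Y q)) = (\<lambda>q. Y q \<phi>)" "(\<lambda>q. ?\<beta> q (Y q)) = (\<lambda>q. Y q \<psi>)"
      using differential_apply[OF Yt] by auto
    have 2: "?\<beta> p (lie_bracket (sharp ?\<alpha>) Y p) = sharp ?\<alpha> p (\<lambda>q. Y q \<psi>) - Y p (\<lambda>q. sharp ?\<alpha> q \<psi>)"
      "?\<alpha> p (lie_bracket (sharp ?\<beta>) Y p) = sharp ?\<beta> p (\<lambda>q. Y q \<phi>) - Y p (\<lambda>q. sharp ?\<beta> q \<phi>)"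
      using differential_apply[OF vector_field_tangent[OF lie_bracket_vector_field[OF
          anchor_vector_field[OF \<alpha>] Y]]]
        differential_apply[OF vector_field_tangent[OF lie_bracket_vector_field[OF
            anchor_vector_field[OF \<beta>] Y]]]
      by (simp_all add: lie_bracket_def)
    have 3: "(\<lambda>q. sharp ?\<alpha> q \<psi>) = tensor_pair P ?\<alpha> ?\<beta>" "(\<lambda>q. sharp ?\<beta> q \<phi>) = tensor_pair P ?\<beta> ?\<alpha>"
      using anchor_apply[OF \<alpha> \<psi>] anchor_apply[OF \<beta> \<phi>] by auto
    have "Y p (tensor_pair P ?\<beta> ?\<alpha>) = - Y p (tensor_pair P ?\<alpha> ?\<beta>)"
      using tangent_lincomb[OF Yt bivector_smooth[OF \<alpha> \<beta>] bivector_smooth[OF \<alpha> \<beta>], of p "-1" 0]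
      unfolding tensor_pair_antisym[OF \<beta> \<alpha>] by simp
    then show "koszul ?\<alpha> ?\<beta> p (Y p) = differential (tensor_pair P ?\<alpha> ?\<beta>) p (Y p)"
      unfolding koszul_apply[OF \<alpha> \<beta> Y] 1 2 3 differential_apply[OF Yt] by simp
  qed
qed

end

section \<open>Metrics\<close>

locale metric_manifold = smooth_manifold A
  for A :: "('a::{t2_space,second_countable_topology}, 'e::euclidean_space) atlas" +
  fixes gt :: "'a metric"
  assumes pseudo_riemannian: "pseudo_riemannian A gt"
begin

abbreviation "g \<equiv> cometric A gt"

lemma metric_lincomb_left:
  "u \<in> tangent p \<Longrightarrow> v \<in> tangent p \<Longrightarrow> w \<in> tangent p \<Longrightarrow>
    gt p (\<lambda>\<phi>. a * u \<phi> + b * v \<phi>) w = a * gt p u w + b * gt p v w"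
  and metric_lincomb_right:
  "u \<in> tangent p \<Longrightarrow> v \<in> tangent p \<Longrightarrow> w \<in> tangent p \<Longrightarrow>
    gt p w (\<lambda>\<phi>. a * u \<phi> + b * v \<phi>) = a * gt p w u + b * gt p w v"
  and metric_sym: "u \<in> tangent p \<Longrightarrow> v \<in> tangent p \<Longrightarrow> gt p u v = gt p v u"
  and metric_nondegenerate: "u \<in> tangent p \<Longrightarrow> (\<And>v. v \<in> tangent p \<Longrightarrow> gt p u v = 0) \<Longrightarrow> u = (\<lambda>\<phi>. 0)"
  and metric_smooth: "X \<in> vfields \<Longrightarrow> Y \<in> vfields \<Longrightarrow> (\<lambda>p. gt p (X p) (Y p)) \<in> smooth"
  using pseudo_riemannian
  unfolding pseudo_riemannian_def bilinear_form_on_def linear_form_on_def nondegenerate_on_def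
  by blast+

definition flat :: "('a \<Rightarrow> 'a vec) \<Rightarrow> 'a \<Rightarrow> 'a covec" where
  "flat X = (\<lambda>p v. if v \<in> tangent p then gt p (X p) v else 0)"

lemma flat_form:
  assumes "X \<in> vfields"
  shows "flat X \<in> forms"
  unfolding one_forms_def cotangent_space_def linear_form_on_def flat_def
  by (auto simp: tangent_space_lincomb metric_lincomb_right vector_field_tangent[OF assms]
      vector_field_tangent metric_smooth[OF assms])

text \<open>Nondegeneracy makes lowering an index injective; surjectivity needs a dimension count.
  This is done on the model space, where L sends coefficients e to the pairings of the vector F e
  with the frame: an injective linear endomorphism of a Euclidean space is onto.\<close>

lemma ex_metric_sharp:
  assumes \<xi>: "\<xi> \<in> cotangent p"
  shows "\<exists>v\<in>tangent p. \<forall>w\<in>tangent p. gt p v w = \<xi> w"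
proof -
  obtain \<rho> x E where fr: "is_frame p \<rho> x E" using ex_frame by blast
  note x = is_frameD(3)[OF fr] and E = is_frameD(4)[OF fr]
  note Et = vector_field_tangent[OF E]
  \<comment> \<open>F identifies the model space with the tangent space at p through the
    frame.\<close>
  define F where "F = (\<lambda>(e::'e) \<phi>. \<Sum>i\<in>Basis. (e \<bullet> i) * E i p \<phi>)"
  have F: "F e \<in> tangent p" for e unfolding F_def by (rule tangent_space_sum[OF Et])
  have F_lin: "F (a *\<^sub>R e + b *\<^sub>R e') = (\<lambda>\<phi>. a * F e \<phi> + b * F e' \<phi>)" for a b e e'
    unfolding F_def by (simp add: inner_add_left sum.distrib sum_distrib_left algebra_simps)
  define L where "L = (\<lambda>e. \<Sum>j\<in>Basis. gt p (F e) (E j p) *\<^sub>R (j::'e))"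
  have L_inner: "L e \<bullet> j = gt p (F e) (E j p)" if "j \<in> Basis" for e j
    using that unfolding L_def by (simp add: inner_sum_left inner_Basis if_distrib cong: if_cong)
  have lin: "linear L"
  proof (rule linearI)
    show "L (e + e') = L e + L e'" for e e'
      using F_lin[of 1 e 1 e'] unfolding L_def
      by (simp add: metric_lincomb_left[OF F F Et, of 1 e 1 e', simplified] scaleR_left_distrib sum.distrib)
    show "L (a *\<^sub>R e) = a *\<^sub>R L e" for a e
      using F_lin[of a e 0 e] unfolding L_def
      by (simp add: metric_lincomb_left[OF F F Et, of a e 0 e, simplified] scaleR_sum_right)
  qed
  have expand: "gt p v w = (\<Sum>j\<in>Basis. w (x j) * gt p v (E j p))"
    if v: "v \<in> tangent p" and w: "w \<in> tangent p" for v w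
  proof -
    have c: "(\<lambda>w. if w \<in> tangent p then gt p v w else 0) \<in> cotangent p"
      unfolding cotangent_space_def linear_form_on_def
      by (auto simp: tangent_space_lincomb metric_lincomb_right[OF _ _ v])
    from fun_cong[OF frame_covector[OF fr c], of w] show ?thesis
      using w Et by (simp add: differential_apply mult.commute)
  qed
  have "inj L"
    unfolding linear_injective_0[OF lin]
  proof (intro allI impI)
    fix e assume e: "L e = 0"
    have "gt p (F e) (E j p) = 0" if "j \<in> Basis" for j
      using L_inner[OF that, of e] e by simp
    then have "F e = (\<lambda>\<phi>. 0)"
      by (intro metric_nondegenerate[OF F]) (simp add: expand[OF F])
    moreover have "F e (x j) = e \<bullet> j" if "j \<in> Basis" for j
      using that unfolding F_def by (simp add: is_frameD(6)[OF fr] if_distrib cong: if_cong)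
    ultimately have "e \<bullet> j = 0" if "j \<in> Basis" for j using that by simp
    then show "e = 0" by (simp add: euclidean_eq_iff[of e 0])
  qed
  then have "surj L" using linear_injective_imp_surjective[OF lin] by blast
  then obtain e where e: "L e = (\<Sum>j\<in>Basis. \<xi> (E j p) *\<^sub>R j)" by (metis surjD)
  have "gt p (F e) w = \<xi> w" if w: "w \<in> tangent p" for w
  proof -
    have "gt p (F e) (E j p) = \<xi> (E j p)" if "j \<in> Basis" for j
      using L_inner[OF that, of e] that unfolding e
      by (simp add: inner_sum_left inner_Basis if_distrib cong: if_cong)
    then have "gt p (F e) w = (\<Sum>j\<in>Basis. w (x j) * \<xi> (E j p))" by (simp add: expand[OF F w])
    also have "\<dots> = \<xi> w"
      using fun_cong[OF frame_covector[OF fr \<xi>], of w] w by (simp add: differential_apply mult.commute)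
    finally show ?thesis .
  qed
  then show ?thesis using F by blast
qed

lemma metric_eqI:
  assumes "u \<in> tangent p" "v \<in> tangent p" "\<And>w. w \<in> tangent p \<Longrightarrow> gt p u w = gt p v w"
  shows "u = v"
proof -
  have "(\<lambda>\<phi>. 1 * u \<phi> + (-1) * v \<phi>) = (\<lambda>\<phi>. 0)"
    by (rule metric_nondegenerate[OF tangent_space_lincomb[OF assms(1,2)]])
      (subst metric_lincomb_left[OF assms(1,2)], simp_all add: assms(3))
  then show ?thesis by (simp add: fun_eq_iff)
qed

lemma metric_sharp:
  assumes \<xi>: "\<xi> \<in> cotangent p"
  shows metric_sharp_tangent: "metric_sharp A gt p \<xi> \<in> tangent p"
    and metric_sharp_pairing: "w \<in> tangent p \<Longrightarrow> gt p (metric_sharp A gt p \<xi>) w = \<xi> w"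
proof -
  have "\<exists>!v. v \<in> tangent p \<and> (\<forall>w\<in>tangent p. gt p v w = \<xi> w)"
    using ex_metric_sharp[OF \<xi>] by (auto intro: metric_eqI)
  from theI'[OF this] show "metric_sharp A gt p \<xi> \<in> tangent p"
    "w \<in> tangent p \<Longrightarrow> gt p (metric_sharp A gt p \<xi>) w = \<xi> w"
    unfolding metric_sharp_def by blast+
qed

lemma cometric_sharp_right:
  "\<xi> \<in> cotangent p \<Longrightarrow> \<zeta> \<in> cotangent p \<Longrightarrow> g p \<xi> \<zeta> = \<xi> (metric_sharp A gt p \<zeta>)"
  by (simp add: cometric_def metric_sharp_pairing metric_sharp_tangent)

lemma cometric_sym: "\<xi> \<in> cotangent p \<Longrightarrow> \<zeta> \<in> cotangent p \<Longrightarrow> g p \<xi> \<zeta> = g p \<zeta> \<xi>"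
  unfolding cometric_def by (intro metric_sym metric_sharp_tangent)

lemma metric_sharp_flat: "X \<in> vfields \<Longrightarrow> metric_sharp A gt p (flat X p) = X p"
  by (rule metric_eqI[OF metric_sharp_tangent[OF form_cotangent[OF flat_form]] vector_field_tangent])
    (simp_all add: metric_sharp_pairing[OF form_cotangent[OF flat_form]], simp add: flat_def)

text \<open>Turns a pairing by the cometric into an evaluation on a known vector, so that
  \<open>metric_sharp\<close> need not be computed.\<close>

lemma cometric_flat_right: "\<xi> \<in> cotangent p \<Longrightarrow> X \<in> vfields \<Longrightarrow> g p \<xi> (flat X p) = \<xi> (X p)"
  by (simp add: cometric_sharp_right form_cotangent[OF flat_form] metric_sharp_flat)

lemma cometric_bilinear: "bilinear_form_on (cotangent p) (g p)"
proof -
  have l: "g p (\<lambda>v. a * \<xi> v + b * \<zeta> v) \<eta> = a * g p \<xi> \<eta> + b * g p \<zeta> \<eta>"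
    if "\<xi> \<in> cotangent p" "\<zeta> \<in> cotangent p" "\<eta> \<in> cotangent p" for \<xi> \<zeta> \<eta> a b
    using that by (simp add: cometric_sharp_right cotangent_space_lincomb)
  then have "g p \<eta> (\<lambda>v. a * \<xi> v + b * \<zeta> v) = a * g p \<eta> \<xi> + b * g p \<eta> \<zeta>"
    if "\<xi> \<in> cotangent p" "\<zeta> \<in> cotangent p" "\<eta> \<in> cotangent p" for \<xi> \<zeta> \<eta> a b
    using that cometric_sym[OF that(3) cotangent_space_lincomb[OF that(1,2)]]
      cometric_sym[OF that(3,1)] cometric_sym[OF that(3,2)] by simp
  with l show ?thesis unfolding bilinear_form_on_def linear_form_on_def by blast
qed

text \<open>Nondegeneracy of the cometric: pairing with lowered vector fields recovers all values of
  a covector.\<close>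

lemma cometric_eqI:
  assumes "\<xi> \<in> cotangent p" "\<zeta> \<in> cotangent p" "\<And>\<eta>. \<eta> \<in> cotangent p \<Longrightarrow> g p \<xi> \<eta> = g p \<zeta> \<eta>"
  shows "\<xi> = \<zeta>"
proof (rule cotangent_ext[OF assms(1,2)])
  fix v assume "v \<in> tangent p"
  then obtain X where X: "X \<in> vfields" "X p = v" using ex_vector_field by blast
  from assms(3)[OF form_cotangent[OF flat_form[OF X(1)], of p]] show "\<xi> v = \<zeta> v"
    using X by (simp add: cometric_flat_right assms)
qed

end

locale metric_bivector_manifold = metric_manifold A gt + bivector_manifold A P
  for A :: "('a::{t2_space,second_countable_topology}, 'e::euclidean_space) atlas"
    and gt :: "'a metric" and P :: "'a cotensor"
begin

abbreviation "J \<equiv> endo_J A g P"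

text \<open>Lowering the anchor solves the defining equation of J. This gives existence for the
  \<open>THE\<close> and, at the same time, smoothness of J \<alpha>.\<close>

lemma endo_J_eq_flat:
  assumes \<alpha>: "\<alpha> \<in> forms"
  shows "J \<alpha> = flat (sharp \<alpha>)"
proof
  fix p
  have f: "flat (sharp \<alpha>) p \<in> cotangent p"
    by (rule form_cotangent[OF flat_form[OF anchor_vector_field[OF \<alpha>]]])
  have eq: "g p (flat (sharp \<alpha>) p) \<zeta> = P p (\<alpha> p) \<zeta>" if "\<zeta> \<in> cotangent p" for \<zeta>
    unfolding cometric_sym[OF f that] cometric_flat_right[OF that anchor_vector_field[OF \<alpha>]]
    by (rule anchor_pairing[OF \<alpha> that])
  show "J \<alpha> p = flat (sharp \<alpha>) p"
    unfolding endo_J_def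
  proof (rule the_equality)
    show "\<xi> = flat (sharp \<alpha>) p" if "\<xi> \<in> cotangent p \<and> (\<forall>\<zeta>\<in>cotangent p. g p \<xi> \<zeta> = P p (\<alpha> p) \<zeta>)" for \<xi>
      using that eq f by (intro cometric_eqI) auto
  qed (use f eq in blast)
qed

lemma endo_J_form: "\<alpha> \<in> forms \<Longrightarrow> J \<alpha> \<in> forms"
  by (simp add: endo_J_eq_flat flat_form anchor_vector_field)

lemma endo_J_pairing:
  assumes "\<alpha> \<in> forms" "\<beta> \<in> forms"
  shows "tensor_pair g (J \<alpha>) \<beta> p = tensor_pair P \<alpha> \<beta> p"
  using cometric_sym[OF form_cotangent[OF endo_J_form[OF assms(1)]] form_cotangent[OF assms(2)], of p]
    cometric_flat_right[OF form_cotangent[OF assms(2)] anchor_vector_field[OF assms(1)], of p]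
    anchor_pairing[OF assms(1) form_cotangent[OF assms(2)], of p]
  by (simp add: tensor_pair_def endo_J_eq_flat[OF assms(1)])

end

section \<open>The Levi-Civita contravariant connection\<close>

text \<open>The metric is an abstract symmetric cotensor h, because the locale is used for the
  cometrics of the factors and also for the warped metric, which is not presented as the cometric of
  a metric on the product.\<close>

locale levi_civita_manifold = bivector_manifold A P
  for A :: "('a::{t2_space,second_countable_topology}, 'e::euclidean_space) atlas"
    and P :: "'a cotensor" +
  fixes h :: "'a cotensor" and D :: "'a connection"
  assumes h_bilinear: "\<And>p. bilinear_form_on (cotangent p) (h p)"
    and h_sym: "\<And>\<xi> \<zeta> p. \<xi> \<in> cotangent p \<Longrightarrow> \<zeta> \<in> cotangent p \<Longrightarrow> h p \<xi> \<zeta> = h p \<zeta> \<xi>"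
    and levi_civita: "levi_civita_connection A h P D"
begin

abbreviation "pair \<equiv> tensor_pair h"

lemma pair_sym: "\<alpha> \<in> forms \<Longrightarrow> \<beta> \<in> forms \<Longrightarrow> pair \<alpha> \<beta> p = pair \<beta> \<alpha> p"
  by (simp add: tensor_pair_def h_sym form_cotangent)

lemma pair_diff:
  "\<alpha> \<in> forms \<Longrightarrow> \<beta> \<in> forms \<Longrightarrow> \<gamma> \<in> forms \<Longrightarrow>
    pair (\<lambda>p v. \<alpha> p v - \<beta> p v) \<gamma> p = pair \<alpha> \<gamma> p - pair \<beta> \<gamma> p"
  using bilinear_lincomb_left[OF h_bilinear form_cotangent form_cotangent form_cotangent,
      of \<alpha> \<beta> \<gamma> p 1 "-1"]
  by (simp add: tensor_pair_def)

lemma connection_contravariant: "contravariant_connection A P D"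
  using levi_civita unfolding levi_civita_connection_def by blast

lemma connection_form: "\<alpha> \<in> forms \<Longrightarrow> \<beta> \<in> forms \<Longrightarrow> D \<alpha> \<beta> \<in> forms"
  using connection_contravariant unfolding contravariant_connection_def by blast

lemma connection_plus_left:
  assumes "\<alpha> \<in> forms" "\<alpha>' \<in> forms" "\<beta> \<in> forms"
  shows "D (\<alpha> \<oplus> \<alpha>') \<beta> = D \<alpha> \<beta> \<oplus> D \<alpha>' \<beta>"
proof -
  have "D (\<lambda>p v. 1 * \<alpha> p v + 1 * \<alpha>' p v) \<beta> = (\<lambda>p v. 1 * D \<alpha> \<beta> p v + 1 * D \<alpha>' \<beta> p v)"
    using connection_contravariant assms unfolding contravariant_connection_def by blast
  then show ?thesis by (simp add: plus_field_def)
qed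

lemma connection_scale_left:
  assumes "f \<in> smooth" "\<alpha> \<in> forms" "\<beta> \<in> forms"
  shows "D (f \<odot> \<alpha>) \<beta> = f \<odot> D \<alpha> \<beta>"
  using connection_contravariant assms unfolding contravariant_connection_def scale_def by blast

lemma connection_compatible:
  "\<alpha> \<in> forms \<Longrightarrow> \<beta> \<in> forms \<Longrightarrow> \<gamma> \<in> forms \<Longrightarrow>
    sharp \<alpha> p (pair \<beta> \<gamma>) = pair (D \<alpha> \<beta>) \<gamma> p + pair \<beta> (D \<alpha> \<gamma>) p"
  using levi_civita unfolding levi_civita_connection_def by blast

lemma connection_torsion:
  assumes "\<alpha> \<in> forms" "\<beta> \<in> forms" "\<gamma> \<in> forms"
  shows "pair (koszul \<alpha> \<beta>) \<gamma> p = pair (D \<alpha> \<beta>) \<gamma> p - pair (D \<beta> \<alpha>) \<gamma> p"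
proof -
  have "(\<lambda>p v. D \<alpha> \<beta> p v - D \<beta> \<alpha> p v) = koszul \<alpha> \<beta>"
    using levi_civita assms unfolding levi_civita_connection_def by blast
  then show ?thesis
    using pair_diff[OF connection_form[OF assms(1,2)] connection_form[OF assms(2,1)] assms(3), of p] by simp
qed

text \<open>The usual cyclic combination of three compatibility and three torsion identities. The
  right-hand side no longer involves D, so it can be evaluated on lifts.\<close>

lemma koszul_formula:
  assumes \<alpha>: "\<alpha> \<in> forms" and \<beta>: "\<beta> \<in> forms" and \<gamma>: "\<gamma> \<in> forms"
  shows "2 * pair (D \<alpha> \<beta>) \<gamma> p = sharp \<alpha> p (pair \<beta> \<gamma>) + sharp \<beta> p (pair \<alpha> \<gamma>) - sharp \<gamma> p (pair \<alpha> \<beta>)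
    + pair (koszul \<alpha> \<beta>) \<gamma> p - pair (koszul \<beta> \<gamma>) \<alpha> p + pair (koszul \<gamma> \<alpha>) \<beta> p"
  using connection_compatible[OF \<alpha> \<beta> \<gamma>, of p] connection_compatible[OF \<beta> \<alpha> \<gamma>, of p]
    connection_compatible[OF \<gamma> \<alpha> \<beta>, of p] connection_torsion[OF \<alpha> \<beta> \<gamma>, of p]
    connection_torsion[OF \<beta> \<gamma> \<alpha>, of p] connection_torsion[OF \<gamma> \<alpha> \<beta>, of p]
    pair_sym[OF \<beta> connection_form[OF \<alpha> \<gamma>], of p] pair_sym[OF \<alpha> connection_form[OF \<beta> \<gamma>], of p]
    pair_sym[OF \<alpha> connection_form[OF \<gamma> \<beta>], of p]
  by linarith

lemma curvature_pairing:
  assumes \<alpha>: "\<alpha> \<in> forms" and \<beta>: "\<beta> \<in> forms" and \<gamma>: "\<gamma> \<in> forms" and \<theta>: "\<theta> \<in> forms"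
  shows "pair (contra_curvature A P D \<alpha> \<beta> \<gamma>) \<theta> p =
    sharp \<alpha> p (pair (D \<beta> \<gamma>) \<theta>) - pair (D \<beta> \<gamma>) (D \<alpha> \<theta>) p
    - (sharp \<beta> p (pair (D \<alpha> \<gamma>) \<theta>) - pair (D \<alpha> \<gamma>) (D \<beta> \<theta>) p)
    - pair (D (koszul \<alpha> \<beta>) \<gamma>) \<theta> p"
  unfolding contra_curvature_def
  by (simp add: pair_diff form_diff connection_form koszul_form \<alpha> \<beta> \<gamma> \<theta> connection_compatible)

end

section \<open>Pullback of forms\<close>

locale smooth_map = M: smooth_manifold A + N: smooth_manifold B
  for A :: "('a::{t2_space,second_countable_topology}, 'e::euclidean_space) atlas"
    and B :: "('b::{t2_space,second_countable_topology}, 'f::euclidean_space) atlas" +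
  fixes h :: "'b \<Rightarrow> 'a"
  assumes continuous: "continuous_on UNIV h"
    and smooth_comp: "\<phi> \<in> M.smooth \<Longrightarrow> (\<lambda>x. \<phi> (h x)) \<in> N.smooth"
begin

lemma pushforward_apply: "\<phi> \<in> M.smooth \<Longrightarrow> pushforward A h v \<phi> = v (\<lambda>x. \<phi> (h x))"
  by (simp add: pushforward_def o_def)

lemma pushforward_tangent: 
  assumes "v \<in> N.tangent q" shows "pushforward A h v \<in> M.tangent (h q)"
  unfolding tangent_space_def mem_Collect_eq
  by (intro conjI ballI allI impI)
    (simp_all add: pushforward_apply M.smooth_functions_lincomb M.smooth_functions_mult
      N.tangent_lincomb[OF assms] N.tangent_mult[OF assms] smooth_comp,
     simp add: pushforward_def)

lemma pushforward_lincomb: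
  "pushforward A h (\<lambda>\<phi>. a * u \<phi> + b * v \<phi>) = (\<lambda>\<phi>. a * pushforward A h u \<phi> + b * pushforward A h v \<phi>)"
  by (simp add: pushforward_def fun_eq_iff)

lemma pullback_apply:
  "v \<in> N.tangent q \<Longrightarrow> pullback A B h \<omega> q v = \<omega> (h q) (pushforward A h v)"
  by (simp add: pullback_def)

lemma pullback_cotangent: "\<omega> \<in> M.forms \<Longrightarrow> pullback A B h \<omega> q \<in> N.cotangent q"
  unfolding cotangent_space_def linear_form_on_def
  by (auto simp: pullback_apply N.tangent_space_lincomb pushforward_lincomb
      M.cotangent_lincomb[OF M.form_cotangent] pushforward_tangent)
    (simp add: pullback_def)

lemma pullback_differential:
  assumes "\<phi> \<in> M.smooth"
  shows "pullback A B h (M.differential \<phi>) = N.differential (\<lambda>x. \<phi> (h x))"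
  using assms by (intro ext)
    (auto simp: pullback_def exterior_d_def pushforward_apply pushforward_tangent)

lemma pullback_scale: "pullback A B h (f \<odot> \<omega>) = (\<lambda>q. f (h q)) \<odot> pullback A B h \<omega>"
  by (auto simp: pullback_def scale_def fun_eq_iff)

lemma pullback_plus: "pullback A B h (\<omega> \<oplus> \<eta>) = pullback A B h \<omega> \<oplus> pullback A B h \<eta>"
  by (auto simp: pullback_def plus_field_def fun_eq_iff)

text \<open>A field X on the source need not project to a field on the target. Near q, expanding
  \<omega> in a frame at h q gives the sum of \<omega>(E_i) o h times X(x_i o h), which is visibly
  smooth.\<close>

lemma pullback_form:
  assumes \<omega>: "\<omega> \<in> M.forms"
  shows "pullback A B h \<omega> \<in> N.forms"
proof -
  have "(\<lambda>q. pullback A B h \<omega> q (X q)) \<in> N.smooth" if X: "X \<in> N.vfields" for X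
  proof (rule N.smooth_functions_locally)
    fix q
    obtain \<rho> x E where fr: "M.is_frame (h q) \<rho> x E" using M.ex_frame by blast
    note x = M.is_frameD(3)[OF fr] and E = M.is_frameD(4)[OF fr]
    obtain W where W: "open W" "h q \<in> W" "\<forall>p\<in>W. \<rho> p = 1" using M.is_frameD(7)[OF fr] by blast
    let ?\<psi> = "\<lambda>r. \<Sum>i\<in>Basis. \<omega> (h r) (E i (h r)) * X r (\<lambda>s. x i (h s))"
    have "?\<psi> \<in> N.smooth"
      by (intro N.smooth_functions_sum N.smooth_functions_mult
          smooth_comp[OF M.form_smooth[OF \<omega> E]] N.vector_field_smooth[OF X] smooth_comp[OF x])
    moreover have "pullback A B h \<omega> r (X r) = ?\<psi> r" if "r \<in> h -` W" for r
    proof -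
      note Xr = N.vector_field_tangent[OF X, of r]
      have "pullback A B h \<omega> r (X r) = (\<rho> \<odot> \<omega>) (h r) (pushforward A h (X r))"
        using W(3) that by (simp add: pullback_apply[OF Xr] scale_def)
      also have "\<dots> = ?\<psi> r"
        by (simp add: M.frame_form[OF fr \<omega>] M.differential_apply[OF pushforward_tangent[OF Xr]]
            pushforward_apply[OF x])
      finally show ?thesis .
    qed
    moreover have "open (h -` W)" using continuous W(1) by (simp add: continuous_on_open_vimage)
    ultimately show "\<exists>U \<psi>. open U \<and> q \<in> U \<and> \<psi> \<in> N.smooth \<and>
        (\<forall>r\<in>U. pullback A B h \<omega> r (X r) = \<psi> r)"
      using W(2) by (intro exI[of _ "h -` W"] exI[of _ ?\<psi>]) simp
  qed
  then show ?thesis using pullback_cotangent[OF \<omega>] by (simp add: one_forms_def)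
qed

end

section \<open>Products\<close>

lemma smooth_on_Pair:
  assumes "open S" "smooth_on S F" "smooth_on S G"
  shows "smooth_on S (\<lambda>x. (F x, G x))"
proof -
  have "smooth_on S (\<lambda>x. (F x, 0) + (0, G x))"
    by (intro smooth_on_add assms(1)
        smooth_on_bounded_linear[OF assms(1) bounded_linear_Pair[OF bounded_linear_ident
            bounded_linear_zero] assms(2)]
        smooth_on_bounded_linear[OF assms(1) bounded_linear_Pair[OF bounded_linear_zero
            bounded_linear_ident] assms(3)])
  then show ?thesis by simp
qed

lemma smooth_on_fst:
  fixes F :: "'x::euclidean_space \<Rightarrow> 'z::real_normed_vector" and T :: "'y::euclidean_space set"
  assumes "open S" "open T" "smooth_on S F"
  shows "smooth_on (S \<times> T) (\<lambda>y. F (fst y))"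
  by (rule smooth_on_compose[OF open_Times[OF assms(1,2)] assms(1) _
        smooth_on_linear[OF bounded_linear_fst open_Times[OF assms(1,2)]] assms(3)]) auto

lemma smooth_on_snd:
  fixes F :: "'y::euclidean_space \<Rightarrow> 'z::real_normed_vector" and S :: "'x::euclidean_space set"
  assumes "open S" "open T" "smooth_on T F"
  shows "smooth_on (S \<times> T) (\<lambda>y. F (snd y))"
  by (rule smooth_on_compose[OF open_Times[OF assms(1,2)] assms(2) _
        smooth_on_linear[OF bounded_linear_snd open_Times[OF assms(1,2)]] assms(3)]) auto

locale product_manifold = M1: smooth_manifold A + M2: smooth_manifold B
  for A :: "('a::{t2_space,second_countable_topology}, 'e::euclidean_space) atlas"
    and B :: "('b::{t2_space,second_countable_topology}, 'f::euclidean_space) atlas"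
begin

lemma prod_chart_cases:
  assumes "(W, k) \<in> prod_atlas A B"
  obtains U c V e where "(U, c) \<in> A" "(V, e) \<in> B" "W = U \<times> V" "k = map_prod c e"
  using assms unfolding prod_atlas_def by auto

lemma prod_chart: "(U, c) \<in> A \<Longrightarrow> (V, e) \<in> B \<Longrightarrow> (U \<times> V, map_prod c e) \<in> prod_atlas A B"
  unfolding prod_atlas_def by force

lemma prod_chart_image: "map_prod c e ` (U \<times> V) = c ` U \<times> e ` V"
  by (rule map_prod_surj_on) auto

lemma prod_chart_inverse:
  assumes "(U, c) \<in> A" "(V, e) \<in> B" "y \<in> c ` U" "z \<in> e ` V"
  shows "inv_into (U \<times> V) (map_prod c e) (y, z) = (inv_into U c y, inv_into V e z)"
proof -
  have inj: "inj_on (map_prod c e) (U \<times> V)"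
    using inj_on_inverseI[of U "inv_into U c" c] inj_on_inverseI[of V "inv_into V e" e]
      M1.chart_inverse[OF assms(1)] M2.chart_inverse[OF assms(2)] by (blast intro: map_prod_inj_on)
  obtain p q where pq: "p \<in> U" "q \<in> V" "y = c p" "z = e q" using assms(3,4) by blast
  have "inv_into (U \<times> V) (map_prod c e) (map_prod c e (p, q)) = (p, q)"
    by (rule inv_into_f_f[OF inj]) (use pq in auto)
  then show ?thesis
    using pq M1.chart_inverse[OF assms(1)] M2.chart_inverse[OF assms(2)] by simp
qed

lemma smooth_atlas_prod: "smooth_atlas (prod_atlas A B)"
proof -
  have 1: "(\<Union>(U, c)\<in>prod_atlas A B. U) = UNIV"
  proof -
    have "z \<in> (\<Union>(U, c)\<in>prod_atlas A B. U)" for z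
    proof -
      obtain U c V e where UV: "(U, c) \<in> A" "fst z \<in> U" "(V, e) \<in> B" "snd z \<in> V"
        using M1.ex_chart M2.ex_chart by metis
      then show ?thesis by (intro UN_I[OF prod_chart[OF UV(1,3)]]) (simp add: mem_Times_iff)
    qed
    then show ?thesis by blast
  qed
  have 2: "open W \<and> open (k ` W) \<and> homeomorphism W (k ` W) k (inv_into W k)"
    if W: "(W, k) \<in> prod_atlas A B" for W k
  proof -
    obtain U c V e where U: "(U, c) \<in> A" and V: "(V, e) \<in> B" and Wk: "W = U \<times> V" "k = map_prod c e"
      using prod_chart_cases[OF W] by blast
    note hU = M1.chart_homeomorphism[OF U] and hV = M2.chart_homeomorphism[OF V]
    have o: "open (k ` W)"
      unfolding Wk prod_chart_image by (intro open_Times M1.chart_image_open[OF U]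
          M2.chart_image_open[OF V])
    have "continuous_on (k ` W) (\<lambda>y. (inv_into U c (fst y), inv_into V e (snd y)))"
      unfolding Wk prod_chart_image
      by (intro continuous_on_Pair continuous_on_compose2[OF homeomorphism_cont2[OF hU]]
          continuous_on_compose2[OF homeomorphism_cont2[OF hV]] continuous_on_fst continuous_on_snd
          continuous_on_id) auto
    then have ci: "continuous_on (k ` W) (inv_into W k)"
      by (rule continuous_on_eq) (auto simp: Wk prod_chart_inverse[OF U V])
    have "continuous_on W (\<lambda>z. (c (fst z), e (snd z)))"
      unfolding Wk
      by (intro continuous_on_Pair continuous_on_compose2[OF homeomorphism_cont1[OF hU]]
          continuous_on_compose2[OF homeomorphism_cont1[OF hV]] continuous_on_fst continuous_on_snd
          continuous_on_id) auto
    then have ck: "continuous_on W k" by (rule continuous_on_eq) (auto simp: Wk)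
    have "homeomorphism W (k ` W) k (inv_into W k)"
      by (rule homeomorphismI[OF ck ci])
        (auto simp: Wk prod_chart_inverse[OF U V] M1.chart_inverse[OF U] M2.chart_inverse[OF V])
    then show ?thesis
      using o unfolding Wk by (simp add: open_Times M1.chart_open[OF U] M2.chart_open[OF V])
  qed
  have 3: "smooth_on (k ` (W \<inter> W')) (k' \<circ> inv_into W k)"
    if W: "(W, k) \<in> prod_atlas A B" and W': "(W', k') \<in> prod_atlas A B" for W k W' k'
  proof -
    obtain U c V e where U: "(U, c) \<in> A" and V: "(V, e) \<in> B" and Wk: "W = U \<times> V" "k = map_prod c e"
      using prod_chart_cases[OF W] by blast
    obtain U' c' V' e' where U': "(U', c') \<in> A" and V': "(V', e') \<in> B"
      and Wk': "W' = U' \<times> V'" "k' = map_prod c' e'"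
      using prod_chart_cases[OF W'] by blast
    have oU: "open (c ` (U \<inter> U'))"
      using M1.chart_subset_open[OF U] M1.chart_open[OF U] M1.chart_open[OF U'] by blast
    have oV: "open (e ` (V \<inter> V'))"
      using M2.chart_subset_open[OF V] M2.chart_open[OF V] M2.chart_open[OF V'] by blast
    have im: "k ` (W \<inter> W') = c ` (U \<inter> U') \<times> e ` (V \<inter> V')"
      unfolding Wk Wk' Times_Int_Times prod_chart_image ..
    have "smooth_on (c ` (U \<inter> U') \<times> e ` (V \<inter> V'))
        (\<lambda>y. ((c' \<circ> inv_into U c) (fst y), (e' \<circ> inv_into V e) (snd y)))"
      by (intro smooth_on_Pair open_Times oU oV smooth_on_fst[OF oU oV M1.chart_transition[OF U U']]
          smooth_on_snd[OF oU oV M2.chart_transition[OF V V']])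
    then show ?thesis
      unfolding im
      by (rule smooth_on_cong[OF open_Times[OF oU oV], rotated])
        (auto simp: Wk Wk' prod_chart_inverse[OF U V])
  qed
  show ?thesis unfolding smooth_atlas_def using 1 2 3 by auto
qed

end

sublocale product_manifold \<subseteq> M: smooth_manifold "prod_atlas A B"
  by unfold_locales (rule smooth_atlas_prod)

context product_manifold begin

section \<open>Functions lifted to the product and restricted to slices\<close>

lemma smooth_functions_fst:
  assumes "\<phi> \<in> M1.smooth"
  shows "(\<lambda>z. \<phi> (fst z)) \<in> M.smooth"
  unfolding smooth_functions_def
proof (clarify, elim prod_chart_cases)
  fix W k U c V e assume U: "(U, c) \<in> A" and V: "(V, e) \<in> B" and Wk: "W = U \<times> V" "k = map_prod c e"
  note oU = M1.chart_image_open[OF U] and oV = M2.chart_image_open[OF V]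
  show "smooth_on (k ` W) ((\<lambda>z. \<phi> (fst z)) \<circ> inv_into W k)"
    unfolding Wk prod_chart_image
    by (rule smooth_on_cong[OF open_Times[OF oU oV] _
          smooth_on_fst[OF oU oV M1.smooth_functions_chart[OF assms U]]])
      (auto simp: prod_chart_inverse[OF U V])
qed

lemma smooth_functions_snd:
  assumes "\<phi> \<in> M2.smooth"
  shows "(\<lambda>z. \<phi> (snd z)) \<in> M.smooth"
  unfolding smooth_functions_def
proof (clarify, elim prod_chart_cases)
  fix W k U c V e assume U: "(U, c) \<in> A" and V: "(V, e) \<in> B" and Wk: "W = U \<times> V" "k = map_prod c e"
  note oU = M1.chart_image_open[OF U] and oV = M2.chart_image_open[OF V]
  show "smooth_on (k ` W) ((\<lambda>z. \<phi> (snd z)) \<circ> inv_into W k)"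
    unfolding Wk prod_chart_image
    by (rule smooth_on_cong[OF open_Times[OF oU oV] _
          smooth_on_snd[OF oU oV M2.smooth_functions_chart[OF assms V]]])
      (auto simp: prod_chart_inverse[OF U V])
qed

text \<open>Brings smoothness back from the product to a factor; together with its counterpart for
  the second factor it yields smoothness of the cometrics on 1-forms.\<close>

lemma smooth_functions_slice_fst:
  assumes F: "F \<in> M.smooth"
  shows "(\<lambda>p. F (p, q)) \<in> M1.smooth"
  unfolding smooth_functions_def
proof clarify
  fix U c assume U: "(U, c) \<in> A"
  obtain V e where V: "(V, e) \<in> B" "q \<in> V" using M2.ex_chart by blast
  note oU = M1.chart_image_open[OF U] and oV = M2.chart_image_open[OF V(1)]
  have o: "open (map_prod c e ` (U \<times> V))" unfolding prod_chart_image by (intro open_Times oU oV)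
  have "smooth_on (c ` U) (\<lambda>y. F (inv_into (U \<times> V) (map_prod c e) (y, e q)))"
    by (rule smooth_on_compose[OF oU o _ smooth_on_Pair[OF oU smooth_on_linear[OF bounded_linear_ident oU]
            smooth_on_const[OF oU]] M.smooth_functions_chart[OF F prod_chart[OF U V(1)]]])
      (use V(2) in \<open>auto simp: prod_chart_image\<close>)
  then show "smooth_on (c ` U) ((\<lambda>p. F (p, q)) \<circ> inv_into U c)"
    by (rule smooth_on_cong[OF oU, rotated])
      (use V(2) in \<open>auto simp: prod_chart_inverse[OF U V(1)] M1.chart_inverse[OF U]
          M2.chart_inverse[OF V(1)]\<close>)
qed

lemma smooth_functions_slice_snd:
  assumes F: "F \<in> M.smooth"
  shows "(\<lambda>q. F (p, q)) \<in> M2.smooth"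
  unfolding smooth_functions_def
proof clarify
  fix V e assume V: "(V, e) \<in> B"
  obtain U c where U: "(U, c) \<in> A" "p \<in> U" using M1.ex_chart by blast
  note oU = M1.chart_image_open[OF U(1)] and oV = M2.chart_image_open[OF V]
  have o: "open (map_prod c e ` (U \<times> V))" unfolding prod_chart_image by (intro open_Times oU oV)
  have "smooth_on (e ` V) (\<lambda>y. F (inv_into (U \<times> V) (map_prod c e) (c p, y)))"
    by (rule smooth_on_compose[OF oV o _ smooth_on_Pair[OF oV smooth_on_const[OF oV]
            smooth_on_linear[OF bounded_linear_ident oV]] M.smooth_functions_chart[OF F
                prod_chart[OF U(1) V]]])
      (use U(2) in \<open>auto simp: prod_chart_image\<close>)
  then show "smooth_on (e ` V) ((\<lambda>q. F (p, q)) \<circ> inv_into V e)"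
    by (rule smooth_on_cong[OF oV, rotated])
      (use U(2) in \<open>auto simp: prod_chart_inverse[OF U(1) V] M1.chart_inverse[OF U(1)]
          M2.chart_inverse[OF V]\<close>)
qed

end

sublocale product_manifold \<subseteq> fst: smooth_map A "prod_atlas A B" fst
  by unfold_locales (auto intro: continuous_intros smooth_functions_fst)

sublocale product_manifold \<subseteq> snd: smooth_map B "prod_atlas A B" snd
  by unfold_locales (auto intro: continuous_intros smooth_functions_snd)

context product_manifold begin

section \<open>Lifts of 1-forms span the cotangent spaces of the product\<close>

abbreviation "hl \<equiv> hlift A B"
abbreviation "vl \<equiv> vlift A B"

lemmas hl_form = fst.pullback_form[folded hlift_def]
  and hl_differential = fst.pullback_differential[folded hlift_def]
  and hl_scale = fst.pullback_scale[folded hlift_def]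
  and hl_plus = fst.pullback_plus[folded hlift_def]

lemmas vl_form = snd.pullback_form[folded vlift_def]
  and vl_differential = snd.pullback_differential[folded vlift_def]
  and vl_scale = snd.pullback_scale[folded vlift_def]
  and vl_plus = snd.pullback_plus[folded vlift_def]

text \<open>Product coordinates can be taken as pullbacks of coordinates on the factors. Their
  differentials are then lifts of exact forms.\<close>

lemma ex_lifted_frame:
  obtains \<rho> x E where "M.is_frame (p, q) \<rho> x E"
    "\<And>i. i \<in> Basis \<Longrightarrow> (\<exists>\<phi>\<in>M1.smooth. x i = (\<lambda>z. \<phi> (fst z))) \<or> (\<exists>\<psi>\<in>M2.smooth. x i = (\<lambda>z. \<psi> (snd z)))"
proof -
  obtain U c where U: "(U, c) \<in> A" "p \<in> U" using M1.ex_chart by blast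
  obtain V e where V: "(V, e) \<in> B" "q \<in> V" using M2.ex_chart by blast
  obtain x W where x: "open W" "p \<in> W" "W \<subseteq> U" "\<And>i. x i \<in> M1.smooth" "\<And>i q. q \<in> W \<Longrightarrow> x i q = c q \<bullet> i"
    using M1.ex_coordinates[OF U] by metis
  obtain y W' where y: "open W'" "q \<in> W'" "W' \<subseteq> V" "\<And>i. y i \<in> M2.smooth" "\<And>i q. q \<in> W' \<Longrightarrow> y i q = e q \<bullet> i"
    using M2.ex_coordinates[OF V] by metis
  \<comment> \<open>A basis vector of the product has exactly one nonzero component, so
    \<open>snd i = 0\<close> singles out the coordinates of the first factor.\<close>
  define w :: "'e \<times> 'f \<Rightarrow> 'a \<times> 'b \<Rightarrow> real" where
    "w = (\<lambda>i z. if snd i = 0 then x (fst i) (fst z) else y (snd i) (snd z))"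
  have w: "w i \<in> M.smooth" for i
    unfolding w_def by (cases "snd i = 0") (simp_all add: smooth_functions_fst smooth_functions_snd x y)
  have wc: "w i z = map_prod c e z \<bullet> i" if "i \<in> Basis" "z \<in> W \<times> W'" for i z
    using that by (auto simp: w_def Basis_prod_def x(5) y(5) inner_prod_def)
  obtain \<rho> E where "M.is_frame (p, q) \<rho> w E"
    by (rule M.frame_of_coordinates[OF prod_chart[OF U(1) V(1)], of "W \<times> W'" "(p, q)" w])
      (use x(1-3) y(1-3) w wc in \<open>auto intro: open_Times\<close>)
  moreover have "(\<exists>\<phi>\<in>M1.smooth. w i = (\<lambda>z. \<phi> (fst z))) \<or> (\<exists>\<psi>\<in>M2.smooth. w i = (\<lambda>z. \<psi> (snd z)))" for i
    unfolding w_def using x(4) y(4) by (cases "snd i = 0") auto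
  ultimately show thesis using that by blast
qed

text \<open>The coordinate differentials of a lifted frame are lifts and span the cotangent space,
  so agreement on lifts extends by linearity in the second slot.\<close>

lemma bilinear_eq_on_lifts:
  assumes G: "bilinear_form_on (M.cotangent (p, q)) G"
    and \<xi>: "\<xi> \<in> M.cotangent (p, q)" and \<zeta>: "\<zeta> \<in> M.cotangent (p, q)"
    and hl: "\<And>\<gamma>. \<gamma> \<in> M1.forms \<Longrightarrow> G \<xi> (hl \<gamma> (p, q)) = G \<zeta> (hl \<gamma> (p, q))"
    and vl: "\<And>\<gamma>. \<gamma> \<in> M2.forms \<Longrightarrow> G \<xi> (vl \<gamma> (p, q)) = G \<zeta> (vl \<gamma> (p, q))"
    and \<eta>: "\<eta> \<in> M.cotangent (p, q)"
  shows "G \<xi> \<eta> = G \<zeta> \<eta>"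
proof -
  obtain \<rho> x E where fr: "M.is_frame (p, q) \<rho> x E"
    and x: "\<And>i. i \<in> Basis \<Longrightarrow> (\<exists>\<phi>\<in>M1.smooth. x i = (\<lambda>z. \<phi> (fst z))) \<or> (\<exists>\<psi>\<in>M2.smooth. x i = (\<lambda>z. \<psi> (snd z)))"
    using ex_lifted_frame by metis
  have dx: "M.differential (x i) (p, q) \<in> M.cotangent (p, q)" for i
    by (rule M.form_cotangent[OF M.form_differential[OF M.is_frameD(3)[OF fr]]])
  have "G \<xi> (M.differential (x i) (p, q)) = G \<zeta> (M.differential (x i) (p, q))" if "i \<in> Basis" for i
    using x[OF that] hl[OF M1.form_differential] vl[OF M2.form_differential]
    by (auto simp: hl_differential vl_differential)
  then have "G \<xi> (\<lambda>v. \<Sum>i\<in>Basis. \<eta> (E i (p, q)) * M.differential (x i) (p, q) v)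
      = G \<zeta> (\<lambda>v. \<Sum>i\<in>Basis. \<eta> (E i (p, q)) * M.differential (x i) (p, q) v)"
    by (simp add: M.bilinear_sum_right[OF G \<xi> dx] M.bilinear_sum_right[OF G \<zeta> dx])
  then show ?thesis using M.frame_covector[OF fr \<eta>] by simp
qed

end

section \<open>The warped bivector field\<close>

text \<open>The two sides of each bracket formula below satisfy the same Leibniz rules, so their difference is
  tensorial in both arguments and only has to be computed on exact forms.\<close>

lemma bitensorial_vanish:
  fixes A :: "('a::{t2_space,second_countable_topology}, 'e::euclidean_space) atlas"
    and B :: "('b::{t2_space,second_countable_topology}, 'f::euclidean_space) atlas"
    and \<Delta> :: "('a \<Rightarrow> 'a covec) \<Rightarrow> ('b \<Rightarrow> 'b covec) \<Rightarrow> real"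
  assumes A: "smooth_manifold A" and B: "smooth_manifold B"
    and exact: "\<And>\<phi> \<psi>. \<phi> \<in> smooth_functions A \<Longrightarrow> \<psi> \<in> smooth_functions B \<Longrightarrow>
      \<Delta> (exterior_d A \<phi>) (exterior_d B \<psi>) = 0"
    and scale_left: "\<And>f \<alpha> \<beta>. f \<in> smooth_functions A \<Longrightarrow> \<alpha> \<in> one_forms A \<Longrightarrow> \<beta> \<in> one_forms B \<Longrightarrow>
      \<Delta> (f \<odot> \<alpha>) \<beta> = f p * \<Delta> \<alpha> \<beta>"
    and scale_right: "\<And>f \<alpha> \<beta>. f \<in> smooth_functions B \<Longrightarrow> \<alpha> \<in> one_forms A \<Longrightarrow> \<beta> \<in> one_forms B \<Longrightarrow>
      \<Delta> \<alpha> (f \<odot> \<beta>) = f q * \<Delta> \<alpha> \<beta>"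
    and plus_left: "\<And>\<alpha> \<alpha>' \<beta>. \<alpha> \<in> one_forms A \<Longrightarrow> \<alpha>' \<in> one_forms A \<Longrightarrow> \<beta> \<in> one_forms B \<Longrightarrow>
      \<Delta> (\<alpha> \<oplus> \<alpha>') \<beta> = \<Delta> \<alpha> \<beta> + \<Delta> \<alpha>' \<beta>"
    and plus_right: "\<And>\<alpha> \<beta> \<beta>'. \<alpha> \<in> one_forms A \<Longrightarrow> \<beta> \<in> one_forms B \<Longrightarrow> \<beta>' \<in> one_forms B \<Longrightarrow>
      \<Delta> \<alpha> (\<beta> \<oplus> \<beta>') = \<Delta> \<alpha> \<beta> + \<Delta> \<alpha> \<beta>'"
    and "\<alpha> \<in> one_forms A" "\<beta> \<in> one_forms B"
  shows "\<Delta> \<alpha> \<beta> = 0"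
proof -
  interpret M: smooth_manifold A by (rule A)
  interpret N: smooth_manifold B by (rule B)
  have right: "\<Delta> (M.differential \<phi>) \<beta> = 0" if \<phi>: "\<phi> \<in> M.smooth" and "\<beta> \<in> N.forms" for \<phi> \<beta>
    using that(2)
  proof (induction \<beta> rule: N.form_induct_at[where p = q])
    case (multiple \<rho> \<eta>)
    then show ?case using scale_right[OF _ M.form_differential[OF \<phi>]] by simp
  qed (simp_all add: exact \<phi> scale_right plus_right M.form_differential)
  show ?thesis using \<open>\<alpha> \<in> one_forms A\<close>
  proof (induction \<alpha> rule: M.form_induct_at[where p = p])
    case (multiple \<rho> \<eta>)
    then show ?case using scale_left[OF _ _ \<open>\<beta> \<in> one_forms B\<close>] by simp
  qed (simp_all add: right scale_left plus_left \<open>\<beta> \<in> one_forms B\<close>)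
qed

locale warped_bivector_manifold = product_manifold A B +
    B1: bivector_manifold A P1 + B2: bivector_manifold B P2
  for A :: "('a::{t2_space,second_countable_topology}, 'e::euclidean_space) atlas"
    and B :: "('b::{t2_space,second_countable_topology}, 'f::euclidean_space) atlas"
    and P1 :: "'a cotensor" and P2 :: "'b cotensor" +
  fixes P :: "('a \<times> 'b) cotensor" and \<mu> :: "'a \<Rightarrow> real"
  assumes \<mu>: "\<mu> \<in> M1.smooth" and warped: "warped_bivector A B \<mu> P1 P2 P"

sublocale warped_bivector_manifold \<subseteq> BM: bivector_manifold "prod_atlas A B" P
  using warped by unfold_locales (simp add: warped_bivector_def)

context warped_bivector_manifold begin

abbreviation "d\<mu> \<equiv> M1.differential \<mu>"

lemma warped_hh: "\<alpha> \<in> M1.forms \<Longrightarrow> \<beta> \<in> M1.forms \<Longrightarrow>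
    tensor_pair P (hl \<alpha>) (hl \<beta>) z = tensor_pair P1 \<alpha> \<beta> (fst z)"
  and warped_vv: "\<alpha>' \<in> M2.forms \<Longrightarrow> \<beta>' \<in> M2.forms \<Longrightarrow>
    tensor_pair P (vl \<alpha>') (vl \<beta>') z = \<mu> (fst z) * tensor_pair P2 \<alpha>' \<beta>' (snd z)"
  and warped_hv: "\<alpha> \<in> M1.forms \<Longrightarrow> \<beta>' \<in> M2.forms \<Longrightarrow> tensor_pair P (hl \<alpha>) (vl \<beta>') z = 0"
  using warped unfolding warped_bivector_def by (cases z; simp)+

lemma warped_vh: "\<alpha>' \<in> M2.forms \<Longrightarrow> \<beta> \<in> M1.forms \<Longrightarrow> tensor_pair P (vl \<alpha>') (hl \<beta>) z = 0"
  using BM.tensor_pair_antisym[OF vl_form hl_form] warped_hv by simp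

section \<open>The anchor on lifted functions\<close>

text \<open>The differential of a lifted function is the lift of its differential, so the action of
  the anchor can be read off from the defining equations of P. The three rules that follow have the
  same reason.\<close>

lemma sharp_h_fst:
  "\<alpha> \<in> M1.forms \<Longrightarrow> \<phi> \<in> M1.smooth \<Longrightarrow> BM.sharp (hl \<alpha>) z (\<lambda>z. \<phi> (fst z)) = B1.sharp \<alpha> (fst z) \<phi>"
  by (simp add: BM.anchor_apply hl_form smooth_functions_fst flip: hl_differential)
    (simp add: warped_hh M1.form_differential B1.anchor_apply)

lemma sharp_h_snd:
  "\<alpha> \<in> M1.forms \<Longrightarrow> \<psi> \<in> M2.smooth \<Longrightarrow> BM.sharp (hl \<alpha>) z (\<lambda>z. \<psi> (snd z)) = 0"
  by (simp add: BM.anchor_apply hl_form smooth_functions_snd flip: vl_differential)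
    (simp add: warped_hv M2.form_differential)

lemma sharp_v_fst:
  "\<alpha> \<in> M2.forms \<Longrightarrow> \<phi> \<in> M1.smooth \<Longrightarrow> BM.sharp (vl \<alpha>) z (\<lambda>z. \<phi> (fst z)) = 0"
  by (simp add: BM.anchor_apply vl_form smooth_functions_fst flip: hl_differential)
    (simp add: warped_vh M1.form_differential)

lemma sharp_v_snd:
  "\<alpha> \<in> M2.forms \<Longrightarrow> \<psi> \<in> M2.smooth \<Longrightarrow>
    BM.sharp (vl \<alpha>) z (\<lambda>z. \<psi> (snd z)) = \<mu> (fst z) * B2.sharp \<alpha> (snd z) \<psi>"
  by (simp add: BM.anchor_apply vl_form smooth_functions_snd flip: vl_differential)
    (simp add: warped_vv M2.form_differential B2.anchor_apply)

lemma sharp_h_prod: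
  assumes "\<alpha> \<in> M1.forms" "\<phi> \<in> M1.smooth" "\<psi> \<in> M2.smooth"
  shows "BM.sharp (hl \<alpha>) z (\<lambda>z. \<phi> (fst z) * \<psi> (snd z)) = \<psi> (snd z) * B1.sharp \<alpha> (fst z) \<phi>"
  using M.tangent_mult[OF BM.anchor_tangent[OF hl_form[OF assms(1)]]
      smooth_functions_fst[OF assms(2)] smooth_functions_snd[OF assms(3)], of z]
  by (simp add: sharp_h_fst sharp_h_snd assms)

lemma sharp_v_prod:
  assumes "\<alpha> \<in> M2.forms" "\<phi> \<in> M1.smooth" "\<psi> \<in> M2.smooth"
  shows "BM.sharp (vl \<alpha>) z (\<lambda>z. \<phi> (fst z) * \<psi> (snd z)) = \<phi> (fst z) * \<mu> (fst z) * B2.sharp \<alpha> (snd z) \<psi>"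
  using M.tangent_mult[OF BM.anchor_tangent[OF vl_form[OF assms(1)]]
      smooth_functions_fst[OF assms(2)] smooth_functions_snd[OF assms(3)], of z]
  by (simp add: sharp_v_fst sharp_v_snd assms)

lemma hl_apply: "v \<in> M.tangent z \<Longrightarrow> hl \<omega> z v = \<omega> (fst z) (pushforward A fst v)"
  unfolding hlift_def by (rule fst.pullback_apply)

lemma vl_apply: "v \<in> M.tangent z \<Longrightarrow> vl \<omega> z v = \<omega> (snd z) (pushforward B snd v)"
  unfolding vlift_def by (rule snd.pullback_apply)

section \<open>Koszul brackets of lifts\<close>

lemma koszul_hh:
  assumes \<alpha>: "\<alpha> \<in> M1.forms" and \<beta>: "\<beta> \<in> M1.forms"
  shows "BM.koszul (hl \<alpha>) (hl \<beta>) = hl (B1.koszul \<alpha> \<beta>)"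
proof
  fix z
  show "BM.koszul (hl \<alpha>) (hl \<beta>) z = hl (B1.koszul \<alpha> \<beta>) z"
  proof (rule M.cotangent_ext)
    show "BM.koszul (hl \<alpha>) (hl \<beta>) z \<in> M.cotangent z" "hl (B1.koszul \<alpha> \<beta>) z \<in> M.cotangent z"
      by (intro M.form_cotangent BM.koszul_form hl_form B1.koszul_form \<alpha> \<beta>)+
    fix v assume v: "v \<in> M.tangent z"
    let ?\<Delta> = "\<lambda>\<alpha> \<beta>. BM.koszul (hl \<alpha>) (hl \<beta>) z v - hl (B1.koszul \<alpha> \<beta>) z v"
    have "?\<Delta> \<alpha> \<beta> = 0"
    proof (rule bitensorial_vanish[of A A ?\<Delta>, where p = "fst z" and q = "fst z",
          OF M1.smooth_manifold_axioms M1.smooth_manifold_axioms _ _ _ _ _ \<alpha> \<beta>])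
      fix \<phi> \<psi> assume \<phi>: "\<phi> \<in> M1.smooth" and \<psi>: "\<psi> \<in> M1.smooth"
      have "tensor_pair P (hl (M1.differential \<phi>)) (hl (M1.differential \<psi>))
          = (\<lambda>z. tensor_pair P1 (M1.differential \<phi>) (M1.differential \<psi>) (fst z))"
        by (simp add: warped_hh M1.form_differential \<phi> \<psi> fun_eq_iff)
      then show "?\<Delta> (M1.differential \<phi>) (M1.differential \<psi>) = 0"
        by (simp add: hl_differential BM.koszul_exact B1.koszul_exact smooth_functions_fst
            B1.bivector_smooth M1.form_differential \<phi> \<psi>)
    qed (simp_all add: hl_scale hl_plus BM.koszul_scale_left BM.koszul_scale_right BM.koszul_plus_left
        BM.koszul_plus_right smooth_functions_fst hl_form hl_apply[OF v] B1.koszul_scale_left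
        B1.koszul_scale_right B1.koszul_plus_left B1.koszul_plus_right sharp_h_fst algebra_simps)
    then show "BM.koszul (hl \<alpha>) (hl \<beta>) z v = hl (B1.koszul \<alpha> \<beta>) z v" by simp
  qed
qed

text \<open>The bracket is already tensorial here: the anchor of a horizontal lift kills functions
  of the second factor and vice versa, so no Leibniz terms arise. On exact forms it is d of the zero
  function.\<close>

lemma koszul_hv:
  assumes \<alpha>: "\<alpha> \<in> M1.forms" and \<beta>: "\<beta> \<in> M2.forms"
  shows "BM.koszul (hl \<alpha>) (vl \<beta>) = (\<lambda>z v. 0)"
proof
  fix z
  show "BM.koszul (hl \<alpha>) (vl \<beta>) z = (\<lambda>v. 0)"
  proof (rule M.cotangent_ext)
    show "BM.koszul (hl \<alpha>) (vl \<beta>) z \<in> M.cotangent z" "(\<lambda>v. 0) \<in> M.cotangent z"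
      by (intro M.form_cotangent BM.koszul_form hl_form vl_form \<alpha> \<beta> M.cotangent_space_zero)+
    fix v assume v: "v \<in> M.tangent z"
    let ?\<Delta> = "\<lambda>\<alpha> \<beta>. BM.koszul (hl \<alpha>) (vl \<beta>) z v"
    show "?\<Delta> \<alpha> \<beta> = 0"
    proof (rule bitensorial_vanish[of A B ?\<Delta>, where p = "fst z" and q = "snd z",
          OF M1.smooth_manifold_axioms M2.smooth_manifold_axioms _ _ _ _ _ \<alpha> \<beta>])
      fix \<phi> \<psi> assume "\<phi> \<in> M1.smooth" "\<psi> \<in> M2.smooth"
      then have "tensor_pair P (hl (M1.differential \<phi>)) (vl (M2.differential \<psi>)) = (\<lambda>z. 0)"
        by (simp add: warped_hv M1.form_differential M2.form_differential fun_eq_iff)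
      then show "?\<Delta> (M1.differential \<phi>) (M2.differential \<psi>) = 0"
        using \<open>\<phi> \<in> M1.smooth\<close> \<open>\<psi> \<in> M2.smooth\<close>
        by (simp add: hl_differential vl_differential BM.koszul_exact smooth_functions_fst
            smooth_functions_snd M.differential_apply[OF v] M.tangent_const[OF v])
    qed (simp_all add: hl_scale hl_plus vl_scale vl_plus BM.koszul_scale_left BM.koszul_scale_right
        BM.koszul_plus_left BM.koszul_plus_right smooth_functions_fst smooth_functions_snd hl_form vl_form
        sharp_h_snd sharp_v_fst)
  qed
qed

text \<open>For exact forms the bracket is d(\<mu> \<pi>), where \<pi> is P2 of the two
  differentials. The product rule splits it into the lifted bracket and the horizontal term with
  d\<mu>.\<close>

lemma koszul_vv:
  assumes \<alpha>: "\<alpha> \<in> M2.forms" and \<beta>: "\<beta> \<in> M2.forms"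
  shows "BM.koszul (vl \<alpha>) (vl \<beta>) =
    ((\<lambda>z. \<mu> (fst z)) \<odot> vl (B2.koszul \<alpha> \<beta>)) \<oplus> ((\<lambda>z. tensor_pair P2 \<alpha> \<beta> (snd z)) \<odot> hl d\<mu>)"
    (is "_ = ?K \<alpha> \<beta>")
proof
  fix z
  note sm = smooth_functions_fst[OF \<mu>] smooth_functions_snd hl_form[OF M1.form_differential[OF \<mu>]]
  show "BM.koszul (vl \<alpha>) (vl \<beta>) z = ?K \<alpha> \<beta> z"
  proof (rule M.cotangent_ext)
    show "BM.koszul (vl \<alpha>) (vl \<beta>) z \<in> M.cotangent z" "?K \<alpha> \<beta> z \<in> M.cotangent z"
      by (intro M.form_cotangent BM.koszul_form vl_form B2.koszul_form M.form_plus M.form_scale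
          sm B2.bivector_smooth \<alpha> \<beta>)+
    fix v assume v: "v \<in> M.tangent z"
    let ?\<Delta> = "\<lambda>\<alpha> \<beta>. BM.koszul (vl \<alpha>) (vl \<beta>) z v - ?K \<alpha> \<beta> z v"
    have "?\<Delta> \<alpha> \<beta> = 0"
    proof (rule bitensorial_vanish[of B B ?\<Delta>, where p = "snd z" and q = "snd z",
          OF M2.smooth_manifold_axioms M2.smooth_manifold_axioms _ _ _ _ _ \<alpha> \<beta>])
      fix \<phi> \<psi> assume \<phi>: "\<phi> \<in> M2.smooth" and \<psi>: "\<psi> \<in> M2.smooth"
      let ?\<pi> = "tensor_pair P2 (M2.differential \<phi>) (M2.differential \<psi>)"
      have s: "?\<pi> \<in> M2.smooth" by (intro B2.bivector_smooth M2.form_differential \<phi> \<psi>)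
      have "tensor_pair P (vl (M2.differential \<phi>)) (vl (M2.differential \<psi>)) = (\<lambda>z. \<mu> (fst z) * ?\<pi> (snd z))"
        by (simp add: warped_vv M2.form_differential \<phi> \<psi> fun_eq_iff)
      then have "BM.koszul (vl (M2.differential \<phi>)) (vl (M2.differential \<psi>)) z v
          = \<mu> (fst z) * v (\<lambda>z. ?\<pi> (snd z)) + ?\<pi> (snd z) * v (\<lambda>z. \<mu> (fst z))"
        using M.tangent_mult[OF v smooth_functions_fst[OF \<mu>] smooth_functions_snd[OF s]]
        by (simp add: vl_differential \<phi> \<psi> BM.koszul_exact smooth_functions_snd M.differential_apply[OF v])
      then show "?\<Delta> (M2.differential \<phi>) (M2.differential \<psi>) = 0"
        by (simp add: plus_field_def scale_def B2.koszul_exact \<phi> \<psi> s vl_differential hl_differential \<mu>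
            M.differential_apply[OF v])
    next
      fix f \<alpha> \<beta> assume f: "f \<in> M2.smooth" and \<alpha>: "\<alpha> \<in> M2.forms" and \<beta>: "\<beta> \<in> M2.forms"
      \<comment> \<open>The anchor of a vertical lift carries the same factor \<mu> that stands
        before the lifted bracket, so the derivatives of f cancel in the difference.\<close>
      note r = BM.koszul_scale_left[OF smooth_functions_snd[OF f] vl_form[OF \<alpha>] vl_form[OF \<beta>]]
        BM.koszul_scale_right[OF smooth_functions_snd[OF f] vl_form[OF \<alpha>] vl_form[OF \<beta>]]
        B2.koszul_scale_left[OF f \<alpha> \<beta>] B2.koszul_scale_right[OF f \<alpha> \<beta>]
        sharp_v_snd[OF \<alpha> f] sharp_v_snd[OF \<beta> f] B2.tensor_pair_scale_left[OF \<alpha> \<beta>]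
      have t: "tensor_pair P2 \<alpha> (f \<odot> \<beta>) = (\<lambda>p. f p * tensor_pair P2 \<alpha> \<beta> p)"
        using B2.tensor_pair_antisym[OF \<alpha> M2.form_scale[OF f \<beta>]] B2.tensor_pair_scale_left[OF \<beta> \<alpha>]
          B2.tensor_pair_antisym[OF \<alpha> \<beta>] by simp
      show "?\<Delta> (f \<odot> \<alpha>) \<beta> = f (snd z) * ?\<Delta> \<alpha> \<beta>"
        unfolding vl_scale plus_field_def
        by (simp add: scale_def vl_apply[OF v] r[unfolded scale_def] algebra_simps)
      show "?\<Delta> \<alpha> (f \<odot> \<beta>) = f (snd z) * ?\<Delta> \<alpha> \<beta>"
        unfolding vl_scale plus_field_def t
        by (simp add: scale_def vl_apply[OF v] r[unfolded scale_def] algebra_simps)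
    next
      fix \<alpha> \<beta> \<gamma> assume \<alpha>: "\<alpha> \<in> M2.forms" and \<beta>: "\<beta> \<in> M2.forms" and \<gamma>: "\<gamma> \<in> M2.forms"
      note r = BM.koszul_plus_left[OF vl_form[OF \<alpha>] vl_form[OF \<beta>] vl_form[OF \<gamma>]]
        BM.koszul_plus_right[OF vl_form[OF \<alpha>] vl_form[OF \<beta>] vl_form[OF \<gamma>]]
        B2.koszul_plus_left[OF \<alpha> \<beta> \<gamma>] B2.koszul_plus_right[OF \<alpha> \<beta> \<gamma>] B2.tensor_pair_plus_left[OF \<alpha> \<beta> \<gamma>]
      have t: "tensor_pair P2 \<alpha> (\<beta> \<oplus> \<gamma>) = (\<lambda>p. tensor_pair P2 \<alpha> \<beta> p + tensor_pair P2 \<alpha> \<gamma> p)"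
        using B2.tensor_pair_antisym[OF \<alpha> M2.form_plus[OF \<beta> \<gamma>]] B2.tensor_pair_plus_left[OF \<beta> \<gamma> \<alpha>]
          B2.tensor_pair_antisym[OF \<alpha> \<beta>] B2.tensor_pair_antisym[OF \<alpha> \<gamma>] by simp
      show "?\<Delta> (\<alpha> \<oplus> \<beta>) \<gamma> = ?\<Delta> \<alpha> \<gamma> + ?\<Delta> \<beta> \<gamma>"
        unfolding vl_plus
        by (simp add: plus_field_def scale_def vl_apply[OF v] r[unfolded plus_field_def] algebra_simps)
      show "?\<Delta> \<alpha> (\<beta> \<oplus> \<gamma>) = ?\<Delta> \<alpha> \<beta> + ?\<Delta> \<alpha> \<gamma>"
        unfolding vl_plus t
        by (simp add: plus_field_def scale_def vl_apply[OF v] r[unfolded plus_field_def] algebra_simps)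
    qed
    then show "BM.koszul (vl \<alpha>) (vl \<beta>) z v = ?K \<alpha> \<beta> z v" by simp
  qed
qed

end

section \<open>The warped Levi-Civita connection\<close>

locale warped_levi_civita_manifold = warped_bivector_manifold A B P1 P2 P \<mu> +
    G1: metric_bivector_manifold A gt1 P1 + G2: metric_bivector_manifold B gt2 P2
  for A :: "('a::{t2_space,second_countable_topology}, 'e::euclidean_space) atlas"
    and B :: "('b::{t2_space,second_countable_topology}, 'f::euclidean_space) atlas"
    and P1 P2 P \<mu> gt1 gt2 +
  fixes f :: "'a \<Rightarrow> real" and g :: "('a \<times> 'b) cotensor"
    and D1 :: "'a connection" and D2 :: "'b connection" and D :: "('a \<times> 'b) connection"
  assumes f: "f \<in> M1.smooth" and f_pos: "\<And>p. f p > 0"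
    and warped_metric: "warped_metric A B f (cometric A gt1) (cometric B gt2) g"
    and levi_civita1: "levi_civita_connection A (cometric A gt1) P1 D1"
    and levi_civita2: "levi_civita_connection B (cometric B gt2) P2 D2"
    and levi_civita: "levi_civita_connection (prod_atlas A B) g P D"

sublocale warped_levi_civita_manifold \<subseteq> L1: levi_civita_manifold A P1 "cometric A gt1" D1
  by unfold_locales (auto intro: G1.cometric_bilinear G1.cometric_sym levi_civita1)

sublocale warped_levi_civita_manifold \<subseteq> L2: levi_civita_manifold B P2 "cometric B gt2" D2
  by unfold_locales (auto intro: G2.cometric_bilinear G2.cometric_sym levi_civita2)

sublocale warped_levi_civita_manifold \<subseteq> L: levi_civita_manifold "prod_atlas A B" P g D
  using warped_metric levi_civita
  by unfold_locales (auto simp: warped_metric_def contravariant_metric_def smooth_cotensor_def)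

context warped_levi_civita_manifold begin

abbreviation "Jdf \<equiv> G1.J (M1.differential f)"

lemma d\<mu>_form: "d\<mu> \<in> M1.forms"
  by (rule M1.form_differential[OF \<mu>])

lemma Jdf_form: "Jdf \<in> M1.forms"
  by (rule G1.endo_J_form[OF M1.form_differential[OF f]])

lemma pair_hh: "\<alpha> \<in> M1.forms \<Longrightarrow> \<beta> \<in> M1.forms \<Longrightarrow> L.pair (hl \<alpha>) (hl \<beta>) = (\<lambda>z. L1.pair \<alpha> \<beta> (fst z))"
  and pair_vv: "\<alpha>' \<in> M2.forms \<Longrightarrow> \<beta>' \<in> M2.forms \<Longrightarrow>
    L.pair (vl \<alpha>') (vl \<beta>') = (\<lambda>z. f (fst z) * L2.pair \<alpha>' \<beta>' (snd z))"
  and pair_hv: "\<alpha> \<in> M1.forms \<Longrightarrow> \<beta>' \<in> M2.forms \<Longrightarrow> L.pair (hl \<alpha>) (vl \<beta>') = (\<lambda>z. 0)"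
  using warped_metric unfolding warped_metric_def by (auto simp: fun_eq_iff)

lemma pair_vh: "\<alpha> \<in> M2.forms \<Longrightarrow> \<beta> \<in> M1.forms \<Longrightarrow> L.pair (vl \<alpha>) (hl \<beta>) = (\<lambda>z. 0)"
  using L.pair_sym[OF vl_form hl_form] by (auto simp: pair_hv)

lemma pair_smooth: "\<omega> \<in> M.forms \<Longrightarrow> \<eta> \<in> M.forms \<Longrightarrow> L.pair \<omega> \<eta> \<in> M.smooth"
  using warped_metric
  unfolding warped_metric_def contravariant_metric_def smooth_cotensor_def by blast

text \<open>Slicing the smooth metric of the product avoids inverting the matrix of the metric.\<close>

lemma pair1_smooth: "\<alpha> \<in> M1.forms \<Longrightarrow> \<beta> \<in> M1.forms \<Longrightarrow> L1.pair \<alpha> \<beta> \<in> M1.smooth"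
  using smooth_functions_slice_fst[OF pair_smooth[OF hl_form hl_form]] by (simp add: pair_hh)

lemma pair2_smooth: 
  assumes "\<alpha> \<in> M2.forms" "\<beta> \<in> M2.forms"
  shows "L2.pair \<alpha> \<beta> \<in> M2.smooth"
proof -
  have "(\<lambda>q. f p * L2.pair \<alpha> \<beta> q) \<in> M2.smooth" for p
    using smooth_functions_slice_snd[OF pair_smooth[OF vl_form vl_form]] assms by (simp add: pair_vv)
  \<comment> \<open>\<open>undefined\<close> serves as an arbitrary point of the first factor; on
    the slice over it f is a positive constant and can be divided out.\<close>
  from M2.smooth_functions_mult[OF M2.smooth_functions_const[of "1 / f undefined"] this[of undefined]]
  show ?thesis using f_pos[of undefined] by simp
qed

text \<open>The source of every J1 df: antisymmetry of P1 moves df to the left slot, where J turns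
  P1 into a metric pairing at the price of a sign.\<close>

lemma sharp_f: "\<alpha> \<in> M1.forms \<Longrightarrow> B1.sharp \<alpha> p f = - L1.pair Jdf \<alpha> p"
  using B1.tensor_pair_antisym[OF _ M1.form_differential[OF f], of \<alpha>]
  by (simp add: B1.anchor_apply f G1.endo_J_pairing M1.form_differential)

lemma koszul_vh: "\<alpha> \<in> M2.forms \<Longrightarrow> \<beta> \<in> M1.forms \<Longrightarrow> BM.koszul (vl \<alpha>) (hl \<beta>) = (\<lambda>z v. 0)"
  using BM.koszul_antisym[OF hl_form vl_form] by (simp add: koszul_hv fun_eq_iff)

lemma pair_zero_left: "\<omega> \<in> M.forms \<Longrightarrow> L.pair (\<lambda>z v. 0) \<omega> z = 0"
  using L.pair_diff[of \<omega> \<omega> \<omega>] by simp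

lemma pair_scale_left:
  "\<omega> \<in> M.forms \<Longrightarrow> \<eta> \<in> M.forms \<Longrightarrow> L.pair (F \<odot> \<omega>) \<eta> z = F z * L.pair \<omega> \<eta> z"
  using M.bilinear_lincomb_left[OF L.h_bilinear M.form_cotangent M.form_cotangent M.form_cotangent,
      of \<omega> \<omega> \<eta> z "F z" 0]
  by (simp add: tensor_pair_def scale_def)

lemma pair_plus_left:
  "\<omega> \<in> M.forms \<Longrightarrow> \<omega>' \<in> M.forms \<Longrightarrow> \<eta> \<in> M.forms \<Longrightarrow>
    L.pair (\<omega> \<oplus> \<omega>') \<eta> z = L.pair \<omega> \<eta> z + L.pair \<omega>' \<eta> z"
  using M.bilinear_lincomb_left[OF L.h_bilinear M.form_cotangent M.form_cotangent M.form_cotangent,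
      of \<omega> \<omega>' \<eta> z 1 1]
  by (simp add: tensor_pair_def plus_field_def)

lemma pair_koszul_vv:
  assumes \<alpha>: "\<alpha> \<in> M2.forms" and \<beta>: "\<beta> \<in> M2.forms" and \<omega>: "\<omega> \<in> M.forms"
  shows "L.pair (BM.koszul (vl \<alpha>) (vl \<beta>)) \<omega> z = \<mu> (fst z) * L.pair (vl (B2.koszul \<alpha> \<beta>)) \<omega> z
    + tensor_pair P2 \<alpha> \<beta> (snd z) * L.pair (hl d\<mu>) \<omega> z"
proof -
  note sm = smooth_functions_fst[OF \<mu>] smooth_functions_snd[OF B2.bivector_smooth[OF \<alpha> \<beta>]]
    hl_form[OF d\<mu>_form] vl_form[OF B2.koszul_form[OF \<alpha> \<beta>]]
  show ?thesis
    unfolding koszul_vv[OF \<alpha> \<beta>]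
    by (simp add: pair_plus_left pair_scale_left M.form_scale sm \<omega>)
qed

lemmas forms = hl_form vl_form B1.koszul_form B2.koszul_form d\<mu>_form Jdf_form
  L1.connection_form L2.connection_form L.connection_form G2.endo_J_form
lemmas pairs = pair_hh pair_vv pair_hv pair_vh pair_zero_left koszul_hh koszul_hv koszul_vh
  M.tangent_const[OF BM.anchor_tangent]

section \<open>The warped connection paired with lifts\<close>

lemma pair_D_hh_h:
  assumes \<alpha>: "\<alpha> \<in> M1.forms" and \<beta>: "\<beta> \<in> M1.forms" and \<gamma>: "\<gamma> \<in> M1.forms"
  shows "L.pair (D (hl \<alpha>) (hl \<beta>)) (hl \<gamma>) = (\<lambda>z. L1.pair (D1 \<alpha> \<beta>) \<gamma> (fst z))"
proof
  fix z
  show "L.pair (D (hl \<alpha>) (hl \<beta>)) (hl \<gamma>) z = L1.pair (D1 \<alpha> \<beta>) \<gamma> (fst z)"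
    using L.koszul_formula[OF hl_form[OF \<alpha>] hl_form[OF \<beta>] hl_form[OF \<gamma>], of z]
      L1.koszul_formula[OF \<alpha> \<beta> \<gamma>, of "fst z"]
    by (simp add: forms pairs \<alpha> \<beta> \<gamma> sharp_h_fst pair1_smooth)
qed

lemma pair_D_hh_v:
  assumes \<alpha>: "\<alpha> \<in> M1.forms" and \<beta>: "\<beta> \<in> M1.forms" and \<gamma>: "\<gamma> \<in> M2.forms"
  shows "L.pair (D (hl \<alpha>) (hl \<beta>)) (vl \<gamma>) = (\<lambda>z. 0)"
proof
  fix z
  show "L.pair (D (hl \<alpha>) (hl \<beta>)) (vl \<gamma>) z = 0"
    using L.koszul_formula[OF hl_form[OF \<alpha>] hl_form[OF \<beta>] vl_form[OF \<gamma>], of z]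
    by (simp add: forms pairs \<alpha> \<beta> \<gamma> sharp_v_fst pair1_smooth)
qed

text \<open>Two terms of the Koszul formula survive: the derivative of f g2(\<alpha>, \<beta>) along
  the horizontal form, and the d\<mu>-part of the bracket of the two vertical forms.\<close>

lemma pair_D_vv_h:
  assumes \<alpha>: "\<alpha> \<in> M2.forms" and \<beta>: "\<beta> \<in> M2.forms" and \<gamma>: "\<gamma> \<in> M1.forms"
  shows "L.pair (D (vl \<alpha>) (vl \<beta>)) (hl \<gamma>) = (\<lambda>z.
    (L1.pair Jdf \<gamma> (fst z) * L2.pair \<alpha> \<beta> (snd z) + tensor_pair P2 \<alpha> \<beta> (snd z) * L1.pair d\<mu> \<gamma> (fst z)) / 2)"
proof
  fix z
  show "L.pair (D (vl \<alpha>) (vl \<beta>)) (hl \<gamma>) z =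
    (L1.pair Jdf \<gamma> (fst z) * L2.pair \<alpha> \<beta> (snd z) + tensor_pair P2 \<alpha> \<beta> (snd z) * L1.pair d\<mu> \<gamma> (fst z)) / 2"
    using L.koszul_formula[OF vl_form[OF \<alpha>] vl_form[OF \<beta>] hl_form[OF \<gamma>], of z]
    by (simp add: forms pairs \<alpha> \<beta> \<gamma> sharp_h_prod[OF \<gamma> f pair2_smooth[OF \<alpha> \<beta>]] pair_koszul_vv sharp_f
        mult.commute)
qed

text \<open>Vertical anchors do not differentiate functions of the first factor and carry \<mu>,
  while the metric carries f. Each term is thus \<mu> f times its counterpart on the second
  factor.\<close>

lemma pair_D_vv_v:
  assumes \<alpha>: "\<alpha> \<in> M2.forms" and \<beta>: "\<beta> \<in> M2.forms" and \<gamma>: "\<gamma> \<in> M2.forms"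
  shows "L.pair (D (vl \<alpha>) (vl \<beta>)) (vl \<gamma>) = (\<lambda>z.
    (\<mu> (fst z) * f (fst z)) * L2.pair (D2 \<alpha> \<beta>) \<gamma> (snd z))"
proof
  fix z
  have "2 * L.pair (D (vl \<alpha>) (vl \<beta>)) (vl \<gamma>) z
      = (\<mu> (fst z) * f (fst z)) * (2 * L2.pair (D2 \<alpha> \<beta>) \<gamma> (snd z))"
    unfolding L.koszul_formula[OF vl_form[OF \<alpha>] vl_form[OF \<beta>] vl_form[OF \<gamma>], of z]
      L2.koszul_formula[OF \<alpha> \<beta> \<gamma>, of "snd z"]
    by (simp add: forms pairs \<alpha> \<beta> \<gamma> sharp_v_prod f pair2_smooth pair_koszul_vv algebra_simps)
  then show "L.pair (D (vl \<alpha>) (vl \<beta>)) (vl \<gamma>) z = (\<mu> (fst z) * f (fst z)) * L2.pair (D2 \<alpha> \<beta>) \<gamma> (snd z)"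
    by simp
qed

lemma pair_D_hv_h:
  assumes \<alpha>: "\<alpha> \<in> M1.forms" and \<beta>: "\<beta> \<in> M2.forms" and \<gamma>: "\<gamma> \<in> M1.forms"
  shows "L.pair (D (hl \<alpha>) (vl \<beta>)) (hl \<gamma>) = (\<lambda>z. 0)"
proof
  fix z
  show "L.pair (D (hl \<alpha>) (vl \<beta>)) (hl \<gamma>) z = 0"
    using L.koszul_formula[OF hl_form[OF \<alpha>] vl_form[OF \<beta>] hl_form[OF \<gamma>], of z]
    by (simp add: forms pairs \<alpha> \<beta> \<gamma> sharp_v_fst pair1_smooth)
qed

text \<open>The same two terms as for two vertical arguments survive, with opposite signs since the
  horizontal form has changed its place in the Koszul formula.\<close>

lemma pair_D_hv_v:
  assumes \<alpha>: "\<alpha> \<in> M1.forms" and \<beta>: "\<beta> \<in> M2.forms" and \<gamma>: "\<gamma> \<in> M2.forms"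
  shows "L.pair (D (hl \<alpha>) (vl \<beta>)) (vl \<gamma>) = (\<lambda>z.
    - (L1.pair Jdf \<alpha> (fst z) * L2.pair \<beta> \<gamma> (snd z) + tensor_pair P2 \<beta> \<gamma> (snd z) * L1.pair d\<mu> \<alpha> (fst
        z)) / 2)"
proof
  fix z
  show "L.pair (D (hl \<alpha>) (vl \<beta>)) (vl \<gamma>) z =
    - (L1.pair Jdf \<alpha> (fst z) * L2.pair \<beta> \<gamma> (snd z) + tensor_pair P2 \<beta> \<gamma> (snd z) * L1.pair d\<mu> \<alpha> (fst z)) / 2"
    using L.koszul_formula[OF hl_form[OF \<alpha>] vl_form[OF \<beta>] vl_form[OF \<gamma>], of z]
    by (simp add: forms pairs \<alpha> \<beta> \<gamma> sharp_h_prod[OF \<alpha> f pair2_smooth[OF \<beta> \<gamma>]] pair_koszul_vv sharp_f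
        mult.commute)
qed

text \<open>Absence of torsion together with the vanishing mixed bracket.\<close>

lemma D_vh:
  assumes \<alpha>: "\<alpha> \<in> M1.forms" and \<beta>: "\<beta> \<in> M2.forms"
  shows "D (vl \<beta>) (hl \<alpha>) = D (hl \<alpha>) (vl \<beta>)"
proof -
  have "(\<lambda>z v. D (hl \<alpha>) (vl \<beta>) z v - D (vl \<beta>) (hl \<alpha>) z v) = BM.koszul (hl \<alpha>) (vl \<beta>)"
    using levi_civita hl_form[OF \<alpha>] vl_form[OF \<beta>] unfolding levi_civita_connection_def by blast
  then show ?thesis unfolding koszul_hv[OF \<alpha> \<beta>] by (simp add: fun_eq_iff)
qed

section \<open>The warped connection paired with arbitrary 1-forms\<close>

lemma pair_eq_on_lifts:
  assumes "\<omega> \<in> M.forms" "\<omega>' \<in> M.forms" "\<eta> \<in> M.forms"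
    and "\<And>\<gamma>. \<gamma> \<in> M1.forms \<Longrightarrow> L.pair \<omega> (hl \<gamma>) z = L.pair \<omega>' (hl \<gamma>) z"
    and "\<And>\<gamma>. \<gamma> \<in> M2.forms \<Longrightarrow> L.pair \<omega> (vl \<gamma>) z = L.pair \<omega>' (vl \<gamma>) z"
  shows "L.pair \<omega> \<eta> z = L.pair \<omega>' \<eta> z"
  using bilinear_eq_on_lifts[of "fst z" "snd z" "g z" "\<omega> z" "\<omega>' z" "\<eta> z"] assms
  by (simp add: tensor_pair_def M.form_cotangent L.h_bilinear)

lemma pair_D_hh:
  assumes \<alpha>: "\<alpha> \<in> M1.forms" and \<beta>: "\<beta> \<in> M1.forms" and \<eta>: "\<eta> \<in> M.forms"
  shows "L.pair (D (hl \<alpha>) (hl \<beta>)) \<eta> z = L.pair (hl (D1 \<alpha> \<beta>)) \<eta> z"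
  by (rule pair_eq_on_lifts)
    (simp_all add: forms \<alpha> \<beta> \<eta> pair_D_hh_h pair_D_hh_v pair_hh pair_hv)

text \<open>Allows the other factor of a pairing to be itself a covariant derivative, as the
  curvature formula demands.\<close>

lemma pair_D_vv:
  assumes \<alpha>: "\<alpha> \<in> M2.forms" and \<beta>: "\<beta> \<in> M2.forms" and \<eta>: "\<eta> \<in> M.forms"
  shows "L.pair (D (vl \<alpha>) (vl \<beta>)) \<eta> z = L2.pair \<alpha> \<beta> (snd z) / 2 * L.pair (hl Jdf) \<eta> z
    + tensor_pair P2 \<alpha> \<beta> (snd z) / 2 * L.pair (hl d\<mu>) \<eta> z + \<mu> (fst z) * L.pair (vl (D2 \<alpha> \<beta>)) \<eta> z"
proof -
  \<comment> \<open>The coefficients are frozen at the fixed point z: pairings are pointwise, so a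
    form that is right at z is enough, and constant coefficients are trivially smooth. The bound
    variable in the line below does not capture this z.\<close>
  let ?a = "L2.pair \<alpha> \<beta> (snd z) / 2" and ?b = "tensor_pair P2 \<alpha> \<beta> (snd z) / 2"
  let ?\<omega> = "((\<lambda>z. ?a) \<odot> hl Jdf) \<oplus> (((\<lambda>z. ?b) \<odot> hl d\<mu>) \<oplus> ((\<lambda>x. \<mu> (fst z)) \<odot> vl (D2 \<alpha> \<beta>)))"
  have \<omega>: "?\<omega> \<in> M.forms"
    by (intro M.form_plus M.form_scale M.smooth_functions_const forms \<alpha> \<beta>)
  have expand: "L.pair ?\<omega> \<eta> z = ?a * L.pair (hl Jdf) \<eta> z + ?b * L.pair (hl d\<mu>) \<eta> z
      + \<mu> (fst z) * L.pair (vl (D2 \<alpha> \<beta>)) \<eta> z" if "\<eta> \<in> M.forms" for \<eta>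
    by (simp add: pair_plus_left pair_scale_left M.form_plus M.form_scale M.smooth_functions_const
        forms \<alpha> \<beta> that)
  have "L.pair (D (vl \<alpha>) (vl \<beta>)) \<eta> z = L.pair ?\<omega> \<eta> z"
    by (rule pair_eq_on_lifts)
      (simp_all only: expand forms \<alpha> \<beta> \<eta> \<omega>, simp_all add: pair_D_vv_h pair_D_vv_v pairs forms \<alpha> \<beta>
          algebra_simps add_divide_distrib)
  then show ?thesis unfolding expand[OF \<eta>] .
qed

text \<open>J2 enters because P2(\<beta>, \<gamma>) = g2(J2 \<beta>, \<gamma>). A pairing of
  vertical lifts contains a factor f that P2 lacks, whence the division by f; it is cleared in the
  statement.\<close>

lemma pair_D_hv:
  assumes \<alpha>: "\<alpha> \<in> M1.forms" and \<beta>: "\<beta> \<in> M2.forms" and \<eta>: "\<eta> \<in> M.forms"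
  shows "2 * f (fst z) * L.pair (D (hl \<alpha>) (vl \<beta>)) \<eta> z =
    - L1.pair Jdf \<alpha> (fst z) * L.pair (vl \<beta>) \<eta> z - L1.pair d\<mu> \<alpha> (fst z) * L.pair (vl (G2.J \<beta>)) \<eta> z"
proof -
  have fz: "f (fst z) > 0" by (rule f_pos)
  let ?a = "- L1.pair Jdf \<alpha> (fst z) / (2 * f (fst z))" and ?b = "- L1.pair d\<mu> \<alpha> (fst z) / (2 * f (fst z))"
  let ?\<omega> = "((\<lambda>z. ?a) \<odot> vl \<beta>) \<oplus> ((\<lambda>z. ?b) \<odot> vl (G2.J \<beta>))"
  have \<omega>: "?\<omega> \<in> M.forms"
    by (intro M.form_plus M.form_scale M.smooth_functions_const forms \<alpha> \<beta>)
  have expand: "L.pair ?\<omega> \<eta> z = ?a * L.pair (vl \<beta>) \<eta> z + ?b * L.pair (vl (G2.J \<beta>)) \<eta> z"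
    if "\<eta> \<in> M.forms" for \<eta>
    by (simp add: pair_plus_left pair_scale_left M.form_scale M.smooth_functions_const forms \<alpha> \<beta> that)
  have "L.pair (D (hl \<alpha>) (vl \<beta>)) \<eta> z = L.pair ?\<omega> \<eta> z"
    by (rule pair_eq_on_lifts)
      (simp_all only: expand forms \<alpha> \<beta> \<eta> \<omega>,
       use fz in \<open>simp_all add: pair_D_hv_h pair_D_hv_v pairs forms \<alpha> \<beta> G2.endo_J_pairing field_simps\<close>)
  then show ?thesis unfolding expand[OF \<eta>] using fz by (simp add: field_simps)
qed

section \<open>The warped curvature\<close>

lemma curvature_hh:
  assumes \<alpha>: "\<alpha> \<in> M1.forms" and \<beta>: "\<beta> \<in> M1.forms"
  shows "L.pair (contra_curvature (prod_atlas A B) P D (hl \<alpha>) (hl \<beta>) (hl \<beta>)) (hl \<alpha>) (p, q)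
    = L1.pair (contra_curvature A P1 D1 \<alpha> \<beta> \<beta>) \<alpha> p"
proof -
  \<comment> \<open>\<open>pair_D_hh\<close> replaces the left derivative by a lift; symmetry then
    moves the right one into the left slot, where its pairing with that lift is known.\<close>
  have DD: "L.pair (D (hl \<alpha>') (hl \<beta>)) (D (hl \<gamma>) (hl \<alpha>)) z = L1.pair (D1 \<alpha>' \<beta>) (D1 \<gamma> \<alpha>) (fst z)"
    if \<alpha>': "\<alpha>' \<in> M1.forms" and \<gamma>: "\<gamma> \<in> M1.forms" for \<alpha>' \<gamma> z
  proof -
    note f1 = L1.connection_form[OF \<alpha>' \<beta>] and f2 = L1.connection_form[OF \<gamma> \<alpha>]
      and f3 = L.connection_form[OF hl_form[OF \<gamma>] hl_form[OF \<alpha>]]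
    show ?thesis
      unfolding pair_D_hh[OF \<alpha>' \<beta> f3] L.pair_sym[OF hl_form[OF f1] f3]
        pair_D_hh_h[OF \<gamma> \<alpha> f1] L1.pair_sym[OF f1 f2] ..
  qed
  show ?thesis
    unfolding L.curvature_pairing[OF hl_form[OF \<alpha>] hl_form[OF \<beta>] hl_form[OF \<beta>] hl_form[OF \<alpha>]]
      L1.curvature_pairing[OF \<alpha> \<beta> \<beta> \<alpha>]
    by (simp add: \<alpha> \<beta> forms DD pair_D_hh_h koszul_hh sharp_h_fst pair1_smooth)
qed

lemma connection_zero_left:
  assumes "\<beta> \<in> M.forms"
  shows "D (\<lambda>z v. 0) \<beta> = (\<lambda>z v. 0)"
  using L.connection_scale_left[OF M.smooth_functions_const[of 0] M.form_zero assms] by (simp add: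
      scale_def)

text \<open>Only the pairings of D_b b with a and with D_a a and of D_a b with D_b a contribute, the
  mixed bracket being zero. P2(\<beta>, \<beta>) = 0 removes d\<mu> from D_b b in these pairings,
  and g2(\<beta>, J2 \<beta>) = 0 removes the cross terms of J1 df and d\<mu>.\<close>

lemma curvature_hv:
  assumes \<alpha>: "\<alpha> \<in> M1.forms" and \<beta>: "\<beta> \<in> M2.forms"
  shows "L.pair (contra_curvature (prod_atlas A B) P D (hl \<alpha>) (vl \<beta>) (vl \<beta>)) (hl \<alpha>) (p, q)
    = L2.pair \<beta> \<beta> q * L1.pair (D1 \<alpha> Jdf) \<alpha> p / 2
      + (L1.pair Jdf \<alpha> p)\<^sup>2 * L2.pair \<beta> \<beta> q / (4 * f p)
      + (L1.pair d\<mu> \<alpha> p)\<^sup>2 * L2.pair (G2.J \<beta>) (G2.J \<beta>) q / (4 * f p)"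
proof -
  let ?a = "hl \<alpha>" and ?b = "vl \<beta>" and ?z = "(p, q)"
  note a = hl_form[OF \<alpha>] and b = vl_form[OF \<beta>]
  have fp: "f p > 0" by (rule f_pos)
  have P_bb: "tensor_pair P2 \<beta> \<beta> r = 0" for r
    using fun_cong[OF B2.tensor_pair_antisym[OF \<beta> \<beta>], of r] by simp
  have P_bJ: "tensor_pair P2 \<beta> (G2.J \<beta>) r = L2.pair (G2.J \<beta>) (G2.J \<beta>) r" for r
    using G2.endo_J_pairing[OF \<beta> G2.endo_J_form[OF \<beta>]] by simp
  have g_bJ: "L2.pair \<beta> (G2.J \<beta>) r = 0" for r
    using L2.pair_sym[OF \<beta> G2.endo_J_form[OF \<beta>], of r] G2.endo_J_pairing[OF \<beta> \<beta>, of r] by (simp add: P_bb)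
  have s: "(\<lambda>p. L1.pair Jdf \<alpha> p) \<in> M1.smooth" by (rule pair1_smooth[OF Jdf_form \<alpha>])
  have 1: "BM.sharp ?a ?z (L.pair (D ?b ?b) ?a) = L2.pair \<beta> \<beta> q / 2 * B1.sharp \<alpha> p (L1.pair Jdf \<alpha>)"
  proof -
    have "L.pair (D ?b ?b) ?a = (\<lambda>z. L1.pair Jdf \<alpha> (fst z) * ((1/2) * L2.pair \<beta> \<beta> (snd z)))"
      by (simp add: pair_D_vv_h \<alpha> \<beta> P_bb)
    then show ?thesis
      using sharp_h_prod[OF \<alpha> s M2.smooth_functions_mult[OF M2.smooth_functions_const
          pair2_smooth[OF \<beta> \<beta>]], of ?z "1/2"]
      by simp
  qed
  have 2: "L.pair (D ?b ?b) (D ?a ?a) ?z = L2.pair \<beta> \<beta> q / 2 * L1.pair Jdf (D1 \<alpha> \<alpha>) p"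
  proof -
    note Daa = L.connection_form[OF a a]
    have "L.pair (vl (D2 \<beta> \<beta>)) (D ?a ?a) ?z = 0"
      using L.pair_sym[OF vl_form[OF L2.connection_form[OF \<beta> \<beta>]] Daa, of ?z]
      by (simp add: pair_D_hh_v \<alpha> \<beta> forms)
    moreover have "L.pair (hl Jdf) (D ?a ?a) ?z = L1.pair Jdf (D1 \<alpha> \<alpha>) p"
      using L.pair_sym[OF hl_form[OF Jdf_form] Daa, of ?z] L1.pair_sym[OF Jdf_form
          L1.connection_form[OF \<alpha> \<alpha>], of p]
      by (simp add: pair_D_hh_h \<alpha> forms)
    ultimately show ?thesis by (simp add: pair_D_vv[OF \<beta> \<beta> Daa] P_bb)
  qed
  have 3: "BM.sharp ?b ?z (L.pair (D ?a ?b) ?a) = 0"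
    by (simp add: pair_D_hv_h \<alpha> \<beta> b M.tangent_const[OF BM.anchor_tangent[OF b]])
  \<comment> \<open>As D_b a = D_a b, this is the square of one form under the warped metric; hence
    the two squares and the coefficient 1/(4 f).\<close>
  have 4: "2 * f p * L.pair (D ?a ?b) (D ?b ?a) ?z
      = (L1.pair Jdf \<alpha> p)\<^sup>2 * L2.pair \<beta> \<beta> q / 2 + (L1.pair d\<mu> \<alpha> p)\<^sup>2 * L2.pair (G2.J \<beta>) (G2.J \<beta>) q / 2"
  proof -
    note Dab = L.connection_form[OF a b]
    have vD: "L.pair (vl \<gamma>) (D ?a ?b) ?z
        = - (L1.pair Jdf \<alpha> p * L2.pair \<beta> \<gamma> q + tensor_pair P2 \<beta> \<gamma> q * L1.pair d\<mu> \<alpha> p) / 2"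
      if "\<gamma> \<in> M2.forms" for \<gamma>
      using L.pair_sym[OF vl_form[OF that] Dab, of ?z] by (simp add: pair_D_hv_v \<alpha> \<beta> that)
    show ?thesis
      unfolding D_vh[OF \<alpha> \<beta>] pair_D_hv[OF \<alpha> \<beta> Dab, of ?z, simplified] vD[OF \<beta>]
        vD[OF G2.endo_J_form[OF \<beta>]] P_bb P_bJ g_bJ
      by (simp add: power2_eq_square field_simps)
  qed
  \<comment> \<open>Compatibility of D1 merges the derivative of g1(J1 df, \<alpha>) and its
    correction by D1 \<alpha> \<alpha> into the derivative of J1 df itself.\<close>
  have 5: "B1.sharp \<alpha> p (L1.pair Jdf \<alpha>) - L1.pair Jdf (D1 \<alpha> \<alpha>) p = L1.pair (D1 \<alpha> Jdf) \<alpha> p"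
    using L1.connection_compatible[OF \<alpha> Jdf_form \<alpha>, of p] by simp
  have 6: "L.pair (D (BM.koszul ?a ?b) ?b) ?a ?z = 0"
    by (simp add: koszul_hv \<alpha> \<beta> connection_zero_left b pair_zero_left a)
  have "L.pair (contra_curvature (prod_atlas A B) P D ?a ?b ?b) ?a ?z
      = L2.pair \<beta> \<beta> q / 2 * L1.pair (D1 \<alpha> Jdf) \<alpha> p + L.pair (D ?a ?b) (D ?b ?a) ?z"
    unfolding L.curvature_pairing[OF a b b a] 1 2 3 6 5[symmetric] by (simp add: algebra_simps)
  moreover have "L.pair (D ?a ?b) (D ?b ?a) ?z = (L1.pair Jdf \<alpha> p)\<^sup>2 * L2.pair \<beta> \<beta> q / (4 * f p)
      + (L1.pair d\<mu> \<alpha> p)\<^sup>2 * L2.pair (G2.J \<beta>) (G2.J \<beta>) q / (4 * f p)"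
    using 4 fp by (simp add: field_simps)
  ultimately show ?thesis by simp
qed

text \<open>The coefficient 3/4 is 1/4 + 1/2: pairing D_a b with D_b a gives - 1/4 P2(\<alpha>,
  \<beta>)^2 |d\<mu>|^2, the horizontal part of the bracket gives - 1/2 of the same. The terms with
  |J1 df|^2 from the two pairings of derivatives form the Gram determinant. Everything else is
  \<mu>^2 f times the curvature of the second factor.\<close>

lemma curvature_vv:
  assumes \<alpha>: "\<alpha> \<in> M2.forms" and \<beta>: "\<beta> \<in> M2.forms"
  shows "L.pair (contra_curvature (prod_atlas A B) P D (vl \<alpha>) (vl \<beta>) (vl \<beta>)) (vl \<alpha>) (p, q)
    = (\<mu> p)\<^sup>2 * f p * L2.pair (contra_curvature B P2 D2 \<alpha> \<beta> \<beta>) \<alpha> q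
      - L1.pair Jdf Jdf p / 4 * gram (cometric B gt2) \<alpha> \<beta> q
      - 3 / 4 * (tensor_pair P2 \<alpha> \<beta> q)\<^sup>2 * L1.pair d\<mu> d\<mu> p
      + tensor_pair P2 \<alpha> \<beta> q * L2.pair \<alpha> \<beta> q * L1.pair d\<mu> Jdf p / 2"
proof -
  let ?a = "vl \<alpha>" and ?b = "vl \<beta>" and ?z = "(p, q)"
  note a = vl_form[OF \<alpha>] and b = vl_form[OF \<beta>]
  let ?G = "\<lambda>\<gamma> \<delta>. L2.pair \<gamma> \<delta> q" and ?P = "\<lambda>\<gamma> \<delta>. tensor_pair P2 \<gamma> \<delta> q"
  let ?m = "L1.pair d\<mu> d\<mu> p" and ?j = "L1.pair Jdf Jdf p" and ?x = "L1.pair d\<mu> Jdf p"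
  have jm: "L1.pair Jdf d\<mu> p = ?x" by (rule L1.pair_sym[OF Jdf_form d\<mu>_form])
  have P_refl: "?P \<gamma> \<gamma> = 0" if "\<gamma> \<in> M2.forms" for \<gamma>
    using fun_cong[OF B2.tensor_pair_antisym[OF that that], of q] by simp
  have P_ba: "?P \<beta> \<alpha> = - ?P \<alpha> \<beta>"
    using fun_cong[OF B2.tensor_pair_antisym[OF \<beta> \<alpha>], of q] .
  have G_ba: "?G \<beta> \<alpha> = ?G \<alpha> \<beta>" by (rule L2.pair_sym[OF \<beta> \<alpha>])
  have sharp: "BM.sharp (vl \<gamma>) ?z (L.pair (D (vl \<delta>) ?b) ?a) = \<mu> p * f p * \<mu> p * B2.sharp \<gamma> q
      (L2.pair (D2 \<delta> \<beta>) \<alpha>)"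
    if \<gamma>: "\<gamma> \<in> M2.forms" and \<delta>: "\<delta> \<in> M2.forms" for \<gamma> \<delta>
    unfolding pair_D_vv_v[OF \<delta> \<beta> \<alpha>]
    using sharp_v_prod[OF \<gamma> M1.smooth_functions_mult[OF \<mu> f] pair2_smooth[OF L2.connection_form[OF \<delta>
        \<beta>] \<alpha>], of ?z]
    by simp
  \<comment> \<open>Stated for general first arguments to cover both pairings. For D_a b with D_b a
    the two terms in g1(d\<mu>, J1 df) cancel by antisymmetry of P2; for D_b b with D_a a they
    vanish.\<close>
  have DD: "L.pair (D (vl \<gamma>) ?b) (D (vl \<delta>) ?a) ?z =
      ?G \<gamma> \<beta> / 2 * ((?j * ?G \<delta> \<alpha> + ?P \<delta> \<alpha> * ?x) / 2) + ?P \<gamma> \<beta> / 2 * ((?x * ?G \<delta> \<alpha> + ?P \<delta> \<alpha> * ?m) / 2)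
      + (\<mu> p)\<^sup>2 * f p * ?G (D2 \<gamma> \<beta>) (D2 \<delta> \<alpha>)"
    if \<gamma>: "\<gamma> \<in> M2.forms" and \<delta>: "\<delta> \<in> M2.forms" for \<gamma> \<delta>
  proof -
    note Dd = L.connection_form[OF vl_form[OF \<delta>] a] and D2g = L2.connection_form[OF \<gamma> \<beta>]
    note sym = L.pair_sym[OF hl_form[OF Jdf_form] Dd, of ?z] L.pair_sym[OF hl_form[OF d\<mu>_form] Dd, of ?z]
      L.pair_sym[OF vl_form[OF D2g] Dd, of ?z]
    show ?thesis
      unfolding pair_D_vv[OF \<gamma> \<beta> Dd] sym
      by (simp add: pair_D_vv_h pair_D_vv_v \<delta> \<alpha> Jdf_form d\<mu>_form D2g jm L1.pair_sym[OF Jdf_form d\<mu>_form]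
          L2.pair_sym[OF D2g L2.connection_form[OF \<delta> \<alpha>]] power2_eq_square)
  qed
  \<comment> \<open>The derivative along d\<mu>^h brings in \<open>pair_D_hv_v\<close> with d\<mu>
    as horizontal form: it yields |d\<mu>|^2 and the whole term in g1(d\<mu>, J1 df).\<close>
  have kos: "L.pair (D (BM.koszul ?a ?b) ?b) ?a ?z = (\<mu> p)\<^sup>2 * f p * ?G (D2 (B2.koszul \<alpha> \<beta>) \<beta>) \<alpha>
      - ?P \<alpha> \<beta> * (?x * ?G \<alpha> \<beta> - ?P \<alpha> \<beta> * ?m) / 2"
  proof -
    note k2 = B2.koszul_form[OF \<alpha> \<beta>]
    note sm = smooth_functions_fst[OF \<mu>] smooth_functions_snd[OF B2.bivector_smooth[OF \<alpha> \<beta>]]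
      hl_form[OF d\<mu>_form] vl_form[OF k2]
    have "D (BM.koszul ?a ?b) ?b = ((\<lambda>z. \<mu> (fst z)) \<odot> D (vl (B2.koszul \<alpha> \<beta>)) ?b)
        \<oplus> ((\<lambda>z. tensor_pair P2 \<alpha> \<beta> (snd z)) \<odot> D (hl d\<mu>) ?b)"
      unfolding koszul_vv[OF \<alpha> \<beta>]
      by (simp add: L.connection_plus_left L.connection_scale_left M.form_scale sm b)
    then have "L.pair (D (BM.koszul ?a ?b) ?b) ?a ?z
        = \<mu> p * L.pair (D (vl (B2.koszul \<alpha> \<beta>)) ?b) ?a ?z + ?P \<alpha> \<beta> * L.pair (D (hl d\<mu>) ?b) ?a ?z"
      by (simp add: pair_plus_left pair_scale_left M.form_scale sm b a L.connection_form)
    then show ?thesis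
      by (simp add: pair_D_vv_v[OF k2 \<beta> \<alpha>] pair_D_hv_v[OF d\<mu>_form \<beta> \<alpha>] G_ba P_ba jm power2_eq_square
          field_simps)
  qed
  show ?thesis
    unfolding L.curvature_pairing[OF a b b a] L2.curvature_pairing[OF \<alpha> \<beta> \<beta> \<alpha>]
      sharp[OF \<alpha> \<beta>] sharp[OF \<beta> \<alpha>] DD[OF \<beta> \<alpha>] DD[OF \<alpha> \<beta>] kos
      P_refl[OF \<alpha>] P_refl[OF \<beta>] P_ba G_ba gram_def
    by (simp add: field_simps power2_eq_square)
qed

section \<open>Gram determinants and sectional curvatures\<close>

text \<open>The factor f^2 turns the \<mu>^2 f of the vertical curvature into \<mu>^2 / f and puts
  f^2 below the remaining terms.\<close>

lemma gram_vv:
  "\<alpha> \<in> M2.forms \<Longrightarrow> \<beta> \<in> M2.forms \<Longrightarrow> gram g (vl \<alpha>) (vl \<beta>) (p, q) = (f p)\<^sup>2 * gram (cometric B gt2) \<alpha> \<beta> q"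
  by (simp add: gram_def pair_vv power2_eq_square algebra_simps)

lemma gram_hh:
  "\<alpha> \<in> M1.forms \<Longrightarrow> \<beta> \<in> M1.forms \<Longrightarrow> gram g (hl \<alpha>) (hl \<beta>) (p, q) = gram (cometric A gt1) \<alpha> \<beta> p"
  by (simp add: gram_def pair_hh)

lemma gram_hv:
  "\<alpha> \<in> M1.forms \<Longrightarrow> \<beta> \<in> M2.forms \<Longrightarrow>
    gram g (hl \<alpha>) (vl \<beta>) (p, q) = L1.pair \<alpha> \<alpha> p * (f p * L2.pair \<beta> \<beta> q)"
  by (simp add: gram_def pair_hh pair_vv pair_hv)

lemma sectional_curvature_hh:
  assumes "\<alpha> \<in> M1.forms" "\<beta> \<in> M1.forms"
  shows "sectional_curvature (prod_atlas A B) g P D (hl \<alpha>) (hl \<beta>) (p, q)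
    = sectional_curvature A (cometric A gt1) P1 D1 \<alpha> \<beta> p"
  by (simp add: sectional_curvature_def curvature_hh gram_hh assms)

text \<open>The Gram determinant factors because horizontal and vertical lifts are orthogonal. Its
  being nonzero makes each squared norm nonzero, which justifies the separate quotients.\<close>

lemma sectional_curvature_hv:
  assumes \<alpha>: "\<alpha> \<in> M1.forms" and \<beta>: "\<beta> \<in> M2.forms"
    and nz: "gram g (hl \<alpha>) (vl \<beta>) (p, q) \<noteq> 0"
  shows "sectional_curvature (prod_atlas A B) g P D (hl \<alpha>) (vl \<beta>) (p, q) =
    (L1.pair d\<mu> \<alpha> p)\<^sup>2 / (4 * (f p)\<^sup>2 * L1.pair \<alpha> \<alpha> p)
      * (L2.pair (G2.J \<beta>) (G2.J \<beta>) q / L2.pair \<beta> \<beta> q)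
    + ((L1.pair Jdf \<alpha> p)\<^sup>2 / (4 * (f p)\<^sup>2 * L1.pair \<alpha> \<alpha> p)
       + L1.pair (D1 \<alpha> Jdf) \<alpha> p / (2 * f p * L1.pair \<alpha> \<alpha> p))"
  using nz unfolding sectional_curvature_def curvature_hv[OF \<alpha> \<beta>] gram_hv[OF \<alpha> \<beta>]
  by (simp add: field_simps power2_eq_square)

lemma sectional_curvature_vv:
  assumes \<alpha>: "\<alpha> \<in> M2.forms" and \<beta>: "\<beta> \<in> M2.forms"
    and nz: "gram (cometric B gt2) \<alpha> \<beta> q \<noteq> 0"
  shows "sectional_curvature (prod_atlas A B) g P D (vl \<alpha>) (vl \<beta>) (p, q) =
    (\<mu> p)\<^sup>2 / f p * sectional_curvature B (cometric B gt2) P2 D2 \<alpha> \<beta> q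
    - L1.pair d\<mu> d\<mu> p / (4 * (f p)\<^sup>2) * (3 * (tensor_pair P2 \<alpha> \<beta> q)\<^sup>2 / gram (cometric B gt2) \<alpha> \<beta> q)
    - L1.pair Jdf Jdf p / (4 * (f p)\<^sup>2)
    + L1.pair d\<mu> Jdf p / (2 * (f p)\<^sup>2)
      * (tensor_pair P2 \<alpha> \<beta> q * L2.pair \<alpha> \<beta> q / gram (cometric B gt2) \<alpha> \<beta> q)"
  using nz f_pos[of p] unfolding sectional_curvature_def curvature_vv[OF \<alpha> \<beta>] gram_vv[OF \<alpha> \<beta>]
  by (simp add: field_simps power2_eq_square)

end

theorem corollary5:
  fixes A1 :: "('a::{t2_space,second_countable_topology}, 'e::euclidean_space) atlas"
    and A2 :: "('b::{t2_space,second_countable_topology}, 'f::euclidean_space) atlas"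
    and gt1 :: "'a metric" and gt2 :: "'b metric"
    and g1 P1 :: "'a cotensor" and g2 P2 :: "'b cotensor"
    and g P :: "('a \<times> 'b) cotensor"
    and f \<mu> :: "'a \<Rightarrow> real"
    and D1 :: "'a connection" and D2 :: "'b connection" and D :: "('a \<times> 'b) connection"
    and \<alpha>1 \<beta>1 :: "'a \<Rightarrow> 'a covec" and \<alpha>2 \<beta>2 :: "'b \<Rightarrow> 'b covec"
  defines "K \<equiv> sectional_curvature (prod_atlas A1 A2) g P D"
    and "K1 \<equiv> sectional_curvature A1 g1 P1 D1"
    and "K2 \<equiv> sectional_curvature A2 g2 P2 D2"
    and "J1df \<equiv> endo_J A1 g1 P1 (exterior_d A1 f)"
    and "d\<mu> \<equiv> exterior_d A1 \<mu>"
    and "J2\<beta>2 \<equiv> endo_J A2 g2 P2 \<beta>2"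
  assumes "smooth_atlas A1" and "smooth_atlas A2"
    and "pseudo_riemannian A1 gt1" and "pseudo_riemannian A2 gt2"
    and "g1 = cometric A1 gt1" and "g2 = cometric A2 gt2"
    and "bivector_field A1 P1" and "bivector_field A2 P2"
    and "f \<in> smooth_functions A1" and "\<forall>p. f p > 0"
    and "\<mu> \<in> smooth_functions A1"
    and "warped_metric A1 A2 f g1 g2 g"
    and "warped_bivector A1 A2 \<mu> P1 P2 P"
    and "levi_civita_connection A1 g1 P1 D1"
    and "levi_civita_connection A2 g2 P2 D2"
    and "levi_civita_connection (prod_atlas A1 A2) g P D"
    and "\<alpha>1 \<in> one_forms A1" and "\<beta>1 \<in> one_forms A1"
    and "\<alpha>2 \<in> one_forms A2" and "\<beta>2 \<in> one_forms A2"
  shows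
    "(\<forall>p q. gram g (hlift A1 A2 \<alpha>1) (hlift A1 A2 \<beta>1) (p, q) \<noteq> 0 \<longrightarrow> gram g1 \<alpha>1 \<beta>1 p \<noteq> 0 \<longrightarrow>
        K (hlift A1 A2 \<alpha>1) (hlift A1 A2 \<beta>1) (p, q) = K1 \<alpha>1 \<beta>1 p) \<and>
     (\<forall>p q. gram g (hlift A1 A2 \<alpha>1) (vlift A1 A2 \<beta>2) (p, q) \<noteq> 0 \<longrightarrow>
        K (hlift A1 A2 \<alpha>1) (vlift A1 A2 \<beta>2) (p, q) =
          (tensor_pair g1 d\<mu> \<alpha>1 p)\<^sup>2 / (4 * (f p)\<^sup>2 * tensor_pair g1 \<alpha>1 \<alpha>1 p)
            * (tensor_pair g2 J2\<beta>2 J2\<beta>2 q / tensor_pair g2 \<beta>2 \<beta>2 q)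
          + ((tensor_pair g1 J1df \<alpha>1 p)\<^sup>2 / (4 * (f p)\<^sup>2 * tensor_pair g1 \<alpha>1 \<alpha>1 p)
             + tensor_pair g1 (D1 \<alpha>1 J1df) \<alpha>1 p / (2 * f p * tensor_pair g1 \<alpha>1 \<alpha>1 p))) \<and>
     (\<forall>p q. gram g (vlift A1 A2 \<alpha>2) (vlift A1 A2 \<beta>2) (p, q) \<noteq> 0 \<longrightarrow> gram g2 \<alpha>2 \<beta>2 q \<noteq> 0 \<longrightarrow>
        K (vlift A1 A2 \<alpha>2) (vlift A1 A2 \<beta>2) (p, q) =
          (\<mu> p)\<^sup>2 / f p * K2 \<alpha>2 \<beta>2 q
          - tensor_pair g1 d\<mu> d\<mu> p / (4 * (f p)\<^sup>2)
            * (3 * (tensor_pair P2 \<alpha>2 \<beta>2 q)\<^sup>2 / gram g2 \<alpha>2 \<beta>2 q)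
          - tensor_pair g1 J1df J1df p / (4 * (f p)\<^sup>2)
          + tensor_pair g1 d\<mu> J1df p / (2 * (f p)\<^sup>2)
            * (tensor_pair P2 \<alpha>2 \<beta>2 q * tensor_pair g2 \<alpha>2 \<beta>2 q / gram g2 \<alpha>2 \<beta>2 q))"
proof -
  interpret warped_levi_civita_manifold A1 A2 P1 P2 P \<mu> gt1 gt2 f g D1 D2 D
    by unfold_locales (use assms(7-) in auto)
  show ?thesis
    \<comment> \<open>These are the six \<open>defines\<close> equations and the identification of
      g1 and g2 with the cometrics, after which the statement is in the vocabulary of the
      locale.\<close>
    unfolding assms(1-6,11,12)
    using sectional_curvature_hh[OF \<open>\<alpha>1 \<in> one_forms A1\<close> \<open>\<beta>1 \<in> one_forms A1\<close>]
      sectional_curvature_hv[OF \<open>\<alpha>1 \<in> one_forms A1\<close> \<open>\<beta>2 \<in> one_forms A2\<close>]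
      sectional_curvature_vv[OF \<open>\<alpha>2 \<in> one_forms A2\<close> \<open>\<beta>2 \<in> one_forms A2\<close>]
    by blast
qed

end
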